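(* Assume the tree matrix is transient. Let $h:I\to\mathbb R$ be a harmonic function such that $\lim h=\varphi$ $\mu$-a.e. (for example if $h$ is bounded). Assume that $\varphi$ is a simple function, that is $\varphi\in\mathcal D$ (in particular $\varphi$ is in the domain of $W^{-1}$). Then for all $i\in I$ $$h(i)=\int_{\partial_\infty}U_{i\xi}\,(W^{-1}\varphi)(\xi)\,\mu(d\xi).$$
   Context: Tree and matrix. $(I,\mathcal T)$ is a connected, locally finite, non-oriented tree with countably infinite set of sites $I$ and root $r$, every branch being infinite (each site has at least one successor). $|i|$ is the distance from $i$ to $r$; $i^-$ ($i\ne r$) is the neighbour of $i$ closer to $r$; $S_i=\{j:j^-=i\}$; $i\wedge j$ is the common vertex, farthest from $r$, of the geodesics from $r$ to $i$ and to $j$. $w:\mathbb N=\{0,1,\dots\}\to(0,\infty)$ is strictly increasing, $w_{-1}=0$. $U_{ij}=w_{|i\wedge j|}$. The matrix $Q$ is: $Q_{ii^-}=Q_{i^-i}=(w_{|i|}-w_{|i|-1})^{-1}$ for $i\neq r$, $Q_{ii}=-\big((w_{|i|}-w_{|i|-1})^{-1}+|S_i|(w_{|i|+1}-w_{|i|})^{-1}\big)$, and $0$ otherwise. A function $h:I\to\mathbb R$ is harmonic if $\sum_jQ_{ij}h(j)=0$ for all $i\in I$ (including $i=r$). Boundary. $\partial_\infty$ is the set of infinite geodesic rays $\xi=(\xi(n))_{n\ge0}$ with $\xi(0)=r$, $\xi(n+1)\in S_{\xi(n)}$, with the compact topology generated by the sets $\partial_\infty(i)=\{\xi:\xi(|i|)=i\}$,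 $i\in I$. For $\xi\ne\eta$, $|\xi\wedge\eta|=\max\{n:\xi(n)=\eta(n)\}$, $U_{\xi\eta}=w_{|\xi\wedge\eta|}$ and $U_{\xi\xi}=\lim_n w_n\in(0,\infty]$; for $i\in I$, $U_{i\xi}=w_{|i\wedge\xi|}$, where $|i\wedge\xi|$ is the largest level of a common vertex of the geodesic from $r$ to $i$ and the ray $\xi$. For an extended-real function $\varphi$ on $\partial_\infty$, $\lim h=\varphi$ $\mu$-a.e. means $h(\xi(n))\to\varphi(\xi)$ as $n\to\infty$ for $\mu$-a.e. $\xi$. Process. $X$ is the minimal continuous-time Markov chain on $I$ with $q$-matrix $Q$, absorbed from $r$ at rate $1/w_0$ in an extra state $\partial_r$; $\zeta$ is its lifetime (minimum of absorption and explosion times, possibly $\infty$). $X_\zeta=\partial_r$ if absorption occurs, and otherwise $X_\zeta\in\partial_\infty$ is the a.s. existing limit of $X_t$ as $t\uparrow\zeta$. Transient means $\mathbb P_r\{X_\zeta\in\partial_\infty\}>0$; $\mu(\cdot)=\mathbb P_r\{X_\zeta\in\cdot\mid X_\zeta\in\partial_\infty\}$. Operator. $\mathcal F_n$ is the finite $\sigma$-field generated by the sets $\partial_\infty(i)$ with $|i|=n$; $\mathcal D=\bigcup_nL^2(\mathcal F_n,\mu)$ is the set of simple functions. $Wf(\eta)=\int_{\partial_\infty}U_{\eta\xi}f(\xi)\mu(d\xi)$ defines a bounded injective self-adjoint operator on $L^2(\mu)$ whose image contains $\mathcal D$; $W^{-1}$ is its inverse, with domain $W(L^2(\mu))$.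
   Formalization: The formal theorem additionally assumes that h is bounded; without this the claim fails (on the binary tree with w_n = n+1 there is an unbounded harmonic h with h(r) = 1 and limit 0 μ-a.e.), and every h satisfying the formula is bounded. *)

theory Defs
  imports "HOL-Probability.Probability"
begin

text \<open>The sites are all elements of the type \<open>'a\<close>; \<open>adj\<close> is the neighbour relation of the tree.\<close>

locale rooted_tree =
  fixes adj :: "'a \<Rightarrow> 'a \<Rightarrow> bool" and r :: 'a
  assumes adj_sym: "adj i j \<Longrightarrow> adj j i"
    and adj_irrefl: "\<not> adj i i"
    and connected_tree: "adj\<^sup>*\<^sup>* i j"
    and no_cycle: "\<not> (\<exists>p. length p \<ge> 3 \<and> distinct p \<and> successively adj p \<and> adj (last p) (hd p))"
    and locally_finite: "finite {j. adj i j}"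
    and infinite_sites: "infinite (UNIV :: 'a set)"
    and countable_sites: "countable (UNIV :: 'a set)"
begin

definition tdist :: "'a \<Rightarrow> 'a \<Rightarrow> nat" where
  "tdist i j = (LEAST n. (adj ^^ n) i j)"

definition level :: "'a \<Rightarrow> nat" where
  "level i = tdist r i"

definition geodesic :: "'a list \<Rightarrow> 'a \<Rightarrow> 'a \<Rightarrow> bool" where
  "geodesic p i j \<longleftrightarrow>
     length p = Suc (tdist i j) \<and> successively adj p \<and> hd p = i \<and> last p = j"

definition geo :: "'a \<Rightarrow> 'a set" where
  "geo i = {k. \<exists>p. geodesic p r i \<and> k \<in> set p}"

definition pred :: "'a \<Rightarrow> 'a" where
  "pred i = (THE j. adj i j \<and> level j < level i)"

definition succs :: "'a \<Rightarrow> 'a set" where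
  "succs i = {j. j \<noteq> r \<and> pred j = i}"

definition rays :: "(nat \<Rightarrow> 'a) set" where
  "rays = {\<xi>. \<xi> 0 = r \<and> (\<forall>n. \<xi> (Suc n) \<in> succs (\<xi> n))}"

definition cyl :: "'a \<Rightarrow> (nat \<Rightarrow> 'a) set" where
  "cyl i = {\<xi> \<in> rays. \<xi> (level i) = i}"

text \<open>As there are only countably many cylinders, the \<open>\<sigma>\<close>-field they generate is the Borel
  \<open>\<sigma>\<close>-field of the boundary.\<close>

definition boundary_space :: "(nat \<Rightarrow> 'a) measure" where
  "boundary_space = sigma rays (range cyl)"

definition level_field :: "nat \<Rightarrow> (nat \<Rightarrow> 'a) measure" where
  "level_field n = sigma rays (cyl ` {i. level i = n})"

definition meet_level :: "'a \<Rightarrow> (nat \<Rightarrow> 'a) \<Rightarrow> nat" where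
  "meet_level i \<xi> = Max (level ` (geo i \<inter> range \<xi>))"

definition ray_meet_level :: "(nat \<Rightarrow> 'a) \<Rightarrow> (nat \<Rightarrow> 'a) \<Rightarrow> nat" where
  "ray_meet_level \<xi> \<eta> = Max {n. \<xi> n = \<eta> n}"

end

locale tree_matrix = rooted_tree adj r
  for adj :: "'a \<Rightarrow> 'a \<Rightarrow> bool" and r :: 'a +
  fixes w :: "nat \<Rightarrow> real"
  assumes succs_nonempty: "succs i \<noteq> {}"
    and w_pos: "w n > 0"
    and w_strict_mono: "strict_mono w"
begin

text \<open>The increment \<open>w\<^sub>n - w\<^sub>n\<^sub>-\<^sub>1\<close>, with \<open>w\<^sub>-\<^sub>1 = 0\<close>.\<close>

definition incr :: "nat \<Rightarrow> real" where
  "incr n = w n - (case n of 0 \<Rightarrow> 0 | Suc m \<Rightarrow> w m)"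

definition Q :: "'a \<Rightarrow> 'a \<Rightarrow> real" where
  "Q i j =
    (if i = j then - (1 / incr (level i) + real (card (succs i)) / incr (Suc (level i)))
     else if i \<noteq> r \<and> j = pred i then 1 / incr (level i)
     else if j \<noteq> r \<and> i = pred j then 1 / incr (level j)
     else 0)"

definition harmonic :: "('a \<Rightarrow> real) \<Rightarrow> bool" where
  "harmonic h \<longleftrightarrow> (\<forall>i. ((\<lambda>j. Q i j * h j) has_sum 0) UNIV)"

definition U_site :: "'a \<Rightarrow> (nat \<Rightarrow> 'a) \<Rightarrow> real" where
  "U_site i \<xi> = w (meet_level i \<xi>)"

definition U_ray :: "(nat \<Rightarrow> 'a) \<Rightarrow> (nat \<Rightarrow> 'a) \<Rightarrow> ennreal" where
  "U_ray \<xi> \<eta> =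
    (if \<xi> = \<eta> then lim (\<lambda>n. ennreal (w n)) else ennreal (w (ray_meet_level \<xi> \<eta>)))"

definition L2 :: "'x measure \<Rightarrow> ('x \<Rightarrow> real) set" where
  "L2 N = {f \<in> borel_measurable N. integrable N (\<lambda>x. (f x)\<^sup>2)}"

definition simple_fns :: "(nat \<Rightarrow> 'a) measure \<Rightarrow> ((nat \<Rightarrow> 'a) \<Rightarrow> real) set" where
  "simple_fns \<mu> = (\<Union>n. L2 (restr_to_subalg \<mu> (level_field n)))"

text \<open>The kernel may be infinite on the diagonal, so the integral is written as the difference of
  the integrals of the positive and the negative part.\<close>

definition W :: "(nat \<Rightarrow> 'a) measure \<Rightarrow> ((nat \<Rightarrow> 'a) \<Rightarrow> real) \<Rightarrow> (nat \<Rightarrow> 'a) \<Rightarrow> real" where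
  "W \<mu> f \<eta> = enn2real (\<integral>\<^sup>+\<xi>. U_ray \<eta> \<xi> * ennreal (f \<xi>) \<partial>\<mu>)
            - enn2real (\<integral>\<^sup>+\<xi>. U_ray \<eta> \<xi> * ennreal (- f \<xi>) \<partial>\<mu>)"

text \<open>Elements of \<open>L\<^sup>2\<close> are represented by functions; \<open>W_inv \<mu> \<phi>\<close> is a representative of
  the preimage, which is unique up to \<open>\<mu>\<close>-null sets because \<open>W\<close> is injective on
  \<open>L\<^sup>2\<close>.\<close>

definition dom_W_inv :: "(nat \<Rightarrow> 'a) measure \<Rightarrow> ((nat \<Rightarrow> 'a) \<Rightarrow> real) set" where
  "dom_W_inv \<mu> = {\<phi> \<in> L2 \<mu>. \<exists>f \<in> L2 \<mu>. AE \<eta> in \<mu>. W \<mu> f \<eta> = \<phi> \<eta>}"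

definition W_inv ::
  "(nat \<Rightarrow> 'a) measure \<Rightarrow> ((nat \<Rightarrow> 'a) \<Rightarrow> real) \<Rightarrow> (nat \<Rightarrow> 'a) \<Rightarrow> real" where
  "W_inv \<mu> \<phi> = (SOME f. f \<in> L2 \<mu> \<and> (AE \<eta> in \<mu>. W \<mu> f \<eta> = \<phi> \<eta>))"

text \<open>The state \<open>None\<close> is the extra state in which the chain is absorbed from the root at rate
  \<open>1 / w 0\<close>.\<close>

definition exit_rate :: "'a \<Rightarrow> real" where
  "exit_rate i = - Q i i"

fun jump_prob :: "'a \<Rightarrow> 'a option \<Rightarrow> real" where
  "jump_prob i (Some j) = (if i = j then 0 else Q i j / exit_rate i)"
| "jump_prob i None = (if i = r then (1 / w 0) / exit_rate i else 0)"

end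

text \<open>The minimal chain started at \<open>r\<close>, given by its jump chain \<open>Y\<close> and its holding times
  \<open>T\<close>: \<open>jump_law\<close> says that \<open>Y\<close> has transition probabilities \<open>jump_prob\<close> and that, given
  \<open>Y\<close>, the holding times before absorption are independent, \<open>T k\<close> being exponential with
  parameter \<open>exit_rate (Y k)\<close>. After absorption \<open>T\<close> is irrelevant.\<close>

locale minimal_chain = tree_matrix adj r w + prob_space M
  for adj :: "'a \<Rightarrow> 'a \<Rightarrow> bool" and r :: 'a and w :: "nat \<Rightarrow> real" and M :: "'b measure" +
  fixes Y :: "nat \<Rightarrow> 'b \<Rightarrow> 'a option" and T :: "nat \<Rightarrow> 'b \<Rightarrow> real"
  assumes Y_measurable: "Y n \<in> measurable M (count_space UNIV)"
    and T_measurable: "T n \<in> borel_measurable M"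
    and T_pos: "\<omega> \<in> space M \<Longrightarrow> T n \<omega> > 0"
    and Y_start: "\<omega> \<in> space M \<Longrightarrow> Y 0 \<omega> = Some r"
    and Y_absorbed: "\<omega> \<in> space M \<Longrightarrow> Y n \<omega> = None \<Longrightarrow> Y (Suc n) \<omega> = None"
    and jump_law: "x 0 = Some r \<Longrightarrow> (\<And>k. k < n \<Longrightarrow> x k \<noteq> None) \<Longrightarrow> (\<And>k. k < n \<Longrightarrow> t k \<ge> 0) \<Longrightarrow>
      prob {\<omega> \<in> space M. (\<forall>k\<le>n. Y k \<omega> = x k) \<and> (\<forall>k<n. T k \<omega> > t k)} =
      (\<Prod>k<n. jump_prob (the (x k)) (x (Suc k)) * exp (- exit_rate (the (x k)) * t k))"
begin

definition jump_time :: "nat \<Rightarrow> 'b \<Rightarrow> real" where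
  "jump_time n \<omega> = (\<Sum>k<n. T k \<omega>)"

text \<open>The lifetime, i.e. the absorption time if there is one and otherwise the explosion time.\<close>

definition lifetime :: "'b \<Rightarrow> ennreal" where
  "lifetime \<omega> = (\<Sum>k. if Y k \<omega> = None then 0 else ennreal (T k \<omega>))"

definition X :: "real \<Rightarrow> 'b \<Rightarrow> 'a option" where
  "X t \<omega> = (if ennreal t < lifetime \<omega>
     then Y (THE n. jump_time n \<omega> \<le> t \<and> t < jump_time (Suc n) \<omega>) \<omega> else None)"

definition absorbed :: "'b \<Rightarrow> bool" where
  "absorbed \<omega> \<longleftrightarrow> (\<exists>n. Y n \<omega> = None)"

text \<open>Convergence of \<open>X t\<close> to the ray \<open>\<xi>\<close> as \<open>t\<close> increases to the lifetime: every branch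
  \<open>{i. \<xi> n \<in> geo i}\<close> eventually contains \<open>X t\<close>.\<close>

definition tends_to_ray :: "'b \<Rightarrow> (nat \<Rightarrow> 'a) \<Rightarrow> bool" where
  "tends_to_ray \<omega> \<xi> \<longleftrightarrow> (\<forall>n. \<exists>s\<ge>0. ennreal s < lifetime \<omega> \<and>
     (\<forall>t\<ge>s. ennreal t < lifetime \<omega> \<longrightarrow> (\<exists>i. X t \<omega> = Some i \<and> \<xi> n \<in> geo i)))"

text \<open>The event that \<open>X\<close> at its lifetime lies in the set \<open>A\<close> of rays.\<close>

definition exits_in :: "(nat \<Rightarrow> 'a) set \<Rightarrow> 'b set" where
  "exits_in A = {\<omega> \<in> space M. \<not> absorbed \<omega> \<and> (\<exists>\<xi> \<in> A. tends_to_ray \<omega> \<xi>)}"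

definition transient :: bool where
  "transient \<longleftrightarrow> prob (exits_in rays) > 0"

definition exit_law :: "(nat \<Rightarrow> 'a) measure" where
  "exit_law = measure_of rays (sets boundary_space)
     (\<lambda>A. emeasure M (exits_in A) / emeasure M (exits_in rays))"

end

text \<open>The representation theorem is stated for bounded harmonic functions: a limit along almost
  every ray does not by itself determine a harmonic function. On the binary tree with
  \<open>w n = n + 1\<close> put \<open>\<nu> r = h r\<close> and \<open>\<nu> i = h i - h (pred i)\<close>; then \<open>h\<close> is harmonic iff each
  \<open>\<nu> i\<close> is the sum of \<open>\<nu>\<close> over the two successors of \<open>i\<close>. Start with \<open>h r = 1\<close>. At a site
  with \<open>h i \<noteq> 0\<close> give the successors the values \<open>- h i\<close> and \<open>\<nu> i + h i\<close>, so that \<open>h = 0\<close> at the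
  first one; at a site with \<open>h i = 0\<close> give them the values \<open>0\<close> and \<open>\<nu> i\<close>, so that \<open>h = \<nu> = 0\<close> at
  the first one, hence on the whole branch below it. Along almost every ray such a branch is
  entered, so \<open>h\<close> has limit \<open>0\<close> almost everywhere although \<open>h r = 1\<close>.
  Conversely, for simple \<open>\<phi>\<close> the right-hand side of the representation is bounded in \<open>i\<close>, so
  no function for which the representation holds is excluded.\<close>

end

theory Submission
  imports Defs
begin

text \<open>For integrable \<open>f\<close> let \<open>F i\<close> be the integral of \<open>f\<close> over \<open>\<partial>\<^sub>\<infinity>(i)\<close>. The function
  \<open>g i = (\<Sum>k\<le>|i|. (w k - w (k - 1)) * F (i k))\<close>, where \<open>i k\<close> is the ancestor of \<open>i\<close> at
  level \<open>k\<close> and \<open>w (-1) = 0\<close>, is the integral of \<open>U\<^sub>i f\<close>. Because \<open>F\<close> is additive, \<open>g\<close> is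
  harmonic, and it converges to \<open>W f\<close> along almost every ray.

  Let \<open>v\<close> be the Green function of the root, extended by \<open>w 0\<close> to a parent of the root, and \<open>p\<close>
  the probability of exit through the boundary. The net flux of the chain through the edge above
  \<open>i\<close> is \<open>p \<mu>(\<partial>\<^sub>\<infinity>(i)) = (v (i\<^sup>-) - v i) / (w |i| - w (|i| - 1))\<close>. By the maximal
  inequality for superharmonic functions \<open>v\<close> tends to 0 along almost every ray, so the sums telescope
  and \<open>W\<close> maps the indicator of \<open>\<partial>\<^sub>\<infinity>(i)\<close> to \<open>v (i\<^sup>-) / p\<close> times itself plus a
  combination of the indicators of the larger sets around it. By induction on the level every
  simple \<open>\<phi>\<close> is \<open>W f\<close> for a bounded \<open>f\<close>; by self-adjointness of \<open>W\<close> the function \<open>F\<close>,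
  hence \<open>g\<close>, is the same for every preimage of \<open>\<phi>\<close>. Finally, a bounded harmonic function is
  determined by its limits along the rays, again by the maximal inequality.\<close>

section \<open>Rooted trees\<close>

text \<open>Only the chain started at \<open>r\<close> is given. A start at \<open>i\<close> is
  replaced by restricting to the event \<open>Y n = Some i\<close>, for some \<open>n\<close> that
  gives it positive probability. Reversibility enters through the symmetry of \<open>Q\<close>,
  which turns the forward equation for occupation times into a mean over one jump. Statements about
  almost every ray and about almost every path are exchanged by the fact that a path which is not
  absorbed almost surely passes through every vertex of its exit ray, the one of level
  \<open>n\<close> at time \<open>n\<close> or later.

  Two obstacles shape the second half. The kernel may be infinite on the diagonal, and
  \<open>W_inv\<close> is an arbitrary choice among square integrable preimages, known only through
  its defining equation. Hence the kernel is expanded into indicators of cylinders, where each level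
  contributes a finite sum, and two preimages are compared only through their integrals over
  cylinders, which are all that the integral of \<open>U_site i\<close> against them depends
  on.\<close>

context rooted_tree
begin

section \<open>Levels and parents in a tree without cycles\<close>

lemma adj_commute: "adj i j \<longleftrightarrow> adj j i"
  using adj_sym[of i j] adj_sym[of j i] by blast

lemma level_root [simp]: "level r = 0"
  unfolding level_def tdist_def by (rule Least_eq_0) simp

lemma relpow_level: "(adj ^^ level i) r i"
proof -
  obtain n where "(adj ^^ n) r i"
    using connected_tree[of r i] by (auto simp: rtranclp_power)
  then show ?thesis unfolding level_def tdist_def by (rule LeastI)
qed

lemma level_le: "(adj ^^ n) r i \<Longrightarrow> level i \<le> n"
  unfolding level_def tdist_def by (rule Least_le)

lemma level_eq_0_iff [simp]: "level i = 0 \<longleftrightarrow> i = r"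
  using relpow_level[of i] by auto

lemma level_adj: "adj i j \<Longrightarrow> level j \<le> Suc (level i)"
  using relpow_level[of i] by (intro level_le) auto

lemma ex_parent: "i \<noteq> r \<Longrightarrow> \<exists>j. adj i j \<and> level i = Suc (level j)"
proof -
  assume "i \<noteq> r"
  then obtain n where n: "level i = Suc n" by (metis level_eq_0_iff not0_implies_Suc)
  with relpow_level[of i] obtain j where j: "(adj ^^ n) r j" "adj j i" by auto
  from level_le[OF j(1)] level_adj[OF j(2)] n have "level j = n" by simp
  with j n adj_commute show ?thesis by blast
qed

text \<open>Climbing from both sites to their parents until the two lines meet gives the path. As it
  stays within levels up to \<open>n\<close>, an edge between its ends, or a common neighbour of the
  ends at level \<open>n + 1\<close>, would close it to a cycle. The first excludes edges within a
  level, the second excludes two parents.\<close>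

lemma ex_path_below:
  assumes "level x = n" "level y = n" "x \<noteq> y"
  shows "\<exists>p. hd p = x \<and> last p = y \<and> distinct p \<and> successively adj p \<and> 3 \<le> length p \<and>
    (\<forall>z\<in>set p. level z \<le> n)"
  using assms
proof (induction n arbitrary: x y)
  case 0
  then show ?case by simp
next
  case (Suc n)
  then have "x \<noteq> r" "y \<noteq> r" by auto
  then obtain x' y' where x': "adj x x'" "level x' = n" and y': "adj y y'" "level y' = n"
    using ex_parent[of x] ex_parent[of y] Suc.prems(1,2) by auto
  show ?case
  proof (cases "x' = y'")
    case True
    have "x \<noteq> x'" "y \<noteq> x'" using Suc.prems(1,2) x'(2) by (metis n_not_Suc_n)+
    then have "distinct [x, x', y]" "successively adj [x, x', y]"
      "\<forall>z\<in>set [x, x', y]. level z \<le> Suc n"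
      using True x' adj_sym[OF y'(1)] Suc.prems by simp_all
    moreover have "hd [x, x', y] = x" "last [x, x', y] = y" "3 \<le> length [x, x', y]" by simp_all
    ultimately show ?thesis by blast
  next
    case False
    from Suc.IH[OF x'(2) y'(2) False] obtain p where p: "hd p = x'" "last p = y'" "distinct p"
      "successively adj p" "3 \<le> length p" "\<forall>z\<in>set p. level z \<le> n" by blast
    have "x \<notin> set p" "y \<notin> set p" using p(6) Suc.prems(1,2) by (metis Suc_n_not_le_n)+
    moreover have "p \<noteq> []" using p(5) by auto
    ultimately have "hd (x # p @ [y]) = x" "last (x # p @ [y]) = y" "distinct (x # p @ [y])"
      "successively adj (x # p @ [y])" "3 \<le> length (x # p @ [y])"
      "\<forall>z\<in>set (x # p @ [y]). level z \<le> Suc n"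
      using p x' adj_sym[OF y'(1)] Suc.prems
      by (simp_all add: successively_Cons successively_append_iff le_SucI)
    then show ?thesis by blast
  qed
qed

lemma adj_level_neq: "adj i j \<Longrightarrow> level i \<noteq> level j"
proof
  assume adj: "adj i j" and "level i = level j"
  moreover from adj have "i \<noteq> j" using adj_irrefl by auto
  ultimately obtain p where "hd p = i" "last p = j" "distinct p" "successively adj p" "3 \<le> length p"
    using ex_path_below[of i _ j] by auto
  with no_cycle adj adj_commute show False by blast
qed

lemma parent_unique:
  assumes "adj i x" "adj i y" "level i = Suc (level x)" "level i = Suc (level y)"
  shows "x = y"
proof (rule ccontr)
  assume "x \<noteq> y"
  with assms obtain p where p: "hd p = x" "last p = y" "distinct p" "successively adj p"
    "3 \<le> length p" "\<forall>z\<in>set p. level z \<le> level x"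
    using ex_path_below[of x "level x" y] by auto
  have "i \<notin> set p" using p(6) assms(3) by (metis Suc_n_not_le_n)
  then have "3 \<le> length (i # p)" "distinct (i # p)" "successively adj (i # p)"
    "adj (last (i # p)) (hd (i # p))"
    using p assms adj_commute by (auto simp: successively_Cons)
  with no_cycle show False by blast
qed

lemma pred_props:
  assumes "i \<noteq> r"
  shows adj_pred: "adj i (pred i)" and level_pred: "level i = Suc (level (pred i))"
proof -
  obtain j where j: "adj i j" "level i = Suc (level j)" using ex_parent[OF assms] by blast
  have "\<exists>!j. adj i j \<and> level j < level i"
  proof (rule ex1I[of _ j])
    show "adj i j \<and> level j < level i" using j by simp
    fix k assume k: "adj i k \<and> level k < level i"
    then have "level i = Suc (level k)" using level_adj[of k i] adj_commute by force
    with k j show "k = j" using parent_unique by blast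
  qed
  then have *: "adj i (pred i) \<and> level (pred i) < level i"
    unfolding pred_def by (rule theI')
  then show "adj i (pred i)" by simp
  from * level_adj[of "pred i" i] adj_commute show "level i = Suc (level (pred i))" by force
qed

lemma pred_eqI: "adj i j \<Longrightarrow> level j < level i \<Longrightarrow> pred i = j"
proof -
  assume a: "adj i j" "level j < level i"
  then have "i \<noteq> r" by auto
  moreover from a have "level i = Suc (level j)" using level_adj[of j i] adj_commute by force
  ultimately show ?thesis using parent_unique[of i "pred i" j] pred_props a by blast
qed

lemma adj_iff: "adj i j \<longleftrightarrow> i \<noteq> r \<and> pred i = j \<or> j \<noteq> r \<and> pred j = i"
proof
  assume a: "adj i j"
  then consider "level j < level i" | "level i < level j" using adj_level_neq by (metis nat_neq_iff)
  then show "i \<noteq> r \<and> pred i = j \<or> j \<noteq> r \<and> pred j = i"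
    using a adj_commute pred_eqI by cases (metis level_eq_0_iff not_less0)+
next
  assume "i \<noteq> r \<and> pred i = j \<or> j \<noteq> r \<and> pred j = i"
  then show "adj i j" using adj_pred adj_commute by blast
qed

lemma finite_succs [simp]: "finite (succs i)"
  by (rule finite_subset[OF _ locally_finite[of i]]) (auto simp: succs_def adj_iff)

lemma level_succs: "j \<in> succs i \<Longrightarrow> level j = Suc (level i)"
  using level_pred by (auto simp: succs_def)

lemma finite_ball: "finite {i. level i \<le> n}"
proof (induction n)
  case 0
  then show ?case by simp
next
  case (Suc n)
  have "{i. level i \<le> Suc n} \<subseteq> insert r (\<Union>j\<in>{i. level i \<le> n}. succs j)"
  proof
    fix i assume "i \<in> {i. level i \<le> Suc n}"
    then show "i \<in> insert r (\<Union>j\<in>{i. level i \<le> n}. succs j)"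
      using level_pred[of i] by (cases "i = r") (auto simp: succs_def)
  qed
  moreover have "finite (insert r (\<Union>j\<in>{i. level i \<le> n}. succs j))"
    using Suc by (intro finite.insertI finite_UN_I finite_succs)
  ultimately show ?case by (rule finite_subset)
qed

section \<open>Geodesics from the root and ancestors\<close>

lemma geo_root: "geo r = {r}"
proof -
  have "geodesic p r r \<longleftrightarrow> p = [r]" for p
    by (cases p) (auto simp: geodesic_def level_def[symmetric])
  then show ?thesis by (auto simp: geo_def)
qed

lemma relpow_successively:
  "successively adj p \<Longrightarrow> p \<noteq> [] \<Longrightarrow> (adj ^^ (length p - 1)) (hd p) (last p)"
proof (induction p rule: rev_induct)
  case Nil
  then show ?case by simp
next
  case (snoc x p)
  show ?case
  proof (cases "p = []")
    case True
    then show ?thesis by simp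
  next
    case False
    with snoc.prems have "successively adj p" "adj (last p) x"
      by (auto simp: successively_append_iff)
    then have "(adj ^^ Suc (length p - 1)) (hd p) x"
      using snoc.IH[OF _ False] unfolding relpow.simps relpowp.simps by blast
    moreover from False have "Suc (length p - 1) = length (p @ [x]) - 1" by (cases p) auto
    ultimately have "(adj ^^ (length (p @ [x]) - 1)) (hd p) x" by (simp only:)
    then show ?thesis using False by simp
  qed
qed

text \<open>A geodesic has no spare step: without its last vertex \<open>i\<close> it is a path of
  \<open>level i - 1\<close> edges from the root, so it ends at a neighbour of \<open>i\<close>
  closer to the root, and this can only be the parent.\<close>

lemma geodesic_snoc_iff:
  assumes "i \<noteq> r"
  shows "geodesic p r i \<longleftrightarrow> (\<exists>q. p = q @ [i] \<and> geodesic q r (pred i))"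
proof
  assume p: "geodesic p r i"
  then have len: "length p = Suc (level i)" and ne: "p \<noteq> []"
    by (auto simp: geodesic_def level_def)
  then obtain q where q: "p = q @ [i]"
    using p by (cases p rule: rev_cases) (auto simp: geodesic_def)
  have qne: "q \<noteq> []" using len q assms by auto
  have s: "successively adj q" "adj (last q) i" "hd q = r"
    using p q qne by (auto simp: geodesic_def successively_append_iff)
  have "level (last q) \<le> length q - 1"
    using relpow_successively[OF s(1) qne] s(3) level_le by simp
  then have "level (last q) < level i" using len q qne by (cases q) auto
  then have "pred i = last q" using s adj_commute pred_eqI by blast
  then have "geodesic q r (pred i)"
    using s len q level_pred[OF assms] by (simp add: geodesic_def level_def)
  with q show "\<exists>q. p = q @ [i] \<and> geodesic q r (pred i)" by blast
next
  assume "\<exists>q. p = q @ [i] \<and> geodesic q r (pred i)"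
  then show "geodesic p r i"
    using level_pred[OF assms] adj_pred[OF assms] adj_commute
    by (auto simp: geodesic_def level_def successively_append_iff hd_append)
qed

lemma geo_rec: "i \<noteq> r \<Longrightarrow> geo i = insert i (geo (pred i))"
proof -
  assume i: "i \<noteq> r"
  \<comment> \<open>That \<open>i\<close> belongs to \<open>geo i\<close> at all requires a geodesic
    to exist; without one, \<open>geo i\<close> would be empty.\<close>
  have "\<exists>q. geodesic q r (pred i)"
  proof -
    have "\<exists>p. successively adj p \<and> p \<noteq> [] \<and> hd p = r \<and> last p = x \<and> length p = Suc n"
      if "(adj ^^ n) r x" for n x
      using that
    proof (induction n arbitrary: x)
      case 0
      then show ?case by (intro exI[of _ "[r]"]) auto
    next
      case (Suc n)
      then obtain y where "(adj ^^ n) r y" "adj y x" by auto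
      with Suc.IH[of y] obtain p where "successively adj p" "p \<noteq> []" "hd p = r" "last p = y"
        "length p = Suc n" by auto
      with \<open>adj y x\<close> show ?case
        by (intro exI[of _ "p @ [x]"]) (auto simp: successively_append_iff hd_append)
    qed
    from this[OF relpow_level[of "pred i"]] show ?thesis
      by (auto simp: geodesic_def level_def)
  qed
  then show ?thesis
    unfolding geo_def geodesic_snoc_iff[OF i] by auto
qed

text \<open>For \<open>n > level i\<close> the truncated subtraction gives \<open>i\<close> itself
  and not a site of level \<open>n\<close>; hence the bounds on \<open>n\<close> in the statements
  about \<open>anc\<close>.\<close>

definition anc :: "nat \<Rightarrow> 'a \<Rightarrow> 'a" where
  "anc n i = (pred ^^ (level i - n)) i"

lemma anc_level [simp]: "anc (level i) i = i"
  by (simp add: anc_def)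

lemma anc_pred: "n < level i \<Longrightarrow> anc n i = anc n (pred i)"
proof -
  assume n: "n < level i"
  then have "i \<noteq> r" by auto
  then have "level i - n = Suc (level (pred i) - n)" using level_pred[of i] n by simp
  then show ?thesis by (simp only: anc_def funpow_Suc_right comp_def)
qed

lemma level_induct [case_names root pred]:
  assumes "P r" "\<And>i. i \<noteq> r \<Longrightarrow> P (pred i) \<Longrightarrow> P i"
  shows "P i"
proof (induction "level i" arbitrary: i)
  case 0
  then show ?case using assms by (metis level_eq_0_iff)
next
  case (Suc n)
  then have i: "i \<noteq> r" by auto
  then have "n = level (pred i)" using level_pred[OF i] Suc.hyps(2) by (metis Suc_inject)
  then show ?case using i Suc.hyps(1) assms(2) by blast
qed

lemma level_anc: "n \<le> level i \<Longrightarrow> level (anc n i) = n"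
proof (induction i rule: level_induct)
  case root
  then show ?case using anc_level[of r] by simp
next
  case (pred i)
  show ?case
  proof (cases "n = level i")
    case False
    with pred level_pred[of i] anc_pred[of n i] show ?thesis by simp
  qed simp
qed

lemma anc_0 [simp]: "anc 0 i = r"
  using level_anc[of 0 i] by simp

lemma pred_anc: "Suc n \<le> level i \<Longrightarrow> pred (anc (Suc n) i) = anc n i"
proof -
  assume "Suc n \<le> level i"
  then have "level i - n = Suc (level i - Suc n)" by simp
  then show ?thesis by (simp add: anc_def)
qed

lemma geo_iff: "k \<in> geo i \<longleftrightarrow> level k \<le> level i \<and> anc (level k) i = k"
proof (induction i rule: level_induct)
  case root
  then show ?case using anc_level[of r] by (auto simp: geo_root)
next
  case (pred i)
  have "level k \<le> level i \<and> anc (level k) i = k \<longleftrightarrow>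
    k = i \<or> (level k \<le> level (pred i) \<and> anc (level k) (pred i) = k)"
  proof (cases "level k = level i")
    case True
    then have "anc (level k) i = i" "\<not> level k \<le> level (pred i)"
      using level_pred[OF pred(1)] anc_level[of i] by (metis, metis Suc_n_not_le_n)
    then show ?thesis using True by auto
  next
    case False
    then have "k \<noteq> i" "level k \<le> level i \<longleftrightarrow> level k \<le> level (pred i)"
      using level_pred[OF pred(1)] by auto
    moreover have "anc (level k) i = anc (level k) (pred i)" if "level k \<le> level (pred i)"
      using that level_pred[OF pred(1)] by (intro anc_pred) simp
    ultimately show ?thesis by auto
  qed
  with pred show ?case by (simp add: geo_rec)
qed

lemma anc_anc: "k \<le> n \<Longrightarrow> n \<le> level i \<Longrightarrow> anc k (anc n i) = anc k i"
proof (induction n)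
  case 0
  then show ?case by simp
next
  case (Suc n)
  show ?case
  proof (cases "k = Suc n")
    case True
    with level_anc[of k i] Suc.prems anc_level[of "anc k i"] show ?thesis by simp
  next
    case False
    with Suc have "anc k (anc n i) = anc k i" by simp
    moreover have "anc k (anc (Suc n) i) = anc k (anc n i)"
      using False Suc.prems anc_pred[of k "anc (Suc n) i"]
      by (simp add: level_anc pred_anc)
    ultimately show ?thesis by simp
  qed
qed

definition branch :: "'a \<Rightarrow> 'a set" where
  "branch i = {j. i \<in> geo j}"

lemma branch_iff: "j \<in> branch i \<longleftrightarrow> level i \<le> level j \<and> anc (level i) j = i"
  by (simp add: branch_def geo_iff)

lemma branch_self [simp]: "i \<in> branch i"
  by (simp add: branch_iff)

lemma branch_root [simp]: "branch r = UNIV"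
  by (auto simp: branch_iff)

lemma branch_rec: "j \<noteq> r \<Longrightarrow> j \<in> branch i \<longleftrightarrow> j = i \<or> pred j \<in> branch i"
  by (auto simp: branch_def geo_rec)

lemma root_in_branch [simp]: "r \<in> branch i \<longleftrightarrow> i = r"
  by (auto simp: branch_iff)

lemma pred_notin_branch: "i \<noteq> r \<Longrightarrow> pred i \<notin> branch i"
  using level_pred[of i] by (simp add: branch_iff)

text \<open>The edge between \<open>x\<close> and its parent is the only one that joins the branch
  at \<open>x\<close> to the other sites. For the chain this means that the probability of being in
  a branch changes through a single edge.\<close>

lemma branch_crossing:
  assumes "adj i j"
  shows "j \<in> branch x \<longleftrightarrow> (i \<in> branch x \<and> \<not> (i = x \<and> x \<noteq> r \<and> j = pred x)) \<or> (x \<noteq> r \<and> i = pred x \<and> j = x)"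
proof -
  have *: "pred (pred x) \<noteq> x" if "x \<noteq> r" "pred x \<noteq> r" for x
  proof
    assume "pred (pred x) = x"
    with level_pred[OF that(1)] level_pred[OF that(2)] show False by (metis n_not_Suc_n not_less_eq lessI less_Suc_eq)
  qed
  from assms consider "i \<noteq> r" "j = pred i" | "j \<noteq> r" "i = pred j" by (auto simp: adj_iff)
  then show ?thesis
  proof cases
    case 1
    with branch_rec[of i x] pred_notin_branch[of x] branch_self[of x] show ?thesis by metis
  next
    case 2
    with branch_rec[of j x] *[of j] branch_self[of x] show ?thesis by metis
  qed
qed

lemma anc_adj:
  assumes "adj i j" "n \<le> level i" "n \<le> level j"
  shows "anc n i = anc n j"
proof -
  from assms(1) consider "i \<noteq> r" "j = pred i" | "j \<noteq> r" "i = pred j" by (auto simp: adj_iff)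
  then show ?thesis
  proof cases
    case 1
    with assms level_pred[of i] have "n < level i" by simp
    with anc_pred[of n i] 1 show ?thesis by simp
  next
    case 2
    with assms level_pred[of j] have "n < level j" by simp
    with anc_pred[of n j] 2 show ?thesis by simp
  qed
qed

subsection \<open>Rays\<close>

lemma rays_0: "\<xi> \<in> rays \<Longrightarrow> \<xi> 0 = r"
  and rays_Suc: "\<xi> \<in> rays \<Longrightarrow> \<xi> (Suc n) \<in> succs (\<xi> n)"
  by (auto simp: rays_def)

lemma rays_pred: "\<xi> \<in> rays \<Longrightarrow> pred (\<xi> (Suc n)) = \<xi> n"
  using rays_Suc[of \<xi> n] by (auto simp: succs_def)

lemma level_ray [simp]: "\<xi> \<in> rays \<Longrightarrow> level (\<xi> n) = n"
proof (induction n)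
  case (Suc n)
  then show ?case using level_succs[OF rays_Suc[of \<xi> n]] by simp
qed (simp add: rays_0)

lemma anc_ray: "\<xi> \<in> rays \<Longrightarrow> k \<le> n \<Longrightarrow> anc k (\<xi> n) = \<xi> k"
proof (induction n)
  case 0
  then show ?case by (simp add: rays_0)
next
  case (Suc n)
  show ?case
  proof (cases "k = Suc n")
    case True
    then show ?thesis using anc_level[of "\<xi> (Suc n)"] Suc.prems by simp
  next
    case False
    then show ?thesis using Suc anc_pred[of k "\<xi> (Suc n)"] by (simp add: rays_pred)
  qed
qed

lemma ray_eq_anc_mono: "\<xi> \<in> rays \<Longrightarrow> k \<le> n \<Longrightarrow> n \<le> level i \<Longrightarrow> \<xi> n = anc n i \<Longrightarrow> \<xi> k = anc k i"
  using anc_ray[of \<xi> k n] anc_anc[of k n i] by simp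

lemma ray_eq_mono: "\<xi> \<in> rays \<Longrightarrow> \<eta> \<in> rays \<Longrightarrow> k \<le> n \<Longrightarrow> \<xi> n = \<eta> n \<Longrightarrow> \<xi> k = \<eta> k"
  using anc_ray[of \<xi> k n] anc_ray[of \<eta> k n] by simp

section \<open>Cylinders of rays and meeting levels\<close>

lemma cyl_iff: "\<xi> \<in> cyl i \<longleftrightarrow> \<xi> \<in> rays \<and> \<xi> (level i) = i"
  by (simp add: cyl_def)

lemma cyl_root [simp]: "cyl r = rays"
  by (auto simp: cyl_def rays_0)

lemma cyl_subset_rays: "cyl i \<subseteq> rays"
  by (auto simp: cyl_def)

lemma ray_in_cyl: "\<xi> \<in> rays \<Longrightarrow> \<eta> \<in> cyl (\<xi> n) \<longleftrightarrow> \<eta> \<in> rays \<and> \<eta> n = \<xi> n"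
  by (auto simp: cyl_def)

lemma cyl_anc_iff: "k \<le> level i \<Longrightarrow> \<xi> \<in> cyl (anc k i) \<longleftrightarrow> \<xi> \<in> rays \<and> \<xi> k = anc k i"
  by (simp add: cyl_iff level_anc)

lemma cyl_split: "cyl i = (\<Union>j\<in>succs i. cyl j)"
proof (intro set_eqI iffI)
  fix \<xi> assume "\<xi> \<in> cyl i"
  then show "\<xi> \<in> (\<Union>j\<in>succs i. cyl j)"
    using rays_Suc[of \<xi> "level i"] by (auto simp: cyl_iff intro!: bexI[of _ "\<xi> (Suc (level i))"])
next
  fix \<xi> assume "\<xi> \<in> (\<Union>j\<in>succs i. cyl j)"
  then obtain j where j: "j \<in> succs i" "\<xi> \<in> rays" "\<xi> (level j) = j" by (auto simp: cyl_iff)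
  then have "pred j = \<xi> (level i)" using rays_pred[of \<xi> "level i"] by (simp add: level_succs)
  with j show "\<xi> \<in> cyl i" by (auto simp: cyl_iff succs_def)
qed

lemma disjoint_cyl_level: "disjoint_family_on cyl {i. level i = n}"
  by (auto simp: disjoint_family_on_def cyl_iff)

lemma disjoint_cyl_succs: "disjoint_family_on cyl (succs i)"
  by (rule disjoint_family_on_mono[OF _ disjoint_cyl_level[of "Suc (level i)"]])
    (auto simp: level_succs)

lemma range_cyl_Pow: "range cyl \<subseteq> Pow rays"
  by (auto simp: cyl_def)

lemma space_boundary [simp]: "space boundary_space = rays"
  unfolding boundary_space_def by (simp add: space_measure_of range_cyl_Pow)

lemma cyl_sets [measurable, simp]: "cyl i \<in> sets boundary_space"
  unfolding boundary_space_def using range_cyl_Pow by (simp add: sets_measure_of sigma_sets.Basic)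

lemma countable_sites_set [simp]: "countable (A :: 'a set)"
  using countable_sites by (rule countable_subset[rotated]) simp

lemma geo_subset_ray: "geo i \<inter> range \<xi> = (\<lambda>k. \<xi> k) ` {k. k \<le> level i \<and> \<xi> k = anc k i}"
  if "\<xi> \<in> rays"
proof -
  have "\<xi> k \<in> geo i \<longleftrightarrow> k \<le> level i \<and> \<xi> k = anc k i" for k
    using that by (auto simp: geo_iff)
  then show ?thesis by blast
qed

lemma meet_level_eq:
  assumes "\<xi> \<in> rays"
  shows "meet_level i \<xi> = Max {k. k \<le> level i \<and> \<xi> k = anc k i}"
  unfolding meet_level_def geo_subset_ray[OF assms] image_image using assms
  by (simp cong: image_cong)

text \<open>Balls are finite, so a path with finitely many visits to each site leaves every ball for
  good. A step between sites of level at least \<open>n\<close> does not change their ancestor at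
  level \<open>n\<close>, so these ancestors become constant and make up the ray. From outside, the
  branch at \<open>\<xi> n\<close> can be entered only at \<open>\<xi> n\<close>.\<close>

lemma converges_to_ray:
  assumes y0: "y 0 = r" and adj: "\<And>k. adj (y k) (y (Suc k))"
    and fin: "\<And>i. finite {k. y k = i}"
  shows "\<exists>\<xi>\<in>rays. (\<forall>n. eventually (\<lambda>k. y k \<in> branch (\<xi> n)) sequentially) \<and>
    (\<forall>n. \<exists>k\<ge>n. y k = \<xi> n)"
proof -
  have ev: "eventually (\<lambda>k. n \<le> level (y k)) sequentially" for n
  proof -
    have "finite (\<Union>i\<in>{i. level i \<le> n}. {k. y k = i})" using fin finite_ball by auto
    then have "finite {k. level (y k) \<le> n}" by (rule finite_subset[rotated]) auto
    then have "\<forall>\<^sub>F k in sequentially. \<not> level (y k) \<le> n"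
      by (simp add: eventually_sequentially finite_nat_set_iff_bounded) (metis le_less_linear not_le)
    then show ?thesis by eventually_elim simp
  qed
  then obtain K where K: "\<And>n k. k \<ge> K n \<Longrightarrow> n \<le> level (y k)"
    unfolding eventually_sequentially by metis
  define \<xi> where "\<xi> n = anc n (y (K n))" for n
  have \<xi>: "anc n (y k) = \<xi> n" if "k \<ge> K n" for n k
    using that
  proof (induction k rule: dec_induct)
    case base
    then show ?case by (simp add: \<xi>_def)
  next
    case (step k)
    then show ?case using anc_adj[OF adj[of k], of n] K[of n k] K[of n "Suc k"] by simp
  qed
  have lev: "level (\<xi> n) = n" for n unfolding \<xi>_def by (rule level_anc) (rule K, simp)
  have "pred (\<xi> (Suc n)) = \<xi> n" for n
  proof -
    define k where "k = max (K n) (K (Suc n))"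
    show ?thesis using \<xi>[of n k] \<xi>[of "Suc n" k] K[of "Suc n" k] pred_anc[of n "y k"]
      by (simp add: k_def)
  qed
  moreover have "\<xi> 0 = r" "\<And>n. \<xi> (Suc n) \<noteq> r"
    using lev level_eq_0_iff by (metis, metis nat.distinct(1))
  ultimately have ray: "\<xi> \<in> rays" by (simp add: rays_def succs_def)
  have br: "eventually (\<lambda>k. y k \<in> branch (\<xi> n)) sequentially" for n
    unfolding eventually_sequentially using K[of n] \<xi>[of n] lev by (auto simp: branch_iff)
  \<comment> \<open>One step raises the level by at most one, so the visit to \<open>\<xi> n\<close>
    happens at time \<open>n\<close> or later. Because visits become late as \<open>n\<close> grows,
    limits can be compared along path and ray.\<close>
  have lev_le: "level (y k) \<le> k" for k
  proof (induction k)
    case (Suc k)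
    with level_adj[OF adj[of k]] show ?case by simp
  qed (simp add: y0)
  have "\<exists>k\<ge>n. y k = \<xi> n" for n
  proof (cases "n = 0")
    case True
    then show ?thesis using y0 rays_0[OF ray] by auto
  next
    case False
    then have nr: "\<xi> n \<noteq> r" using lev[of n] level_root by metis
    obtain N where "y N \<in> branch (\<xi> n)" using br[of n] by (auto simp: eventually_sequentially)
    moreover have "y 0 \<notin> branch (\<xi> n)" using y0 nr by simp
    ultimately obtain k where "y k \<notin> branch (\<xi> n)" "y (Suc k) \<in> branch (\<xi> n)"
      by (induction N) auto
    then have "y (Suc k) = \<xi> n" using branch_crossing[OF adj[of k]] by auto
    moreover have "n \<le> Suc k" using lev_le[of "Suc k"] lev[of n] calculation by simp
    ultimately show ?thesis by blast
  qed
  with ray br show ?thesis by blast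
qed

end

section \<open>The tree matrix\<close>

context tree_matrix
begin

lemma incr_pos [simp]: "incr n > 0"
  using w_pos[of 0] w_strict_mono by (cases n) (auto simp: incr_def strict_mono_def)

lemma incr_nz [simp]: "incr n \<noteq> 0" and incr_nonneg [simp]: "0 \<le> incr n"
  using incr_pos[of n] by (simp_all del: incr_pos)

lemma sum_incr: "(\<Sum>k\<le>n. incr k) = w n"
  by (induction n) (auto simp: incr_def)

lemma incr_0: "incr 0 = w 0" by (simp add: incr_def)

lemma exit_rate_eq: "exit_rate i = 1 / incr (level i) + real (card (succs i)) / incr (Suc (level i))"
  by (simp add: exit_rate_def Q_def)

lemma exit_rate_pos [simp]: "exit_rate i > 0"
  unfolding exit_rate_eq by (intro add_pos_nonneg) auto

lemma exit_rate_nz [simp]: "exit_rate i \<noteq> 0" and exit_rate_nonneg [simp]: "0 \<le> exit_rate i"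
  using exit_rate_pos[of i] by (simp_all del: exit_rate_pos)

text \<open>The cemetery \<open>None\<close> plays the part of a parent of the root.\<close>

definition up :: "'a \<Rightarrow> 'a option" where
  "up i = (if i = r then None else Some (pred i))"

lemma up_notin_succs [simp]: "up i \<notin> Some ` succs i"
  using level_pred[of i] level_succs by (auto simp: up_def)

lemma Some_in_succs_iff: "j \<in> succs i \<longleftrightarrow> up j = Some i"
  by (auto simp: up_def succs_def)

lemma pred_neq: "i \<noteq> r \<Longrightarrow> pred i \<noteq> i"
  using level_pred[of i] by auto

lemma Q_eq_0: "i \<noteq> j \<Longrightarrow> up i \<noteq> Some j \<Longrightarrow> j \<notin> succs i \<Longrightarrow> Q i j = 0"
  by (auto simp: Q_def up_def succs_def)

lemma Q_succs: "j \<in> succs i \<Longrightarrow> Q i j = 1 / incr (Suc (level i))"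
proof -
  assume j: "j \<in> succs i"
  then have l: "level j = Suc (level i)" by (rule level_succs)
  then have "i \<noteq> j" by auto
  moreover have "\<not> (i \<noteq> r \<and> j = pred i)"
  proof
    assume "i \<noteq> r \<and> j = pred i"
    with level_pred[of i] have "level i = Suc (level j)" by simp
    with l show False by simp
  qed
  moreover have "j \<noteq> r" "pred j = i" using j by (simp_all add: succs_def)
  ultimately show ?thesis using l unfolding Q_def by auto
qed

lemma Q_pred: "up i = Some j \<Longrightarrow> Q i j = 1 / incr (level i)"
proof -
  assume "up i = Some j"
  then have "i \<noteq> r" "j = pred i" by (auto simp: up_def split: if_splits)
  with pred_neq[of i] show ?thesis unfolding Q_def by simp
qed

lemma jump_prob_up: "jump_prob i (up i) = 1 / incr (level i) / exit_rate i"
proof (cases "i = r")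
  case True
  then show ?thesis by (simp add: up_def incr_0)
next
  case False
  then show ?thesis using Q_pred[of i "pred i"] pred_neq[of i] by (auto simp: up_def)
qed

lemma jump_prob_succs: "j \<in> succs i \<Longrightarrow> jump_prob i (Some j) = 1 / incr (Suc (level i)) / exit_rate i"
proof -
  assume j: "j \<in> succs i"
  then have "i \<noteq> j" using level_succs[of j i] by auto
  then show ?thesis by (simp add: Q_succs[OF j])
qed

lemma jump_prob_0: "y \<noteq> up i \<Longrightarrow> y \<notin> Some ` succs i \<Longrightarrow> jump_prob i y = 0"
proof (cases y)
  case None
  then show "y \<noteq> up i \<Longrightarrow> ?thesis" by (auto simp: up_def)
next
  case (Some j)
  then show "y \<noteq> up i \<Longrightarrow> y \<notin> Some ` succs i \<Longrightarrow> ?thesis" using Q_eq_0[of i j] by auto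
qed

lemma jump_prob_nonneg [simp]: "0 \<le> jump_prob i y"
  using jump_prob_0[of y i] jump_prob_up[of i] jump_prob_succs[of _ i]
  by (cases "y = up i"; cases "y \<in> Some ` succs i") auto

text \<open>With the convention that a function vanishes at the cemetery, harmonicity also covers
  the root.\<close>

definition ext0 :: "('a \<Rightarrow> real) \<Rightarrow> 'a option \<Rightarrow> real" where
  "ext0 h y = (case y of None \<Rightarrow> 0 | Some i \<Rightarrow> h i)"

lemma ext0_simps [simp]: "ext0 h None = 0" "ext0 h (Some i) = h i"
  by (simp_all add: ext0_def)

lemma Q_has_sum:
  "((\<lambda>j. Q i j * h j) has_sum (ext0 h (up i) / incr (level i) +
    (\<Sum>j\<in>succs i. h j) / incr (Suc (level i)) - exit_rate i * h i)) UNIV"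
proof -
  define P where "P = {j. up i = Some j}"
  have P: "finite P" "(\<Sum>j\<in>P. Q i j * h j) = ext0 h (up i) / incr (level i)"
    by (cases "up i"; simp add: P_def Q_pred)+
  have d: "i \<notin> P \<union> succs i" "P \<inter> succs i = {}"
    using level_succs[of i i] pred_neq[of i] up_notin_succs[of i]
    by (auto simp: P_def up_def split: if_splits)
  have "(\<Sum>j\<in>insert i (P \<union> succs i). Q i j * h j) =
    - exit_rate i * h i + (ext0 h (up i) / incr (level i) + (\<Sum>j\<in>succs i. h j) / incr (Suc (level i)))"
    using d P by (simp add: sum.union_disjoint Q_succs sum_divide_distrib exit_rate_def)
  moreover have "((\<lambda>j. Q i j * h j) has_sum (\<Sum>j\<in>insert i (P \<union> succs i). Q i j * h j)) UNIV"
    by (rule has_sum_finite_neutralI)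
      (use P in \<open>auto simp: P_def Q_eq_0\<close>)
  moreover have "- exit_rate i * h i + (ext0 h (up i) / incr (level i) +
      (\<Sum>j\<in>succs i. h j) / incr (Suc (level i))) = ext0 h (up i) / incr (level i) +
      (\<Sum>j\<in>succs i. h j) / incr (Suc (level i)) - exit_rate i * h i" by simp
  ultimately show ?thesis by metis
qed

lemma harmonic_iff:
  "harmonic h \<longleftrightarrow> (\<forall>i. ext0 h (up i) / incr (level i) + (\<Sum>j\<in>succs i. h j) / incr (Suc (level i)) =
    exit_rate i * h i)"
  unfolding harmonic_def
proof (intro all_cong1 iffI)
  fix i assume "((\<lambda>j. Q i j * h j) has_sum 0) UNIV"
  from has_sum_unique[OF this Q_has_sum[where h = h and i = i]]
  show "ext0 h (up i) / incr (level i) + (\<Sum>j\<in>succs i. h j) / incr (Suc (level i)) =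
    exit_rate i * h i" by simp
next
  fix i assume "ext0 h (up i) / incr (level i) + (\<Sum>j\<in>succs i. h j) / incr (Suc (level i)) =
    exit_rate i * h i"
  then show "((\<lambda>j. Q i j * h j) has_sum 0) UNIV" using Q_has_sum[where h = h and i = i] by simp
qed

section \<open>The kernel as a sum of increments over common vertices\<close>

lemma sum_incr_initial:
  assumes "finite A" "A \<noteq> {}" "\<And>k n. n \<in> A \<Longrightarrow> k \<le> n \<Longrightarrow> k \<in> A"
  shows "(\<Sum>k\<in>A. incr k) = w (Max A)"
proof -
  have "A = {..Max A}" using assms by (auto intro: Max_in)
  then show ?thesis using sum_incr by metis
qed

text \<open>The common vertices of a geodesic and a ray occupy an initial segment of levels, and
  \<open>w\<close> at the last of them is the sum of the increments so far. The kernel thus becomes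
  linear in indicators of cylinders.\<close>

lemma U_site_eq:
  assumes "\<xi> \<in> rays"
  shows "U_site i \<xi> = (\<Sum>k\<le>level i. incr k * indicator (cyl (anc k i)) \<xi>)"
proof -
  let ?A = "{k. k \<le> level i \<and> \<xi> k = anc k i}"
  have "(\<Sum>k\<le>level i. incr k * indicator (cyl (anc k i)) \<xi>) =
    (\<Sum>k\<le>level i. if \<xi> k = anc k i then incr k else 0)"
    by (intro sum.cong) (auto simp: assms cyl_anc_iff indicator_def)
  also have "\<dots> = (\<Sum>k\<in>?A. incr k)"
    by (subst sum.inter_filter[symmetric]) (auto intro!: sum.cong)
  also have "\<dots> = w (Max ?A)"
  proof (rule sum_incr_initial)
    have "0 \<in> ?A" by (simp add: rays_0[OF assms])
    then show "?A \<noteq> {}" by blast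
  qed (use ray_eq_anc_mono[OF assms] in auto)
  finally show ?thesis by (simp add: U_site_def meet_level_eq[OF assms])
qed

text \<open>The series covers the diagonal as well: there every indicator is 1 and the partial sums
  are the numbers \<open>w n\<close>, whose limit in \<open>ennreal\<close> may be infinite. Off the
  diagonal only finitely many terms survive.\<close>

lemma U_ray_eq:
  assumes "\<eta> \<in> rays" "\<xi> \<in> rays"
  shows "U_ray \<eta> \<xi> = (\<Sum>k. ennreal (incr k) * indicator (cyl (\<eta> k)) \<xi>)"
proof (cases "\<eta> = \<xi>")
  case True
  then have "(\<lambda>k. ennreal (incr k) * indicator (cyl (\<eta> k)) \<xi>) = (\<lambda>k. ennreal (incr k))"
    using assms by (auto simp: cyl_iff)
  moreover have "(\<lambda>n. ennreal (w n)) \<longlonglongrightarrow> (\<Sum>k. ennreal (incr k))"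
  proof -
    have "(\<lambda>n. \<Sum>k\<le>n. ennreal (incr k)) \<longlonglongrightarrow> (\<Sum>k. ennreal (incr k))"
      by (rule summable_LIMSEQ') simp
    then show ?thesis by (simp add: sum_ennreal sum_incr)
  qed
  ultimately show ?thesis using True by (simp add: U_ray_def limI)
next
  case False
  let ?A = "{n. \<eta> n = \<xi> n}"
  obtain m where "\<eta> m \<noteq> \<xi> m" using False by auto
  then have "?A \<subseteq> {..<m}" using ray_eq_mono[OF assms] by (auto simp: not_le[symmetric])
  then have fin: "finite ?A" using finite_subset by blast
  have "(\<Sum>k. ennreal (incr k) * indicator (cyl (\<eta> k)) \<xi>) =
    (\<Sum>k\<in>?A. ennreal (incr k) * indicator (cyl (\<eta> k)) \<xi>)"
    using fin assms by (intro suminf_finite) (auto simp: cyl_iff indicator_def)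
  also have "\<dots> = (\<Sum>k\<in>?A. ennreal (incr k))"
    using assms by (intro sum.cong) (auto simp: cyl_iff)
  also have "\<dots> = ennreal (\<Sum>k\<in>?A. incr k)" by (simp add: sum_ennreal)
  also have "(\<Sum>k\<in>?A. incr k) = w (Max ?A)"
  proof (rule sum_incr_initial)
    have "0 \<in> ?A" by (simp add: rays_0 assms)
    then show "?A \<noteq> {}" by blast
  qed (use fin ray_eq_mono[OF assms] in auto)
  finally show ?thesis using False by (simp add: U_ray_def ray_meet_level_def)
qed

end

section \<open>The jump chain\<close>

context tree_matrix
begin

text \<open>The one-step transition operator, with an absorbing cemetery. Values in
  \<open>ennreal\<close> keep every mean defined; a finite sum suffices because all states other
  than neighbours have jump probability 0.\<close>

definition jump_mean :: "('a option \<Rightarrow> ennreal) \<Rightarrow> 'a option \<Rightarrow> ennreal" where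
  "jump_mean g y = (case y of None \<Rightarrow> g None
     | Some i \<Rightarrow> ennreal (jump_prob i (up i)) * g (up i) +
         (\<Sum>j\<in>succs i. ennreal (jump_prob i (Some j)) * g (Some j)))"

lemma jump_mean_None [simp]: "jump_mean g None = g None"
  by (simp add: jump_mean_def)

lemma jump_mean_Some:
  "jump_mean g (Some i) = ennreal (jump_prob i (up i)) * g (up i) +
     (\<Sum>j\<in>succs i. ennreal (jump_prob i (Some j)) * g (Some j))"
  by (simp add: jump_mean_def)

lemma jump_mean_ennreal:
  assumes "\<And>y. 0 \<le> g y"
  shows "jump_mean (\<lambda>y. ennreal (g y)) (Some i) =
    ennreal ((g (up i) / incr (level i) + (\<Sum>j\<in>succs i. g (Some j)) / incr (Suc (level i))) / exit_rate i)"
proof -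
  have "jump_mean (\<lambda>y. ennreal (g y)) (Some i) =
    ennreal (jump_prob i (up i) * g (up i) + (\<Sum>j\<in>succs i. jump_prob i (Some j) * g (Some j)))"
    unfolding jump_mean_Some
    by (simp add: assms sum_nonneg sum_ennreal flip: ennreal_mult ennreal_plus
        del: jump_prob.simps)
  also have "(\<Sum>j\<in>succs i. jump_prob i (Some j) * g (Some j)) =
    (\<Sum>j\<in>succs i. g (Some j)) / incr (Suc (level i)) / exit_rate i"
    unfolding sum_divide_distrib by (intro sum.cong refl) (simp add: jump_prob_succs del: jump_prob.simps)
  also have "jump_prob i (up i) * g (up i) = g (up i) / incr (level i) / exit_rate i"
    by (simp add: jump_prob_up)
  finally show ?thesis by (simp add: add_divide_distrib)
qed

end

context minimal_chain
begin

section \<open>Histories of the jump chain and the Markov property\<close>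

lemma Y_meas [measurable]: "Y n \<in> measurable M (count_space UNIV)"
  by (rule Y_measurable)

lemma countable_states [simp]: "countable (A :: 'a option set)"
proof -
  have "countable (insert None (Some ` (UNIV :: 'a set)))" by (simp only: countable_insert countable_image countable_sites_set)
  then show ?thesis by (simp only: UNIV_option_conv[symmetric]) (rule countable_subset[OF subset_UNIV])
qed

lemma Y_absorbed_le: "\<omega> \<in> space M \<Longrightarrow> Y m \<omega> = None \<Longrightarrow> m \<le> n \<Longrightarrow> Y n \<omega> = None"
  by (induction n rule: nat_induct) (auto simp: le_Suc_eq Y_absorbed)

text \<open>Lists over countably many states are countable, so an event of the past is a countable
  disjoint union of events \<open>hist n \<omega> = xs\<close>, to which the jump law applies
  directly.\<close>

definition hist :: "nat \<Rightarrow> 'b \<Rightarrow> 'a option list" where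
  "hist n \<omega> = map (\<lambda>k. Y k \<omega>) [0..<Suc n]"

lemma nth_hist: "k \<le> n \<Longrightarrow> hist n \<omega> ! k = Y k \<omega>"
  unfolding hist_def by (subst nth_map) (auto simp del: upt_Suc)

lemma length_hist [simp]: "length (hist n \<omega>) = Suc n"
  by (simp add: hist_def)

lemma hist_eq_iff: "hist n \<omega> = xs \<longleftrightarrow> length xs = Suc n \<and> (\<forall>k\<le>n. Y k \<omega> = xs ! k)"
  by (auto simp: list_eq_iff_nth_eq nth_hist less_Suc_eq_le)

lemma hist_meas [measurable]: "hist n \<in> measurable M (count_space UNIV)"
proof (subst measurable_count_space_eq_countable)
  have "countable (lists (UNIV :: 'a option set))" by (rule countable_lists) simp
  then show "countable (UNIV :: 'a option list set)" by simp
  have "hist n -` {xs} \<inter> space M \<in> sets M" for xs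
  proof -
    have "hist n -` {xs} \<inter> space M = {\<omega> \<in> space M. length xs = Suc n \<and> (\<forall>k\<in>{..n}. Y k \<omega> = xs ! k)}"
      unfolding vimage_def Int_def using hist_eq_iff[of n _ xs] by simp blast
    also have "\<dots> \<in> sets M" by measurable
    finally show ?thesis .
  qed
  then show "hist n \<in> space M \<rightarrow> UNIV \<and> (\<forall>a\<in>UNIV. hist n -` {a} \<inter> space M \<in> sets M)" by auto
qed

lemma hist_pred [measurable]: "Measurable.pred M (\<lambda>\<omega>. hist n \<omega> \<in> A)"
  by (rule measurable_compose[OF hist_meas]) simp

lemma prob_path:
  assumes "x 0 = Some r" "\<And>k. k < n \<Longrightarrow> x k \<noteq> None"
  shows "prob {\<omega> \<in> space M. \<forall>k\<le>n. Y k \<omega> = x k} = (\<Prod>k<n. jump_prob (the (x k)) (x (Suc k)))"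
proof -
  \<comment> \<open>Holding times are positive, so the thresholds \<open>t k = 0\<close> impose
    nothing and make the exponential factors equal to 1.\<close>
  have "{\<omega> \<in> space M. \<forall>k\<le>n. Y k \<omega> = x k} =
    {\<omega> \<in> space M. (\<forall>k\<le>n. Y k \<omega> = x k) \<and> (\<forall>k<n. T k \<omega> > 0)}"
    using T_pos by auto
  with jump_law[of x n "\<lambda>_. 0"] assms show ?thesis by (simp del: jump_prob.simps)
qed

lemma prob_hist_step:
  assumes "length xs = Suc n" "xs ! n = Some i"
  shows "prob {\<omega> \<in> space M. hist n \<omega> = xs \<and> Y (Suc n) \<omega> = y} =
    prob {\<omega> \<in> space M. hist n \<omega> = xs} * jump_prob i y"
proof (cases "xs ! 0 = Some r \<and> (\<forall>k<n. xs ! k \<noteq> None)")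
  case True
  define x where "x k = (if k \<le> n then xs ! k else y)" for k
  have x: "x 0 = Some r" "x k \<noteq> None" if "k \<le> n" for k
    using that True assms by (cases "k = n"; auto simp: x_def)+
  have "{\<omega> \<in> space M. hist n \<omega> = xs \<and> Y (Suc n) \<omega> = y} = {\<omega> \<in> space M. \<forall>k\<le>Suc n. Y k \<omega> = x k}"
    using assms by (auto simp: hist_eq_iff x_def le_Suc_eq)
  moreover have "{\<omega> \<in> space M. hist n \<omega> = xs} = {\<omega> \<in> space M. \<forall>k\<le>n. Y k \<omega> = x k}"
    using assms by (auto simp: hist_eq_iff x_def)
  moreover have "the (x n) = i" "x (Suc n) = y" using assms by (auto simp: x_def)
  ultimately show ?thesis
    using prob_path[of x "Suc n"] prob_path[of x n] x(1)[of 0] x(2) by (simp add: less_Suc_eq_le)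
next
  case False
  \<comment> \<open>The jump law does not speak of these histories: they start away from the root,
    or are absorbed and yet show \<open>Some i\<close> at time \<open>n\<close>. Neither occurs, so
    both sides vanish.\<close>
  have "{\<omega> \<in> space M. hist n \<omega> = xs} = {}"
  proof (intro equals0I)
    fix \<omega> assume "\<omega> \<in> {\<omega> \<in> space M. hist n \<omega> = xs}"
    then have \<omega>: "\<omega> \<in> space M" "\<And>k. k \<le> n \<Longrightarrow> Y k \<omega> = xs ! k" by (auto simp: hist_eq_iff)
    have "xs ! k \<noteq> None" if "k < n" for k
      using Y_absorbed_le[OF \<omega>(1), of k n] \<omega>(2)[of k] \<omega>(2)[of n] that assms by auto
    with False \<omega> Y_start[OF \<omega>(1)] show False by (metis zero_le)
  qed
  then have "{\<omega> \<in> space M. hist n \<omega> = xs \<and> Y (Suc n) \<omega> = y} = {}" by blast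
  with \<open>{\<omega> \<in> space M. hist n \<omega> = xs} = {}\<close> show ?thesis by (simp only: measure_empty mult_zero_left)
qed

lemma markov:
  "emeasure M {\<omega> \<in> space M. hist n \<omega> \<in> A \<and> Y n \<omega> = Some i \<and> Y (Suc n) \<omega> = y} =
    emeasure M {\<omega> \<in> space M. hist n \<omega> \<in> A \<and> Y n \<omega> = Some i} * ennreal (jump_prob i y)"
proof -
  define L where "L = {xs \<in> A. length xs = Suc n \<and> xs ! n = Some i}"
  have "countable (lists (UNIV :: 'a option set))" by (rule countable_lists) simp
  then have L: "countable L" by (rule countable_subset[rotated]) auto
  have *: "emeasure M {\<omega> \<in> space M. hist n \<omega> \<in> L \<and> P \<omega>} =
    (\<integral>\<^sup>+xs. emeasure M {\<omega> \<in> space M. hist n \<omega> = xs \<and> P \<omega>} \<partial>count_space L)"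
    if [measurable]: "Measurable.pred M P" for P
  proof -
    have "{\<omega> \<in> space M. hist n \<omega> \<in> L \<and> P \<omega>} = (\<Union>xs\<in>L. {\<omega> \<in> space M. hist n \<omega> = xs \<and> P \<omega>})" by auto
    then show ?thesis
      by (simp only:) (intro emeasure_UN_countable, auto simp: disjoint_family_on_def L)
  qed
  have L_iff: "hist n \<omega> \<in> A \<and> Y n \<omega> = Some i \<longleftrightarrow> hist n \<omega> \<in> L" for \<omega>
    by (auto simp: L_def nth_hist)
  have "emeasure M {\<omega> \<in> space M. hist n \<omega> \<in> L \<and> Y (Suc n) \<omega> = y} =
    (\<integral>\<^sup>+xs. emeasure M {\<omega> \<in> space M. hist n \<omega> = xs \<and> Y (Suc n) \<omega> = y} \<partial>count_space L)"
    by (intro *) measurable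
  also have "\<dots> = (\<integral>\<^sup>+xs. emeasure M {\<omega> \<in> space M. hist n \<omega> = xs \<and> True} * ennreal (jump_prob i y) \<partial>count_space L)"
    by (intro nn_integral_cong)
      (simp add: L_def emeasure_eq_measure prob_hist_step ennreal_mult del: jump_prob.simps)
  also have "\<dots> = emeasure M {\<omega> \<in> space M. hist n \<omega> \<in> L \<and> True} * ennreal (jump_prob i y)"
    by (subst *) (auto simp: nn_integral_multc)
  finally show ?thesis by (simp flip: L_iff add: conj_assoc)
qed

lemma prob_step:
  "prob {\<omega> \<in> space M. Y n \<omega> = Some i \<and> Y (Suc n) \<omega> = y} = prob {\<omega> \<in> space M. Y n \<omega> = Some i} * jump_prob i y"
  using markov[of n UNIV i y]
  by (simp add: emeasure_eq_measure del: jump_prob.simps flip: ennreal_mult)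

lemma AE_step:
  "AE \<omega> in M. \<forall>n i. Y n \<omega> = Some i \<longrightarrow> Y (Suc n) \<omega> = up i \<or> Y (Suc n) \<omega> \<in> Some ` succs i"
proof -
  have "AE \<omega> in M. \<not> (Y n \<omega> = Some i \<and> Y (Suc n) \<omega> = y)"
    if "y \<noteq> up i" "y \<notin> Some ` succs i" for n i y
    using prob_step[of n i y] jump_prob_0[OF that]
    by (intro AE_I[where N = "{\<omega> \<in> space M. Y n \<omega> = Some i \<and> Y (Suc n) \<omega> = y}"])
      (auto simp: emeasure_eq_measure)
  then have "AE \<omega> in M. \<forall>n. \<forall>i\<in>UNIV. \<forall>y\<in>UNIV. y \<noteq> up i \<longrightarrow> y \<notin> Some ` succs i \<longrightarrow>
      \<not> (Y n \<omega> = Some i \<and> Y (Suc n) \<omega> = y)"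
    by (subst AE_all_countable, intro allI, subst AE_ball_countable, simp, intro ballI,
        subst AE_ball_countable, simp, intro ballI) auto
  then show ?thesis by eventually_elim blast
qed

text \<open>\<open>A\<close> restricts the whole past; the maximal inequality uses this for the
  event that a value has not been reached so far. Splitting by the present and the next state
  reduces the claim to \<open>markov\<close>, because almost every step leads to one of finitely
  many states.\<close>

lemma markov_mean:
  "(\<integral>\<^sup>+\<omega>. g (Y (Suc n) \<omega>) * indicator {\<omega> \<in> space M. hist n \<omega> \<in> A} \<omega> \<partial>M) =
    (\<integral>\<^sup>+\<omega>. jump_mean g (Y n \<omega>) * indicator {\<omega> \<in> space M. hist n \<omega> \<in> A} \<omega> \<partial>M)"
proof -
  define I where "I x \<omega> = (indicator {\<omega> \<in> space M. hist n \<omega> \<in> A \<and> Y n \<omega> = x} \<omega> :: ennreal)" for x \<omega>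
  have [measurable]: "I x \<in> borel_measurable M" for x
  proof -
    have "{\<omega> \<in> space M. hist n \<omega> \<in> A \<and> Y n \<omega> = x} \<in> sets M" by measurable
    then show ?thesis unfolding I_def by simp
  qed
  have split: "(\<integral>\<^sup>+\<omega>. f \<omega> * indicator {\<omega> \<in> space M. hist n \<omega> \<in> A} \<omega> \<partial>M) =
      (\<integral>\<^sup>+x. \<integral>\<^sup>+\<omega>. f \<omega> * I x \<omega> \<partial>M \<partial>count_space UNIV)"
    if [measurable]: "f \<in> borel_measurable M" for f
  proof -
    have "f \<omega> * indicator {\<omega> \<in> space M. hist n \<omega> \<in> A} \<omega> = (\<integral>\<^sup>+x. f \<omega> * I x \<omega> \<partial>count_space UNIV)" for \<omega>
    proof -
      have "(\<integral>\<^sup>+x. f \<omega> * I x \<omega> \<partial>count_space UNIV) =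
          (\<integral>\<^sup>+x. f \<omega> * indicator {\<omega> \<in> space M. hist n \<omega> \<in> A} \<omega> * indicator {Y n \<omega>} x \<partial>count_space UNIV)"
        by (intro nn_integral_cong) (auto simp: I_def indicator_def)
      then show ?thesis by (simp add: nn_integral_cmult)
    qed
    then show ?thesis by (simp add: nn_integral_count_space_nn_integral)
  qed
  have "(\<integral>\<^sup>+\<omega>. g (Y (Suc n) \<omega>) * I x \<omega> \<partial>M) = (\<integral>\<^sup>+\<omega>. jump_mean g (Y n \<omega>) * I x \<omega> \<partial>M)" for x
  proof (cases x)
    case None
    then show ?thesis by (intro nn_integral_cong) (auto simp: I_def indicator_def Y_absorbed)
  next
    case (Some i)
    define J where "J y = {\<omega> \<in> space M. hist n \<omega> \<in> A \<and> Y n \<omega> = Some i \<and> Y (Suc n) \<omega> = y}" for y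
    have [measurable]: "J y \<in> sets M" for y unfolding J_def by measurable
    have J: "(\<integral>\<^sup>+\<omega>. g y * indicator (J y) \<omega> \<partial>M) =
        ennreal (jump_prob i y) * g y * emeasure M {\<omega> \<in> space M. hist n \<omega> \<in> A \<and> Y n \<omega> = Some i}" for y
      using markov[of n A i y] by (simp add: nn_integral_cmult_indicator J_def mult_ac del: jump_prob.simps)
    have "(\<integral>\<^sup>+\<omega>. g (Y (Suc n) \<omega>) * I x \<omega> \<partial>M) =
        (\<integral>\<^sup>+\<omega>. (\<Sum>y\<in>insert (up i) (Some ` succs i). g y * indicator (J y) \<omega>) \<partial>M)"
    proof (rule nn_integral_cong_AE)
      show "AE \<omega> in M. g (Y (Suc n) \<omega>) * I x \<omega> =
          (\<Sum>y\<in>insert (up i) (Some ` succs i). g y * indicator (J y) \<omega>)"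
        using AE_step AE_space
      proof eventually_elim
        case (elim \<omega>)
        show ?case
        proof (cases "hist n \<omega> \<in> A \<and> Y n \<omega> = Some i")
          case True
          then have "Y (Suc n) \<omega> \<in> insert (up i) (Some ` succs i)" using elim by blast
          moreover have "g y * indicator (J y) \<omega> = (if y = Y (Suc n) \<omega> then g y else 0)" for y
            using True elim by (auto simp: J_def indicator_def)
          ultimately have "(\<Sum>y\<in>insert (up i) (Some ` succs i). g y * indicator (J y) \<omega>) = g (Y (Suc n) \<omega>)"
            by (subst sum.cong[OF refl, where h = "\<lambda>y. if y = Y (Suc n) \<omega> then g y else 0"])
              (simp_all only: sum.delta' sum.delta finite_insert finite_imageI finite_succs if_True)
          then show ?thesis using True elim Some by (simp add: I_def)
        next
          case False
          then have "indicator (J y) \<omega> = (0::ennreal)" for y by (auto simp: J_def)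
          then show ?thesis using False Some by (auto simp: I_def)
        qed
      qed
    qed
    also have "\<dots> = (\<Sum>y\<in>insert (up i) (Some ` succs i). \<integral>\<^sup>+\<omega>. g y * indicator (J y) \<omega> \<partial>M)"
      by (intro nn_integral_sum) measurable
    also have "\<dots> = (\<Sum>y\<in>insert (up i) (Some ` succs i). ennreal (jump_prob i y) * g y) *
        emeasure M {\<omega> \<in> space M. hist n \<omega> \<in> A \<and> Y n \<omega> = Some i}"
      by (simp only: J sum_distrib_right)
    also have "(\<Sum>y\<in>insert (up i) (Some ` succs i). ennreal (jump_prob i y) * g y) = jump_mean g (Some i)"
      unfolding jump_mean_Some
      by (subst sum.insert) (simp_all add: sum.reindex del: jump_prob.simps)
    also have "jump_mean g (Some i) * emeasure M {\<omega> \<in> space M. hist n \<omega> \<in> A \<and> Y n \<omega> = Some i} =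
        (\<integral>\<^sup>+\<omega>. jump_mean g (Some i) * I x \<omega> \<partial>M)"
      unfolding I_def Some by (subst nn_integral_cmult_indicator) auto
    also have "\<dots> = (\<integral>\<^sup>+\<omega>. jump_mean g (Y n \<omega>) * I x \<omega> \<partial>M)"
      by (intro nn_integral_cong) (auto simp: I_def Some indicator_def)
    finally show ?thesis .
  qed
  moreover have "(\<lambda>\<omega>. g (Y (Suc n) \<omega>)) \<in> borel_measurable M"
      "(\<lambda>\<omega>. jump_mean g (Y n \<omega>)) \<in> borel_measurable M"
    by (rule measurable_compose[OF Y_meas], simp)+
  ultimately show ?thesis by (simp only: split)
qed

end

section \<open>The Green function of the root\<close>

context minimal_chain
begin

text \<open>The expected time spent at \<open>i\<close> in step \<open>n\<close>, since the mean
  holding time is \<open>1 / exit_rate i\<close>. In this normalisation the probability that the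
  jump from \<open>i\<close> crosses a given edge is \<open>occ n i\<close> divided by the increment
  of \<open>w\<close> at that edge, in either direction.\<close>

definition occ :: "nat \<Rightarrow> 'a \<Rightarrow> real" where
  "occ n i = prob {\<omega> \<in> space M. Y n \<omega> = Some i} / exit_rate i"

definition green :: "'a \<Rightarrow> real" where
  "green i = (\<Sum>n. occ n i)"

definition prob_branch :: "nat \<Rightarrow> 'a \<Rightarrow> real" where
  "prob_branch n i = prob {\<omega> \<in> space M. Y n \<omega> \<in> Some ` branch i}"

text \<open>\<open>green_up\<close> extends \<open>green\<close> by the value \<open>w 0\<close> at the cemetery; with it the flux through
  an edge is the same expression for all sites.\<close>

definition green_up :: "'a \<Rightarrow> real" where
  "green_up i = (if i = r then w 0 else green (pred i))"

text \<open>So far only a current through the edge above \<open>i\<close>;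
  \<open>prob_exits_in_cyl\<close> identifies it with a probability.\<close>

definition exit_prob :: "'a \<Rightarrow> real" where
  "exit_prob i = (green_up i - green i) / incr (level i)"

section \<open>Flux of the chain through the edges\<close>

lemma occ_nonneg [simp]: "0 \<le> occ n i"
  by (simp add: occ_def)

lemma Y_pred [measurable]: "Measurable.pred M (\<lambda>\<omega>. Y n \<omega> \<in> A)"
  by (rule measurable_compose[OF Y_meas]) simp

lemma step_adj:
  assumes "Y (Suc n) \<omega> = up i \<or> Y (Suc n) \<omega> \<in> Some ` succs i" "Y (Suc n) \<omega> = Some j"
  shows "adj i j"
  using assms by (auto simp: up_def succs_def adj_iff split: if_splits)

text \<open>Both sides are the probability of being in the branch at time \<open>n\<close> or at
  time \<open>n + 1\<close>: the left adds the departures through the edge above \<open>i\<close> to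
  the state afterwards, the right adds the arrivals to the state before. For \<open>i = r\<close>
  the departures lead to the cemetery and there are no arrivals.\<close>

lemma flux:
  "prob_branch (Suc n) i + occ n i / incr (level i) =
    prob_branch n i + (if i = r then 0 else occ n (pred i) / incr (level i))"
proof -
  let ?L1 = "{\<omega> \<in> space M. Y (Suc n) \<omega> \<in> Some ` branch i}"
  let ?L2 = "{\<omega> \<in> space M. Y n \<omega> = Some i \<and> Y (Suc n) \<omega> = up i}"
  let ?R1 = "{\<omega> \<in> space M. Y n \<omega> \<in> Some ` branch i}"
  let ?R2 = "{\<omega> \<in> space M. i \<noteq> r \<and> Y n \<omega> = Some (pred i) \<and> Y (Suc n) \<omega> = Some i}"
  have up: "up i \<notin> Some ` branch i" using pred_notin_branch by (auto simp: up_def)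
  have "prob (?L1 \<union> ?L2) = prob (?R1 \<union> ?R2)"
  proof (rule finite_measure_eq_AE)
    show "AE \<omega> in M. \<omega> \<in> ?L1 \<union> ?L2 \<longleftrightarrow> \<omega> \<in> ?R1 \<union> ?R2"
      using AE_step AE_space
    proof eventually_elim
      case (elim \<omega>)
      show ?case
      proof (cases "Y n \<omega>")
        case None
        with elim Y_absorbed[of \<omega> n] show ?thesis by auto
      next
        case (Some j)
        with elim have j: "Y (Suc n) \<omega> = up j \<or> Y (Suc n) \<omega> \<in> Some ` succs j" by blast
        show ?thesis
        proof (cases "Y (Suc n) \<omega>")
          case None
          with j have "j = r" by (auto simp: up_def split: if_splits)
          with None Some elim show ?thesis by (auto simp: up_def)
        next
          case (Some k)
          have "k \<in> branch i \<longleftrightarrow> (j \<in> branch i \<and> \<not> (j = i \<and> Some k = up i)) \<or> (i \<noteq> r \<and> j = pred i \<and> k = i)"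
            using branch_crossing[OF step_adj[OF j Some], of i] by (auto simp: up_def)
          moreover have "up i = Some k \<Longrightarrow> k \<notin> branch i" using up by force
          ultimately show ?thesis using Some \<open>Y n \<omega> = Some j\<close> elim branch_self[of i] by auto
        qed
      qed
    qed
  qed auto
  moreover have "prob (?L1 \<union> ?L2) = prob ?L1 + prob ?L2"
    using up by (intro finite_measure_Union) auto
  moreover have "prob (?R1 \<union> ?R2) = prob ?R1 + prob ?R2"
    using pred_notin_branch by (intro finite_measure_Union) auto
  moreover have "prob ?L2 = occ n i / incr (level i)"
    unfolding prob_step jump_prob_up by (simp add: occ_def)
  moreover have "prob ?R2 = (if i = r then 0 else occ n (pred i) / incr (level i))"
  proof (cases "i = r")
    case False
    then have "i \<in> succs (pred i)" by (simp add: succs_def)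
    with False show ?thesis
      by (simp add: prob_step jump_prob_succs occ_def level_pred[OF False] del: jump_prob.simps)
  qed simp
  ultimately show ?thesis by (simp add: prob_branch_def)
qed

text \<open>Splitting by the previous state gives a sum over neighbours. As \<open>Q\<close> is
  symmetric, its weights are also those of a jump out of \<open>j\<close>, so one step forward in
  time acts on \<open>occ\<close> as \<open>jump_mean\<close> does.\<close>

lemma forward_equation:
  "exit_rate j * occ (Suc n) j = ext0 (occ n) (up j) / incr (level j) +
    (\<Sum>i\<in>succs j. occ n i) / incr (Suc (level j))"
proof -
  define P where "P = {i. up j = Some i}"
  let ?E = "\<lambda>i. {\<omega> \<in> space M. Y n \<omega> = Some i \<and> Y (Suc n) \<omega> = Some j}"
  have P: "finite P" by (cases "up j") (auto simp: P_def)
  have disj: "P \<inter> succs j = {}"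
  proof (intro equals0I)
    fix i assume "i \<in> P \<inter> succs j"
    then have "up j = Some i" "i \<in> succs j" by (simp_all add: P_def)
    with up_notin_succs[of j] show False by (simp only: imageI not_True_eq_False)
  qed
  have "exit_rate j * occ (Suc n) j = prob {\<omega> \<in> space M. Y (Suc n) \<omega> = Some j}"
    by (simp add: occ_def)
  also have "\<dots> = prob (\<Union>i\<in>P \<union> succs j. ?E i)"
  proof (rule finite_measure_eq_AE)
    show "AE \<omega> in M. \<omega> \<in> {\<omega> \<in> space M. Y (Suc n) \<omega> = Some j} \<longleftrightarrow> \<omega> \<in> (\<Union>i\<in>P \<union> succs j. ?E i)"
      using AE_step AE_space
    proof eventually_elim
      case (elim \<omega>)
      have "\<exists>i\<in>P \<union> succs j. Y n \<omega> = Some i" if j: "Y (Suc n) \<omega> = Some j"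
      proof (cases "Y n \<omega>")
        case None
        with elim j Y_absorbed[of \<omega> n] show ?thesis by auto
      next
        case (Some i)
        with elim(1)[rule_format, OF Some] j have "Some j = up i \<or> Some j \<in> Some ` succs i" by simp
        then have "up i = Some j \<or> j \<in> succs i" by auto
        with Some show ?thesis by (auto simp: P_def Some_in_succs_iff)
      qed
      then show ?case using elim by auto
    qed
    show "{\<omega> \<in> space M. Y (Suc n) \<omega> = Some j} \<in> sets M" by measurable
    show "(\<Union>i\<in>P \<union> succs j. ?E i) \<in> sets M"
      by (rule sets.finite_UN) (use P in simp_all)
  qed
  also have "\<dots> = (\<Sum>i\<in>P \<union> succs j. prob (?E i))"
    using P by (intro finite_measure_finite_Union) (auto simp: disjoint_family_on_def)
  also have "\<dots> = (\<Sum>i\<in>P. prob (?E i)) + (\<Sum>i\<in>succs j. prob (?E i))"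
    using P disj by (intro sum.union_disjoint) auto
  also have "(\<Sum>i\<in>P. prob (?E i)) = ext0 (occ n) (up j) / incr (level j)"
  proof (cases "up j")
    case (Some i)
    then have "j \<in> succs i" by (simp add: Some_in_succs_iff)
    with Some show ?thesis
      by (simp add: P_def prob_step jump_prob_succs occ_def level_succs del: jump_prob.simps)
  qed (simp add: P_def)
  also have "(\<Sum>i\<in>succs j. prob (?E i)) = (\<Sum>i\<in>succs j. occ n i) / incr (Suc (level j))"
    unfolding sum_divide_distrib
  proof (rule sum.cong)
    fix i assume i: "i \<in> succs j"
    then have "Some j = up i" by (simp add: Some_in_succs_iff)
    then have "prob (?E i) = prob {\<omega> \<in> space M. Y n \<omega> = Some i} * jump_prob i (up i)"
      by (simp only: prob_step)
    then show "prob (?E i) = occ n i / incr (Suc (level j))"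
      using level_succs[OF i] by (simp add: jump_prob_up occ_def)
  qed simp
  finally show ?thesis .
qed

lemma prob_branch_0: "prob_branch 0 i = (if i = r then 1 else 0)"
proof -
  have "{\<omega> \<in> space M. Y 0 \<omega> \<in> Some ` branch i} = (if i = r then space M else {})"
    using Y_start by auto
  then show ?thesis by (simp add: prob_branch_def prob_space)
qed

lemma flux_sum:
  "prob_branch n i + (\<Sum>k<n. occ k i) / incr (level i) =
    (if i = r then 1 else (\<Sum>k<n. occ k (pred i)) / incr (level i))"
proof (induction n)
  case (Suc n)
  then show ?case using flux[of n i] by (cases "i = r") (simp_all add: add_divide_distrib)
qed (simp add: prob_branch_0)

text \<open>The probability left in a branch is nonnegative, so by the flux balance the expected
  time up to step \<open>n\<close> does not increase from a parent to its successor. At the root the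
  edge to the cemetery has conductance \<open>1 / w 0\<close> and carries probability at most
  1.\<close>

lemma sum_occ_le: "(\<Sum>k<n. occ k i) \<le> w 0"
proof (induction i rule: level_induct)
  case root
  have "prob_branch n r \<ge> 0" by (simp add: prob_branch_def)
  then have "(\<Sum>k<n. occ k r) / w 0 \<le> 1"
    using flux_sum[of n r] by (simp add: incr_0)
  then show ?case using w_pos[of 0] by (simp add: field_simps)
next
  case (pred i)
  have "prob_branch n i \<ge> 0" by (simp add: prob_branch_def)
  then have "(\<Sum>k<n. occ k i) / incr (level i) \<le> (\<Sum>k<n. occ k (pred i)) / incr (level i)"
    using flux_sum[of n i] pred by simp
  then show ?case using pred by (simp add: divide_le_cancel)
qed

lemma summable_occ [simp]: "summable (\<lambda>n. occ n i)"
  by (rule summableI_nonneg_bounded[OF _ sum_occ_le]) simp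

lemma occ_sums: "(\<lambda>n. occ n i) sums green i"
  by (simp add: green_def summable_sums)

lemma green_nonneg [simp]: "0 \<le> green i"
  unfolding green_def by (rule suminf_nonneg) auto

lemma green_le: "green i \<le> w 0"
  unfolding green_def by (rule suminf_le_const) (auto intro: sum_occ_le)

lemma prob_branch_lim: "(\<lambda>n. prob_branch n i) \<longlonglongrightarrow> exit_prob i"
proof -
  have S: "(\<lambda>n. \<Sum>k<n. occ k j) \<longlonglongrightarrow> green j" for j
    using occ_sums by (simp add: sums_def)
  have "(\<lambda>n. (if i = r then 1 else (\<Sum>k<n. occ k (pred i)) / incr (level i)) -
      (\<Sum>k<n. occ k i) / incr (level i)) \<longlonglongrightarrow>
    (if i = r then 1 else green (pred i) / incr (level i)) - green i / incr (level i)"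
    by (intro tendsto_intros S incr_nz | cases "i = r"; simp)+
  moreover have "(if i = r then 1 else green (pred i) / incr (level i)) - green i / incr (level i) =
      exit_prob i"
    using w_pos[of 0] by (auto simp: exit_prob_def green_up_def diff_divide_distrib incr_0)
  moreover have "prob_branch n i = (if i = r then 1 else (\<Sum>k<n. occ k (pred i)) / incr (level i)) -
      (\<Sum>k<n. occ k i) / incr (level i)" for n
    using flux_sum[of n i] by simp
  ultimately show ?thesis by simp
qed

lemma exit_prob_nonneg [simp]: "0 \<le> exit_prob i"
  using prob_branch_lim by (rule LIMSEQ_le_const) (simp add: prob_branch_def)

lemma sum_exit_prob: "(\<Sum>k\<le>level i. incr k * exit_prob (anc k i)) = w 0 - green i"
proof (induction i rule: level_induct)
  case root
  then show ?case by (simp add: exit_prob_def green_up_def)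
next
  case (pred i)
  then have "(\<Sum>k\<le>level i. incr k * exit_prob (anc k i)) =
    (\<Sum>k\<le>level (pred i). incr k * exit_prob (anc k i)) + incr (level i) * exit_prob i"
    using anc_level[of i] unfolding level_pred[OF pred(1)] by simp
  also have "(\<Sum>k\<le>level (pred i). incr k * exit_prob (anc k i)) =
    (\<Sum>k\<le>level (pred i). incr k * exit_prob (anc k (pred i)))"
    by (intro sum.cong refl) (use level_pred[OF pred(1)] anc_pred[of _ i] in auto)
  also have "incr (level i) * exit_prob i = green (pred i) - green i"
    using pred by (simp add: exit_prob_def green_up_def)
  finally show ?case using pred by simp
qed

text \<open>This permits conditioning on a visit to \<open>i\<close> and makes \<open>green\<close>
  strictly positive. Every jump along the geodesic to \<open>i\<close> has positive
  probability.\<close>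

lemma visits_pos: "\<exists>n. prob {\<omega> \<in> space M. Y n \<omega> = Some i} > 0"
proof (induction i rule: level_induct)
  case root
  have "{\<omega> \<in> space M. Y 0 \<omega> = Some r} = space M" using Y_start by auto
  then show ?case by (intro exI[of _ 0]) (simp add: prob_space)
next
  case (pred i)
  then obtain n where n: "prob {\<omega> \<in> space M. Y n \<omega> = Some (pred i)} > 0" by blast
  have i: "i \<in> succs (pred i)" using pred by (simp add: succs_def)
  have "0 < prob {\<omega> \<in> space M. Y n \<omega> = Some (pred i)} * jump_prob (pred i) (Some i)"
    using n unfolding jump_prob_succs[OF i] by (intro mult_pos_pos divide_pos_pos) auto
  also have "\<dots> = prob {\<omega> \<in> space M. Y n \<omega> = Some (pred i) \<and> Y (Suc n) \<omega> = Some i}"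
    by (simp only: prob_step)
  also have "\<dots> \<le> prob {\<omega> \<in> space M. Y (Suc n) \<omega> = Some i}"
    by (rule finite_measure_mono) auto
  finally show ?case by blast
qed

lemma green_pos: "0 < green i"
proof -
  obtain n where "prob {\<omega> \<in> space M. Y n \<omega> = Some i} > 0" using visits_pos by blast
  then have "0 < occ n i" by (simp add: occ_def)
  then show ?thesis unfolding green_def by (intro suminf_pos2) auto
qed

text \<open>Borel-Cantelli: the probability of being at \<open>i\<close> at time \<open>n\<close> is
  \<open>exit_rate i\<close> times \<open>occ n i\<close>, which is summable.\<close>

lemma AE_finite_visits: "AE \<omega> in M. \<forall>i. finite {n. Y n \<omega> = Some i}"
proof -
  have "AE \<omega> in M. finite {n. Y n \<omega> = Some i}" for i
  proof -
    have "summable (\<lambda>n. exit_rate i * occ n i)" by (intro summable_mult) simp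
    then have "summable (\<lambda>n. prob {\<omega> \<in> space M. Y n \<omega> = Some i})" by (simp add: occ_def)
    then have "AE \<omega> in M. eventually (\<lambda>n. \<omega> \<in> space M - {\<omega> \<in> space M. Y n \<omega> = Some i}) sequentially"
      by (intro borel_cantelli_AE1) (auto simp: emeasure_eq_measure)
    then show ?thesis
    proof eventually_elim
      case (elim \<omega>)
      then obtain N where "\<forall>n\<ge>N. Y n \<omega> \<noteq> Some i" by (auto simp: eventually_sequentially)
      then have "{n. Y n \<omega> = Some i} \<subseteq> {..<N}" by (auto simp: not_le[symmetric])
      then show ?case by (rule finite_subset) simp
    qed
  qed
  then have "AE \<omega> in M. \<forall>i\<in>UNIV. finite {n. Y n \<omega> = Some i}"
    by (subst AE_ball_countable) auto
  then show ?thesis by simp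
qed

end

section \<open>Superharmonic functions along the jump chain\<close>

text \<open>Countable quantifiers give both the measurability of the set of rays with limit 0 and
  the passage from one threshold to all thresholds outside a single null set.\<close>

lemma nonneg_LIMSEQ_0_iff:
  fixes f :: "nat \<Rightarrow> real"
  assumes "\<And>n. 0 \<le> f n"
  shows "f \<longlonglongrightarrow> 0 \<longleftrightarrow> (\<forall>m. \<exists>n. \<forall>l\<ge>n. f l < inverse (real (Suc m)))"
proof
  assume "f \<longlonglongrightarrow> 0"
  then show "\<forall>m. \<exists>n. \<forall>l\<ge>n. f l < inverse (real (Suc m))"
    using assms by (intro allI) (drule LIMSEQ_D[of _ _ "inverse (real (Suc _))"], auto)
next
  assume *: "\<forall>m. \<exists>n. \<forall>l\<ge>n. f l < inverse (real (Suc m))"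
  show "f \<longlonglongrightarrow> 0"
  proof (rule LIMSEQ_I)
    fix \<epsilon> :: real assume "0 < \<epsilon>"
    then obtain m where m: "inverse (real (Suc m)) < \<epsilon>" using reals_Archimedean by blast
    from * obtain n where "\<forall>l\<ge>n. f l < inverse (real (Suc m))" by blast
    with m assms show "\<exists>n. \<forall>l\<ge>n. norm (f l - 0) < \<epsilon>" by (intro exI[of _ n]) fastforce
  qed
qed

context minimal_chain
begin

section \<open>The maximal inequality\<close>

lemma borel_Y [measurable]: "(\<lambda>\<omega>. (f :: 'a option \<Rightarrow> ennreal) (Y n \<omega>)) \<in> borel_measurable M"
  by (rule measurable_compose[OF Y_meas]) simp

text \<open>The chain is stopped when \<open>f\<close> first reaches \<open>c\<close> after time
  \<open>n\<close>. The second summand is the mean over the paths not yet stopped; it has to be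
  carried along for the induction on the horizon.\<close>

lemma maximal_inequality_finite:
  fixes f :: "'a option \<Rightarrow> ennreal"
  assumes super: "\<And>y. jump_mean f y \<le> f y"
  shows "c * emeasure M {\<omega> \<in> space M. Y n \<omega> \<in> A \<and> (\<exists>l\<in>{n..<n + N}. c \<le> f (Y l \<omega>))} +
      (\<integral>\<^sup>+\<omega>. f (Y (n + N) \<omega>) * indicator {\<omega> \<in> space M. Y n \<omega> \<in> A \<and> (\<forall>l\<in>{n..<n + N}. f (Y l \<omega>) < c)} \<omega> \<partial>M)
    \<le> (\<integral>\<^sup>+\<omega>. f (Y n \<omega>) * indicator {\<omega> \<in> space M. Y n \<omega> \<in> A} \<omega> \<partial>M)"
proof (induction N)
  case 0
  then show ?case by simp
next
  case (Suc N)
  define D where "D N = {\<omega> \<in> space M. Y n \<omega> \<in> A \<and> (\<exists>l\<in>{n..<n + N}. c \<le> f (Y l \<omega>))}" for N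
  define B where "B N = {\<omega> \<in> space M. Y n \<omega> \<in> A \<and> (\<forall>l\<in>{n..<n + N}. f (Y l \<omega>) < c)}" for N
  \<comment> \<open>The paths that are stopped exactly at time \<open>n + N\<close>: they move from
    the unstopped part to the stopped one.\<close>
  define C where "C = {\<omega> \<in> B N. c \<le> f (Y (n + N) \<omega>)}"
  have [measurable]: "D N \<in> sets M" "B N \<in> sets M" for N
    unfolding D_def B_def by measurable
  have [measurable]: "C \<in> sets M"
  proof -
    have "C = B N \<inter> {\<omega> \<in> space M. c \<le> f (Y (n + N) \<omega>)}" by (auto simp: C_def B_def)
    then show ?thesis by simp
  qed
  have ivl: "{n..<n + Suc N} = insert (n + N) {n..<n + N}" by auto
  have D: "D (Suc N) = D N \<union> C" "D N \<inter> C = {}"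
    unfolding D_def C_def B_def ivl by (auto simp: not_le[symmetric])
  have B: "B N = B (Suc N) \<union> C" "B (Suc N) \<inter> C = {}"
    unfolding C_def B_def ivl by (auto simp: not_le[symmetric])
  \<comment> \<open>Not being stopped up to time \<open>n + N\<close> is a property of the history,
    so \<open>markov_mean\<close> applies to the next jump.\<close>
  have hist: "B (Suc N) = {\<omega> \<in> space M. hist (n + N) \<omega> \<in> {xs. xs ! n \<in> A \<and> (\<forall>l\<in>{n..<n + Suc N}. f (xs ! l) < c)}}"
    unfolding B_def by (auto simp: nth_hist)
  have "(\<integral>\<^sup>+\<omega>. f (Y (n + Suc N) \<omega>) * indicator (B (Suc N)) \<omega> \<partial>M) =
      (\<integral>\<^sup>+\<omega>. jump_mean f (Y (n + N) \<omega>) * indicator (B (Suc N)) \<omega> \<partial>M)"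
    unfolding hist by (simp only: add_Suc_right markov_mean)
  also have "\<dots> \<le> (\<integral>\<^sup>+\<omega>. f (Y (n + N) \<omega>) * indicator (B (Suc N)) \<omega> \<partial>M)"
    by (intro nn_integral_mono mult_right_mono super) simp
  finally have step: "(\<integral>\<^sup>+\<omega>. f (Y (n + Suc N) \<omega>) * indicator (B (Suc N)) \<omega> \<partial>M) \<le>
    (\<integral>\<^sup>+\<omega>. f (Y (n + N) \<omega>) * indicator (B (Suc N)) \<omega> \<partial>M)" .
  have "c * emeasure M C = (\<integral>\<^sup>+\<omega>. c * indicator C \<omega> \<partial>M)"
    by (simp add: nn_integral_cmult_indicator)
  also have "\<dots> \<le> (\<integral>\<^sup>+\<omega>. f (Y (n + N) \<omega>) * indicator C \<omega> \<partial>M)"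
    by (intro nn_integral_mono) (auto simp: C_def indicator_def)
  finally have "c * emeasure M C + (\<integral>\<^sup>+\<omega>. f (Y (n + Suc N) \<omega>) * indicator (B (Suc N)) \<omega> \<partial>M) \<le>
    (\<integral>\<^sup>+\<omega>. f (Y (n + N) \<omega>) * indicator C \<omega> \<partial>M) + (\<integral>\<^sup>+\<omega>. f (Y (n + N) \<omega>) * indicator (B (Suc N)) \<omega> \<partial>M)"
    using step by (rule add_mono)
  also have "\<dots> = (\<integral>\<^sup>+\<omega>. f (Y (n + N) \<omega>) * indicator (B N) \<omega> \<partial>M)"
    using B(2) unfolding B(1)
    by (subst nn_integral_add[symmetric]) (auto intro!: nn_integral_cong simp: indicator_def)
  finally have "c * emeasure M (D N) + (c * emeasure M C + (\<integral>\<^sup>+\<omega>. f (Y (n + Suc N) \<omega>) * indicator (B (Suc N)) \<omega> \<partial>M)) \<le>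
      c * emeasure M (D N) + (\<integral>\<^sup>+\<omega>. f (Y (n + N) \<omega>) * indicator (B N) \<omega> \<partial>M)"
    by (rule add_left_mono)
  also have "\<dots> \<le> (\<integral>\<^sup>+\<omega>. f (Y n \<omega>) * indicator {\<omega> \<in> space M. Y n \<omega> \<in> A} \<omega> \<partial>M)"
    using Suc.IH unfolding D_def B_def .
  finally show ?case
    unfolding D_def[symmetric] B_def[symmetric] D(1)
    using D(2) by (simp add: plus_emeasure[symmetric] distrib_left add.assoc)
qed

text \<open>The set \<open>A\<close> has two uses: all states for \<open>green\<close>, and the
  single state \<open>Some i\<close> for bounded harmonic functions. The unstopped part is dropped,
  and the horizon tends to infinity by continuity from below.\<close>

lemma maximal_inequality:
  fixes f :: "'a option \<Rightarrow> ennreal"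
  assumes super: "\<And>y. jump_mean f y \<le> f y"
  shows "c * emeasure M {\<omega> \<in> space M. Y n \<omega> \<in> A \<and> (\<exists>l\<ge>n. c \<le> f (Y l \<omega>))}
    \<le> (\<integral>\<^sup>+\<omega>. f (Y n \<omega>) * indicator {\<omega> \<in> space M. Y n \<omega> \<in> A} \<omega> \<partial>M)"
proof -
  define D where "D N = {\<omega> \<in> space M. Y n \<omega> \<in> A \<and> (\<exists>l\<in>{n..<n + N}. c \<le> f (Y l \<omega>))}" for N
  have [measurable]: "D N \<in> sets M" for N unfolding D_def by measurable
  have "{\<omega> \<in> space M. Y n \<omega> \<in> A \<and> (\<exists>l\<ge>n. c \<le> f (Y l \<omega>))} = (\<Union>N. D N)"
  proof (intro set_eqI iffI)
    fix \<omega> assume "\<omega> \<in> {\<omega> \<in> space M. Y n \<omega> \<in> A \<and> (\<exists>l\<ge>n. c \<le> f (Y l \<omega>))}"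
    then obtain l where "\<omega> \<in> space M" "Y n \<omega> \<in> A" "n \<le> l" "c \<le> f (Y l \<omega>)" by blast
    then have "\<omega> \<in> D (Suc l - n)" by (auto simp: D_def intro!: bexI[of _ l])
    then show "\<omega> \<in> (\<Union>N. D N)" by blast
  qed (auto simp: D_def)
  moreover have "incseq D" unfolding incseq_def D_def by fastforce
  ultimately have "c * emeasure M {\<omega> \<in> space M. Y n \<omega> \<in> A \<and> (\<exists>l\<ge>n. c \<le> f (Y l \<omega>))} =
      (SUP N. c * emeasure M (D N))"
    by (simp add: SUP_emeasure_incseq[symmetric] SUP_mult_left_ennreal image_subset_iff)
  also have "\<dots> \<le> (\<integral>\<^sup>+\<omega>. f (Y n \<omega>) * indicator {\<omega> \<in> space M. Y n \<omega> \<in> A} \<omega> \<partial>M)"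
  proof (rule SUP_least)
    fix N
    have "c * emeasure M (D N) \<le> c * emeasure M (D N) + (\<integral>\<^sup>+\<omega>. f (Y (n + N) \<omega>) *
        indicator {\<omega> \<in> space M. Y n \<omega> \<in> A \<and> (\<forall>l\<in>{n..<n + N}. f (Y l \<omega>) < c)} \<omega> \<partial>M)"
      by simp
    also have "\<dots> \<le> (\<integral>\<^sup>+\<omega>. f (Y n \<omega>) * indicator {\<omega> \<in> space M. Y n \<omega> \<in> A} \<omega> \<partial>M)"
      unfolding D_def by (rule maximal_inequality_finite[OF super])
    finally show "c * emeasure M (D N) \<le>
      (\<integral>\<^sup>+\<omega>. f (Y n \<omega>) * indicator {\<omega> \<in> space M. Y n \<omega> \<in> A} \<omega> \<partial>M)" .
  qed
  finally show ?thesis .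
qed

section \<open>Decay of the Green function along the chain\<close>

lemma ext0_nonneg: "(\<And>i. 0 \<le> h i) \<Longrightarrow> 0 \<le> ext0 h y"
  by (cases y) auto

lemma jump_mean_occ:
  "jump_mean (\<lambda>y. ennreal (ext0 (occ l) y)) y = ennreal (ext0 (occ (Suc l)) y)"
proof (cases y)
  case (Some i)
  have "jump_mean (\<lambda>y. ennreal (ext0 (occ l) y)) (Some i) =
    ennreal ((exit_rate i * occ (Suc l) i) / exit_rate i)"
    by (subst jump_mean_ennreal) (simp_all add: ext0_nonneg forward_equation)
  with Some show ?thesis by simp
qed simp

text \<open>By reversibility the mean of \<open>green\<close> at time \<open>k\<close> is a tail of the series \<open>green r\<close>.\<close>

lemma mean_occ: "(\<integral>\<^sup>+\<omega>. ennreal (ext0 (occ l) (Y k \<omega>)) \<partial>M) = ennreal (occ (l + k) r)"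
proof (induction k arbitrary: l)
  case 0
  have "(\<integral>\<^sup>+\<omega>. ennreal (ext0 (occ l) (Y 0 \<omega>)) \<partial>M) = (\<integral>\<^sup>+\<omega>. ennreal (occ l r) \<partial>M)"
    by (intro nn_integral_cong) (simp add: Y_start)
  then show ?case by (simp add: emeasure_space_1)
next
  case (Suc k)
  have *: "(\<integral>\<^sup>+\<omega>. f \<omega> * indicator {\<omega> \<in> space M. hist k \<omega> \<in> UNIV} \<omega> \<partial>M) = (\<integral>\<^sup>+\<omega>. f \<omega> \<partial>M)"
    for f by (intro nn_integral_cong) auto
  have "(\<integral>\<^sup>+\<omega>. ennreal (ext0 (occ l) (Y (Suc k) \<omega>)) \<partial>M) =
      (\<integral>\<^sup>+\<omega>. jump_mean (\<lambda>y. ennreal (ext0 (occ l) y)) (Y k \<omega>) \<partial>M)"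
    using markov_mean[of "\<lambda>y. ennreal (ext0 (occ l) y)" k UNIV] unfolding * .
  then show ?case by (simp add: jump_mean_occ Suc.IH)
qed

lemma ext0_green_suminf: "ennreal (ext0 green y) = (\<Sum>l. ennreal (ext0 (occ l) y))"
  by (cases y) (auto simp: green_def suminf_ennreal2)

lemma jump_mean_suminf: "jump_mean (\<lambda>y. \<Sum>l. g l y) y = (\<Sum>l. jump_mean (g l) y)"
proof (cases y)
  case (Some i)
  have "(\<Sum>l. jump_mean (g l) (Some i)) =
    (\<Sum>l. ennreal (jump_prob i (up i)) * g l (up i)) +
    (\<Sum>l. \<Sum>j\<in>succs i. ennreal (jump_prob i (Some j)) * g l (Some j))"
    unfolding jump_mean_Some by (intro suminf_add[symmetric]) auto
  also have "(\<Sum>l. \<Sum>j\<in>succs i. ennreal (jump_prob i (Some j)) * g l (Some j)) =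
    (\<Sum>j\<in>succs i. \<Sum>l. ennreal (jump_prob i (Some j)) * g l (Some j))"
    by (intro suminf_sum) auto
  finally show ?thesis
    using Some by (simp add: jump_mean_Some del: jump_prob.simps)
qed simp

text \<open>The mean over one jump shifts the series of \<open>green\<close> by one term, so that
  exactly the term \<open>occ 0\<close> is lost.\<close>

lemma green_superharmonic:
  "jump_mean (\<lambda>y. ennreal (ext0 green y)) y \<le> ennreal (ext0 green y)"
proof -
  have "jump_mean (\<lambda>y. ennreal (ext0 green y)) y = (\<Sum>l. ennreal (ext0 (occ (Suc l)) y))"
    by (simp add: ext0_green_suminf jump_mean_suminf jump_mean_occ)
  also have "\<dots> \<le> ennreal (ext0 (occ 0) y) + (\<Sum>l. ennreal (ext0 (occ (Suc l)) y))"
    by simp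
  also have "\<dots> = ennreal (ext0 green y)"
    unfolding ext0_green_suminf
    by (subst (2) suminf_offset[of _ 1]) auto
  finally show ?thesis .
qed

lemma mean_green_small: "0 < \<delta> \<Longrightarrow> \<exists>n. (\<integral>\<^sup>+\<omega>. ennreal (ext0 green (Y n \<omega>)) \<partial>M) < ennreal \<delta>"
proof -
  assume "0 < \<delta>"
  from suminf_exist_split[OF this summable_occ[of r]] obtain n where n: "\<bar>\<Sum>l. occ (l + n) r\<bar> < \<delta>"
    by auto
  have "(\<integral>\<^sup>+\<omega>. ennreal (ext0 green (Y n \<omega>)) \<partial>M) = (\<Sum>l. \<integral>\<^sup>+\<omega>. ennreal (ext0 (occ l) (Y n \<omega>)) \<partial>M)"
    unfolding ext0_green_suminf
    by (intro nn_integral_suminf borel_Y[of "\<lambda>y. ennreal (ext0 (occ _) y)"])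
  also have "\<dots> = ennreal (\<Sum>l. occ (l + n) r)"
    unfolding mean_occ by (intro suminf_ennreal2) (auto intro: summable_ignore_initial_segment)
  also have "\<dots> < ennreal \<delta>"
    using n \<open>0 < \<delta>\<close> by (intro ennreal_lessI) auto
  finally show ?thesis by blast
qed

lemma AE_green_lim: "AE \<omega> in M. (\<lambda>n. ext0 green (Y n \<omega>)) \<longlonglongrightarrow> 0"
proof -
  have "AE \<omega> in M. \<exists>n. \<forall>l\<ge>n. ext0 green (Y l \<omega>) < c" if "0 < c" for c
  proof -
    define G where "G n = {\<omega> \<in> space M. Y n \<omega> \<in> UNIV \<and> (\<exists>l\<ge>n. ennreal c \<le> ennreal (ext0 green (Y l \<omega>)))}" for n
    have G_sets [measurable]: "G n \<in> sets M" for n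
    proof -
      have [measurable]: "(\<lambda>\<omega>. ennreal (ext0 green (Y l \<omega>))) \<in> borel_measurable M" for l
        by (rule borel_Y[of "\<lambda>y. ennreal (ext0 green y)"])
      show ?thesis unfolding G_def by measurable
    qed
    have G: "ennreal c * emeasure M (G n) \<le> (\<integral>\<^sup>+\<omega>. ennreal (ext0 green (Y n \<omega>)) \<partial>M)" for n
    proof -
      have "ennreal c * emeasure M (G n) \<le>
        (\<integral>\<^sup>+\<omega>. ennreal (ext0 green (Y n \<omega>)) * indicator {\<omega> \<in> space M. Y n \<omega> \<in> UNIV} \<omega> \<partial>M)"
        unfolding G_def by (rule maximal_inequality[OF green_superharmonic])
      also have "\<dots> = (\<integral>\<^sup>+\<omega>. ennreal (ext0 green (Y n \<omega>)) \<partial>M)"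
        by (intro nn_integral_cong) auto
      finally show ?thesis .
    qed
    \<comment> \<open>The maximal inequality bounds \<open>c\<close> times the probability of
      \<open>G n\<close> by the mean of \<open>green\<close> at time \<open>n\<close>, which falls
      below any positive number for some \<open>n\<close>.\<close>
    have "ennreal c * emeasure M (\<Inter>n. G n) \<le> 0"
    proof (rule ennreal_le_epsilon)
      fix \<delta> :: real assume "0 < \<delta>"
      then obtain n where n: "(\<integral>\<^sup>+\<omega>. ennreal (ext0 green (Y n \<omega>)) \<partial>M) < ennreal \<delta>"
        using mean_green_small by blast
      have "ennreal c * emeasure M (\<Inter>n. G n) \<le> ennreal c * emeasure M (G n)"
        by (intro mult_left_mono emeasure_mono) auto
      with G[of n] n show "ennreal c * emeasure M (\<Inter>n. G n) \<le> 0 + ennreal \<delta>" by simp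
    qed
    with that have "emeasure M (\<Inter>n. G n) = 0" by simp
    then have "AE \<omega> in M. \<omega> \<notin> (\<Inter>n. G n)"
      by (intro AE_not_in) (simp add: null_sets_def)
    with AE_space show ?thesis
    proof eventually_elim
      case (elim \<omega>)
      then obtain n where "\<omega> \<notin> G n" by blast
      with elim have "\<forall>l\<ge>n. \<not> ennreal c \<le> ennreal (ext0 green (Y l \<omega>))" by (auto simp: G_def)
      then have "\<forall>l\<ge>n. ext0 green (Y l \<omega>) < c"
        using that by (auto simp: not_le ennreal_le_iff2)
      then show ?case by blast
    qed
  qed
  then have "AE \<omega> in M. \<forall>m. \<exists>n. \<forall>l\<ge>n. ext0 green (Y l \<omega>) < inverse (real (Suc m))"
    by (simp add: AE_all_countable)
  then show ?thesis
    by eventually_elim (subst nonneg_LIMSEQ_0_iff, auto simp: ext0_nonneg)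
qed

end

section \<open>The exit law\<close>

context minimal_chain
begin

section \<open>From continuous time to the jump chain\<close>

lemma jump_time_mono: "\<omega> \<in> space M \<Longrightarrow> m \<le> n \<Longrightarrow> jump_time m \<omega> \<le> jump_time n \<omega>"
  unfolding jump_time_def by (rule sum_mono2) (auto intro: less_imp_le T_pos)

lemma jump_time_less_Suc: "\<omega> \<in> space M \<Longrightarrow> jump_time n \<omega> < jump_time (Suc n) \<omega>"
  by (simp add: jump_time_def T_pos)

lemma jump_time_nonneg: "\<omega> \<in> space M \<Longrightarrow> 0 \<le> jump_time n \<omega>"
  unfolding jump_time_def by (rule sum_nonneg) (auto intro: less_imp_le T_pos)

lemma lifetime_eq:
  assumes "\<omega> \<in> space M" "\<not> absorbed \<omega>"
  shows "lifetime \<omega> = (SUP n. ennreal (jump_time n \<omega>))"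
proof -
  have "lifetime \<omega> = (\<Sum>k. ennreal (T k \<omega>))"
    using assms(2) unfolding lifetime_def absorbed_def by (intro suminf_cong) (metis (full_types))
  also have "\<dots> = (SUP n. \<Sum>k<n. ennreal (T k \<omega>))"
    by (rule suminf_eq_SUP)
  also have "\<dots> = (SUP n. ennreal (jump_time n \<omega>))"
    using T_pos[OF assms(1)] by (simp add: jump_time_def sum_ennreal less_imp_le)
  finally show ?thesis .
qed

lemma jump_time_less_lifetime:
  assumes "\<omega> \<in> space M" "\<not> absorbed \<omega>"
  shows "ennreal (jump_time n \<omega>) < lifetime \<omega>"
proof -
  have "ennreal (jump_time n \<omega>) < ennreal (jump_time (Suc n) \<omega>)"
    using jump_time_less_Suc[OF assms(1), of n] jump_time_nonneg[OF assms(1), of n]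
    by (simp add: ennreal_less_iff)
  also have "\<dots> \<le> lifetime \<omega>"
    unfolding lifetime_eq[OF assms] by (rule SUP_upper) simp
  finally show ?thesis .
qed

lemma X_eq:
  assumes "\<omega> \<in> space M" "\<not> absorbed \<omega>" "jump_time n \<omega> \<le> t" "t < jump_time (Suc n) \<omega>"
  shows "X t \<omega> = Y n \<omega>"
proof -
  have "ennreal t < lifetime \<omega>"
    using assms(4) jump_time_less_lifetime[OF assms(1,2), of "Suc n"]
    by (meson ennreal_leI less_imp_le le_less_trans)
  moreover have "(THE n. jump_time n \<omega> \<le> t \<and> t < jump_time (Suc n) \<omega>) = n"
  proof (rule the_equality)
    fix m assume m: "jump_time m \<omega> \<le> t \<and> t < jump_time (Suc m) \<omega>"
    show "m = n"
    proof (rule ccontr)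
      assume "m \<noteq> n"
      then consider "Suc m \<le> n" | "Suc n \<le> m" by linarith
      then show False
        using jump_time_mono[OF assms(1), of "Suc m" n] jump_time_mono[OF assms(1), of "Suc n" m] m assms
        by cases auto
    qed
  qed (use assms in simp)
  ultimately show ?thesis by (simp add: X_def)
qed

lemma ex_jump_interval:
  assumes "\<omega> \<in> space M" "\<not> absorbed \<omega>" "ennreal t < lifetime \<omega>" "jump_time m \<omega> \<le> t"
  shows "\<exists>n\<ge>m. jump_time n \<omega> \<le> t \<and> t < jump_time (Suc n) \<omega>"
proof -
  obtain N where "ennreal t < ennreal (jump_time N \<omega>)"
    using assms(3) unfolding lifetime_eq[OF assms(1,2)] less_SUP_iff by blast
  then have "t < jump_time N \<omega>" by (metis ennreal_leI linorder_not_le)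
  moreover from this have "m \<le> N"
    using assms(4) jump_time_mono[OF assms(1), of N m] by (cases "m \<le> N") auto
  from this calculation assms(4) show ?thesis
  proof (induction N rule: dec_induct)
    case (step N)
    then show ?case by (cases "t < jump_time N \<omega>") (auto simp: not_less)
  qed simp
qed

text \<open>Explosion does not matter for the limit: only the jump chain does.\<close>

lemma tends_to_ray_iff:
  assumes "\<omega> \<in> space M" "\<not> absorbed \<omega>"
  shows "tends_to_ray \<omega> \<xi> \<longleftrightarrow> (\<forall>n. \<exists>N. \<forall>k\<ge>N. Y k \<omega> \<in> Some ` branch (\<xi> n))"
  unfolding tends_to_ray_def
proof (intro all_cong1 iffI)
  fix n assume "\<exists>s\<ge>0. ennreal s < lifetime \<omega> \<and>
     (\<forall>t\<ge>s. ennreal t < lifetime \<omega> \<longrightarrow> (\<exists>i. X t \<omega> = Some i \<and> \<xi> n \<in> geo i))"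
  then obtain s where s: "0 \<le> s" "ennreal s < lifetime \<omega>"
    "\<And>t. s \<le> t \<Longrightarrow> ennreal t < lifetime \<omega> \<Longrightarrow> \<exists>i. X t \<omega> = Some i \<and> \<xi> n \<in> geo i" by blast
  obtain m where m: "jump_time m \<omega> \<le> s" "s < jump_time (Suc m) \<omega>"
    using ex_jump_interval[OF assms s(2), of 0] s(1) by (auto simp: jump_time_def)
  have "Y k \<omega> \<in> Some ` branch (\<xi> n)" if "k \<ge> Suc m" for k
  proof -
    have "s \<le> jump_time k \<omega>" using m jump_time_mono[OF assms(1) that] by simp
    from s(3)[OF this jump_time_less_lifetime[OF assms]]
      X_eq[OF assms order_refl jump_time_less_Suc[OF assms(1)]]
    show ?thesis by (auto simp: branch_def)
  qed
  then show "\<exists>N. \<forall>k\<ge>N. Y k \<omega> \<in> Some ` branch (\<xi> n)" by blast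
next
  fix n assume "\<exists>N. \<forall>k\<ge>N. Y k \<omega> \<in> Some ` branch (\<xi> n)"
  then obtain N where N: "\<And>k. k \<ge> N \<Longrightarrow> Y k \<omega> \<in> Some ` branch (\<xi> n)" by blast
  show "\<exists>s\<ge>0. ennreal s < lifetime \<omega> \<and>
     (\<forall>t\<ge>s. ennreal t < lifetime \<omega> \<longrightarrow> (\<exists>i. X t \<omega> = Some i \<and> \<xi> n \<in> geo i))"
  proof (intro exI[of _ "jump_time N \<omega>"] conjI allI impI)
    fix t assume t: "jump_time N \<omega> \<le> t" "ennreal t < lifetime \<omega>"
    then obtain m where "m \<ge> N" "jump_time m \<omega> \<le> t \<and> t < jump_time (Suc m) \<omega>"
      using ex_jump_interval[OF assms t(2,1)] by blast
    with N[of m] X_eq[OF assms, of m t] show "\<exists>i. X t \<omega> = Some i \<and> \<xi> n \<in> geo i"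
      by (auto simp: branch_def)
  qed (use assms jump_time_nonneg jump_time_less_lifetime in auto)
qed

section \<open>The exit event and the exit ray\<close>

lemma tends_to_ray_unique:
  assumes "\<omega> \<in> space M" "\<not> absorbed \<omega>" "tends_to_ray \<omega> \<xi>" "tends_to_ray \<omega> \<eta>" "\<xi> \<in> rays" "\<eta> \<in> rays"
  shows "\<xi> = \<eta>"
proof
  fix n
  obtain N N' where "\<And>k. k \<ge> N \<Longrightarrow> Y k \<omega> \<in> Some ` branch (\<xi> n)"
    "\<And>k. k \<ge> N' \<Longrightarrow> Y k \<omega> \<in> Some ` branch (\<eta> n)"
    using assms(3,4) unfolding tends_to_ray_iff[OF assms(1,2)] by metis
  from this(1)[of "max N N'"] this(2)[of "max N N'"] show "\<xi> n = \<eta> n"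
    using assms(5,6) by (auto simp: branch_iff)
qed

text \<open>The definition quantifies over all rays. The branches in which the chain finally stays
  determine the ray, so quantifiers over levels, sites and times suffice and the event is
  measurable.\<close>

lemma exits_in_rays_eq:
  "exits_in rays = {\<omega> \<in> space M. \<not> absorbed \<omega> \<and>
    (\<forall>n. \<exists>i\<in>{i. level i = n}. \<exists>N. \<forall>k\<ge>N. Y k \<omega> \<in> Some ` branch i)}"
proof (intro set_eqI iffI)
  fix \<omega> assume "\<omega> \<in> exits_in rays"
  then obtain \<xi> where "\<omega> \<in> space M" "\<not> absorbed \<omega>" "\<xi> \<in> rays" "tends_to_ray \<omega> \<xi>"
    by (auto simp: exits_in_def)
  moreover from this have "\<xi> n \<in> {i. level i = n}" for n by simp
  ultimately show "\<omega> \<in> {\<omega> \<in> space M. \<not> absorbed \<omega> \<and>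
    (\<forall>n. \<exists>i\<in>{i. level i = n}. \<exists>N. \<forall>k\<ge>N. Y k \<omega> \<in> Some ` branch i)}"
    using tends_to_ray_iff[of \<omega> \<xi>] by blast
next
  fix \<omega> assume "\<omega> \<in> {\<omega> \<in> space M. \<not> absorbed \<omega> \<and>
    (\<forall>n. \<exists>i\<in>{i. level i = n}. \<exists>N. \<forall>k\<ge>N. Y k \<omega> \<in> Some ` branch i)}"
  then have \<omega>: "\<omega> \<in> space M" "\<not> absorbed \<omega>"
    and "\<forall>n. \<exists>i. level i = n \<and> (\<exists>N. \<forall>k\<ge>N. Y k \<omega> \<in> Some ` branch i)" by auto
  then obtain \<xi> where \<xi>: "\<And>n. level (\<xi> n) = n" "\<And>n. \<exists>N. \<forall>k\<ge>N. Y k \<omega> \<in> Some ` branch (\<xi> n)"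
    by metis
  \<comment> \<open>The sites were chosen separately for each level. Finally the chain is in both
    branches at once, which forces them to be nested.\<close>
  have "pred (\<xi> (Suc n)) = \<xi> n" for n
  proof -
    obtain N N' where N: "\<And>k. k \<ge> N \<Longrightarrow> Y k \<omega> \<in> Some ` branch (\<xi> n)"
      "\<And>k. k \<ge> N' \<Longrightarrow> Y k \<omega> \<in> Some ` branch (\<xi> (Suc n))"
      using \<xi>(2) by metis
    from N(1)[of "max N N'"] N(2)[of "max N N'"] obtain j where
      "j \<in> branch (\<xi> n)" "j \<in> branch (\<xi> (Suc n))" by auto
    then show ?thesis using pred_anc[of n j] by (simp add: branch_iff \<xi>(1))
  qed
  moreover have "\<xi> 0 = r" "\<And>n. \<xi> (Suc n) \<noteq> r"
    using \<xi>(1) level_eq_0_iff by (metis, metis nat.distinct(1))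
  ultimately have "\<xi> \<in> rays" by (simp add: rays_def succs_def)
  with \<omega> \<xi> show "\<omega> \<in> exits_in rays" by (auto simp: exits_in_def tends_to_ray_iff)
qed

lemma exits_in_rays_sets [measurable]: "exits_in rays \<in> sets M"
proof -
  have "finite {i. level i = n}" for n by (rule finite_subset[OF _ finite_ball[of n]]) auto
  then show ?thesis unfolding exits_in_rays_eq absorbed_def by measurable
qed

text \<open>Off the exit event the value is a fixed ray, since measurability into
  \<open>boundary_space\<close> requires a map with values in \<open>rays\<close>.\<close>

definition exit_ray :: "'b \<Rightarrow> nat \<Rightarrow> 'a" where
  "exit_ray \<omega> = (if \<omega> \<in> exits_in rays then THE \<xi>. \<xi> \<in> rays \<and> tends_to_ray \<omega> \<xi>
     else SOME \<xi>. \<xi> \<in> rays)"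

lemma exit_ray:
  assumes "\<omega> \<in> exits_in rays"
  shows "exit_ray \<omega> \<in> rays" "tends_to_ray \<omega> (exit_ray \<omega>)"
proof -
  have "\<exists>!\<xi>. \<xi> \<in> rays \<and> tends_to_ray \<omega> \<xi>"
    using assms tends_to_ray_unique by (auto simp: exits_in_def)
  from theI'[OF this] assms show "exit_ray \<omega> \<in> rays" "tends_to_ray \<omega> (exit_ray \<omega>)"
    by (simp_all add: exit_ray_def)
qed

lemma exit_rayI:
  assumes "\<omega> \<in> space M" "\<not> absorbed \<omega>" "\<xi> \<in> rays" "tends_to_ray \<omega> \<xi>"
  shows "\<omega> \<in> exits_in rays" "exit_ray \<omega> = \<xi>"
proof -
  show *: "\<omega> \<in> exits_in rays" using assms by (auto simp: exits_in_def)
  show "exit_ray \<omega> = \<xi>" using tends_to_ray_unique[OF assms(1,2)] exit_ray[OF *] assms by blast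
qed

lemma exits_in_eq: "A \<subseteq> rays \<Longrightarrow> exits_in A = {\<omega> \<in> exits_in rays. exit_ray \<omega> \<in> A}"
proof (intro set_eqI iffI)
  fix \<omega> assume A: "A \<subseteq> rays" and "\<omega> \<in> exits_in A"
  then obtain \<xi> where \<xi>: "\<omega> \<in> space M" "\<not> absorbed \<omega>" "\<xi> \<in> A" "tends_to_ray \<omega> \<xi>"
    by (auto simp: exits_in_def)
  with exit_rayI[of \<omega> \<xi>] A show "\<omega> \<in> {\<omega> \<in> exits_in rays. exit_ray \<omega> \<in> A}" by auto
next
  fix \<omega> assume "A \<subseteq> rays" and "\<omega> \<in> {\<omega> \<in> exits_in rays. exit_ray \<omega> \<in> A}"
  with exit_ray[of \<omega>] show "\<omega> \<in> exits_in A" by (auto simp: exits_in_def)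
qed

text \<open>The chain finally stays in the branch at the vertex of level \<open>level i\<close> on
  its exit ray. This branch is either the one at \<open>i\<close> or disjoint from it, so the chain
  cannot keep entering and leaving the branch at \<open>i\<close>.\<close>

lemma exit_ray_in_cyl_iff:
  assumes "\<omega> \<in> exits_in rays"
  shows "exit_ray \<omega> \<in> cyl i \<longleftrightarrow> (\<exists>N. \<forall>k\<ge>N. Y k \<omega> \<in> Some ` branch i)"
    and "exit_ray \<omega> \<notin> cyl i \<longleftrightarrow> (\<exists>N. \<forall>k\<ge>N. Y k \<omega> \<notin> Some ` branch i)"
proof -
  let ?\<xi> = "exit_ray \<omega>"
  have ray: "?\<xi> \<in> rays" by (rule exit_ray[OF assms])
  have "\<omega> \<in> space M" "\<not> absorbed \<omega>" using assms by (auto simp: exits_in_def)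
  from tends_to_ray_iff[OF this] exit_ray[OF assms]
  obtain N where N: "\<And>k. k \<ge> N \<Longrightarrow> Y k \<omega> \<in> Some ` branch (?\<xi> (level i))" by blast
  have 1: "\<exists>N. \<forall>k\<ge>N. Y k \<omega> \<in> Some ` branch i" if "?\<xi> \<in> cyl i"
    using N that by (auto simp: cyl_iff)
  have 2: "\<exists>N. \<forall>k\<ge>N. Y k \<omega> \<notin> Some ` branch i" if "?\<xi> \<notin> cyl i"
  proof (intro exI allI impI notI)
    fix k assume "N \<le> k" "Y k \<omega> \<in> Some ` branch i"
    with N[of k] ray have "?\<xi> (level i) = i" by (auto simp: branch_iff)
    with that ray show False by (simp add: cyl_iff)
  qed
  have 3: "\<not> ((\<exists>N. \<forall>k\<ge>N. Y k \<omega> \<in> Some ` branch i) \<and> (\<exists>N. \<forall>k\<ge>N. Y k \<omega> \<notin> Some ` branch i))"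
    by (meson nat_le_linear)
  show "exit_ray \<omega> \<in> cyl i \<longleftrightarrow> (\<exists>N. \<forall>k\<ge>N. Y k \<omega> \<in> Some ` branch i)"
    "exit_ray \<omega> \<notin> cyl i \<longleftrightarrow> (\<exists>N. \<forall>k\<ge>N. Y k \<omega> \<notin> Some ` branch i)"
    using 1 2 3 by blast+
qed

text \<open>Without absorption the path runs along edges and visits each site finitely often, so
  \<open>converges_to_ray\<close> applies to it. The late visits carry limits from path to ray in
  \<open>AE_green_ray\<close> and from ray to path in \<open>harmonic_le_0\<close>.\<close>

lemma AE_exit:
  "AE \<omega> in M. \<not> absorbed \<omega> \<longrightarrow> \<omega> \<in> exits_in rays \<and> (\<forall>n. \<exists>k\<ge>n. Y k \<omega> = Some (exit_ray \<omega> n))"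
  using AE_step AE_finite_visits AE_space
proof eventually_elim
  case (elim \<omega>)
  show ?case
  proof
    assume na: "\<not> absorbed \<omega>"
    define y where "y k = the (Y k \<omega>)" for k
    have y: "Y k \<omega> = Some (y k)" for k using na by (auto simp: y_def absorbed_def)
    have "\<exists>\<xi>\<in>rays. (\<forall>n. eventually (\<lambda>k. y k \<in> branch (\<xi> n)) sequentially) \<and> (\<forall>n. \<exists>k\<ge>n. y k = \<xi> n)"
    proof (rule converges_to_ray)
      show "y 0 = r" using Y_start[of \<omega>] elim by (simp add: y_def)
      show "adj (y k) (y (Suc k))" for k
        by (rule step_adj[OF elim(1)[rule_format, OF y] y])
      show "finite {k. y k = i}" for i
        using elim(2) by (simp add: y)
    qed
    then obtain \<xi> where \<xi>: "\<xi> \<in> rays" "\<And>n. eventually (\<lambda>k. y k \<in> branch (\<xi> n)) sequentially"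
      "\<And>n. \<exists>k\<ge>n. y k = \<xi> n" by blast
    have "tends_to_ray \<omega> \<xi>"
      using \<xi>(2) elim(3) na by (simp add: tends_to_ray_iff eventually_sequentially y image_iff)
    from exit_rayI[OF elim(3) na \<xi>(1) this] \<xi>(3)
    show "\<omega> \<in> exits_in rays \<and> (\<forall>n. \<exists>k\<ge>n. Y k \<omega> = Some (exit_ray \<omega> n))" by (simp add: y)
  qed
qed

text \<open>Almost surely the chain finally stays inside the branch or outside it, absorption
  counting as outside. Hence the indicators converge, and dominated convergence identifies the limit
  of the flux balance.\<close>

lemma prob_exits_in_cyl: "prob (exits_in (cyl i)) = exit_prob i"
proof -
  define E where "E = exits_in (cyl i)"
  have E_eq: "E = {\<omega> \<in> exits_in rays. \<exists>N. \<forall>k\<ge>N. Y k \<omega> \<in> Some ` branch i}"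
    unfolding E_def exits_in_eq[OF cyl_subset_rays] using exit_ray_in_cyl_iff(1) by blast
  have "E = exits_in rays \<inter> {\<omega> \<in> space M. \<exists>N. \<forall>k\<ge>N. Y k \<omega> \<in> Some ` branch i}"
    unfolding E_eq by (auto simp: exits_in_def)
  then have [measurable]: "E \<in> sets M" by simp
  let ?B = "\<lambda>n. {\<omega> \<in> space M. Y n \<omega> \<in> Some ` branch i}"
  have "(\<lambda>n. \<integral>\<omega>. indicator (?B n) \<omega> \<partial>M) \<longlonglongrightarrow> (\<integral>\<omega>. indicator E \<omega> \<partial>M :: real)"
  proof (rule integral_dominated_convergence[where w = "\<lambda>_. 1"])
    show "AE \<omega> in M. (\<lambda>n. indicator (?B n) \<omega> :: real) \<longlonglongrightarrow> indicator E \<omega>"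
      using AE_exit AE_space
    proof eventually_elim
      case (elim \<omega>)
      show ?case
      proof (cases "\<omega> \<in> E")
        case True
        then obtain N where "\<And>k. k \<ge> N \<Longrightarrow> Y k \<omega> \<in> Some ` branch i" unfolding E_eq by blast
        with True elim show ?thesis
          by (intro tendsto_eventually) (auto simp: eventually_sequentially intro!: exI[of _ N])
      next
        case False
        have "\<exists>N. \<forall>k\<ge>N. Y k \<omega> \<notin> Some ` branch i"
        proof (cases "absorbed \<omega>")
          case True
          then obtain N where "Y N \<omega> = None" by (auto simp: absorbed_def)
          with Y_absorbed_le[OF elim(2)] show ?thesis by (intro exI[of _ N]) auto
        next
          case False
          with elim have "\<omega> \<in> exits_in rays" by blast
          with \<open>\<omega> \<notin> E\<close> exit_ray_in_cyl_iff[OF this, of i] show ?thesis unfolding E_eq by blast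
        qed
        then obtain N where "\<And>k. k \<ge> N \<Longrightarrow> Y k \<omega> \<notin> Some ` branch i" by blast
        with False show ?thesis
          by (intro tendsto_eventually) (auto simp: eventually_sequentially intro!: exI[of _ N])
      qed
    qed
  qed (auto simp: indicator_def)
  then have "(\<lambda>n. prob_branch n i) \<longlonglongrightarrow> prob E"
    by (simp add: prob_branch_def)
  with prob_branch_lim show ?thesis unfolding E_def by (rule LIMSEQ_unique[rotated])
qed

lemma exit_ray_measurable:
  assumes "transient"
  shows "exit_ray \<in> measurable M boundary_space"
  unfolding boundary_space_def
proof (rule measurable_measure_of[OF range_cyl_Pow])
  obtain \<omega> where "\<omega> \<in> exits_in rays"
    using assms by (metis transient_def equals0I less_irrefl measure_empty)
  then have "\<exists>\<xi>. \<xi> \<in> rays" using exit_ray by blast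
  then have some: "(SOME \<xi>. \<xi> \<in> rays) \<in> rays" by (rule someI_ex)
  with exit_ray show "exit_ray \<in> space M \<rightarrow> rays" by (auto simp: exit_ray_def)
  fix A assume "A \<in> range cyl"
  then obtain i where A: "A = cyl i" by blast
  have "exit_ray -` A \<inter> space M =
    (exits_in rays \<inter> {\<omega> \<in> space M. \<exists>N. \<forall>k\<ge>N. Y k \<omega> \<in> Some ` branch i}) \<union>
    (if (SOME \<xi>. \<xi> \<in> rays) \<in> A then space M - exits_in rays else {})" (is "?L = ?R")
  proof (intro set_eqI)
    fix \<omega>
    show "\<omega> \<in> ?L \<longleftrightarrow> \<omega> \<in> ?R"
    proof (cases "\<omega> \<in> exits_in rays")
      case True
      then have "\<omega> \<in> space M" by (simp add: exits_in_def)
      with True exit_ray_in_cyl_iff(1)[OF True, of i] show ?thesis by (simp add: A)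
    next
      case False
      then have "exit_ray \<omega> = (SOME \<xi>. \<xi> \<in> rays)" by (simp add: exit_ray_def)
      with False show ?thesis by auto
    qed
  qed
  moreover have "exits_in rays \<inter> {\<omega> \<in> space M. \<exists>N. \<forall>k\<ge>N. Y k \<omega> \<in> Some ` branch i} \<in> sets M"
    by measurable
  then have "?R \<in> sets M" by (cases "(SOME \<xi>. \<xi> \<in> rays) \<in> A") (simp_all only: if_True if_False
    sets.Un sets.compl_sets exits_in_rays_sets sets.empty_sets)
  ultimately show "exit_ray -` A \<inter> space M \<in> sets M" by (simp only:)
qed

context
  assumes transient: "transient"
begin

section \<open>The exit law as an image measure\<close>

lemma exit_prob_pos: "0 < exit_prob r"
  using transient prob_exits_in_cyl[of r] by (simp add: transient_def)

text \<open>\<open>measure_of\<close> returns the given set function only if that function is a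
  measure. Countable additivity comes from recognising it as the image of the conditioned law under
  \<open>exit_ray\<close>.\<close>

lemma exit_law_eq: "exit_law = distr (uniform_measure M (exits_in rays)) boundary_space exit_ray"
proof -
  let ?D = "distr (uniform_measure M (exits_in rays)) boundary_space exit_ray"
  have meas: "exit_ray \<in> measurable (uniform_measure M (exits_in rays)) boundary_space"
    using exit_ray_measurable[OF transient] by simp
  have "emeasure M (exits_in A) / emeasure M (exits_in rays) = emeasure ?D A"
    if A: "A \<in> sets boundary_space" for A
  proof -
    have sub: "A \<subseteq> rays" using sets.sets_into_space[OF A] by simp
    have "emeasure ?D A = emeasure (uniform_measure M (exits_in rays)) (exit_ray -` A \<inter> space M)"
      using A by (simp add: emeasure_distr[OF meas])
    also have "\<dots> = emeasure M (exits_in rays \<inter> (exit_ray -` A \<inter> space M)) / emeasure M (exits_in rays)"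
      using measurable_sets[OF exit_ray_measurable[OF transient] A]
      by (intro emeasure_uniform_measure) auto
    also have "exits_in rays \<inter> (exit_ray -` A \<inter> space M) = exits_in A"
      unfolding exits_in_eq[OF sub] by (auto simp: exits_in_def)
    finally show ?thesis by simp
  qed
  then have "exit_law = measure_of rays (sets boundary_space) (emeasure ?D)"
    unfolding exit_law_def
    by (intro measure_of_eq) (use sets.space_closed[of boundary_space] in
      \<open>auto simp: sets.sigma_sets_eq[of boundary_space, simplified]\<close>)
  also have "\<dots> = ?D"
    using measure_of_of_measure[of ?D] by simp
  finally show ?thesis .
qed

lemma sets_exit_law [simp, measurable_cong]: "sets exit_law = sets boundary_space"
  by (simp add: exit_law_eq)

lemma space_exit_law [simp]: "space exit_law = rays"
  by (simp add: exit_law_eq)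

lemma emeasure_exits_pos: "emeasure M (exits_in rays) \<noteq> 0"
  using transient by (simp add: transient_def emeasure_eq_measure)

lemma prob_space_exit_law: "prob_space exit_law"
  unfolding exit_law_eq
  using emeasure_exits_pos exit_ray_measurable[OF transient]
  by (intro prob_space.prob_space_distr prob_space_uniform_measure) auto

lemma AE_exit_lawD:
  assumes "AE \<xi> in exit_law. P \<xi>"
  shows "AE \<omega> in M. \<omega> \<in> exits_in rays \<longrightarrow> P (exit_ray \<omega>)"
proof -
  have "exit_ray \<in> measurable (uniform_measure M (exits_in rays)) boundary_space"
    using exit_ray_measurable[OF transient] by simp
  from AE_distrD[OF this assms[unfolded exit_law_eq]] emeasure_exits_pos
  show ?thesis by (simp add: AE_uniform_measure emeasure_eq_measure)
qed

lemma AE_exit_lawI: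
  assumes [measurable]: "Measurable.pred boundary_space P"
    and "AE \<omega> in M. \<omega> \<in> exits_in rays \<longrightarrow> P (exit_ray \<omega>)"
  shows "AE \<xi> in exit_law. P \<xi>"
proof -
  have *: "exit_ray \<in> measurable (uniform_measure M (exits_in rays)) boundary_space"
    using exit_ray_measurable[OF transient] by simp
  have "{\<xi> \<in> space boundary_space. P \<xi>} \<in> sets boundary_space" by measurable
  from AE_distr_iff[OF * this] assms(2) emeasure_exits_pos
  show ?thesis unfolding exit_law_eq by (simp add: AE_uniform_measure emeasure_eq_measure)
qed

lemma measure_exit_law_cyl: "measure exit_law (cyl i) = exit_prob i / exit_prob r"
proof -
  have "measure exit_law (cyl i) = prob (exits_in rays \<inter> (exit_ray -` cyl i \<inter> space M)) / prob (exits_in rays)"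
    unfolding exit_law_eq
    using exit_ray_measurable[OF transient] emeasure_exits_pos
    by (subst measure_distr) (auto simp: measure_uniform_measure)
  also have "exits_in rays \<inter> (exit_ray -` cyl i \<inter> space M) = exits_in (cyl i)"
    unfolding exits_in_eq[OF cyl_subset_rays] by (auto simp: exits_in_def)
  finally show ?thesis using prob_exits_in_cyl[of i] prob_exits_in_cyl[of r] by simp
qed

lemma coord_measurable [measurable]: "(\<lambda>\<xi>. \<xi> n) \<in> measurable boundary_space (count_space UNIV)"
proof (subst measurable_count_space_eq_countable)
  have "(\<lambda>\<xi>. \<xi> n) -` {i} \<inter> rays = (if level i = n then cyl i else {})" for i
    by (auto simp: cyl_iff)
  then show "(\<lambda>\<xi>. \<xi> n) \<in> space boundary_space \<rightarrow> UNIV \<and>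
      (\<forall>a\<in>UNIV. (\<lambda>\<xi>. \<xi> n) -` {a} \<inter> space boundary_space \<in> sets boundary_space)" by simp
qed simp

lemma AE_green_ray: "AE \<xi> in exit_law. (\<lambda>n. green (\<xi> n)) \<longlonglongrightarrow> 0"
proof (rule AE_exit_lawI)
  have [measurable]: "(\<lambda>\<xi>. green (\<xi> n)) \<in> borel_measurable boundary_space" for n
    by (rule measurable_compose[OF coord_measurable]) simp
  show "Measurable.pred boundary_space (\<lambda>\<xi>. (\<lambda>n. green (\<xi> n)) \<longlonglongrightarrow> 0)"
    by (subst nonneg_LIMSEQ_0_iff) (simp, measurable)
  show "AE \<omega> in M. \<omega> \<in> exits_in rays \<longrightarrow> (\<lambda>n. green (exit_ray \<omega> n)) \<longlonglongrightarrow> 0"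
    using AE_exit AE_green_lim
  proof eventually_elim
    case (elim \<omega>)
    show ?case
    proof
      assume "\<omega> \<in> exits_in rays"
      then have vis: "\<forall>n. \<exists>k\<ge>n. Y k \<omega> = Some (exit_ray \<omega> n)"
        using elim(1) by (auto simp: exits_in_def)
      show "(\<lambda>n. green (exit_ray \<omega> n)) \<longlonglongrightarrow> 0"
        unfolding nonneg_LIMSEQ_0_iff[OF green_nonneg]
      proof
        fix m
        obtain N where N: "\<And>l. l \<ge> N \<Longrightarrow> ext0 green (Y l \<omega>) < inverse (real (Suc m))"
          using elim(2) by (subst (asm) nonneg_LIMSEQ_0_iff) (auto simp: ext0_nonneg)
        have "green (exit_ray \<omega> l) < inverse (real (Suc m))" if "l \<ge> N" for l
        proof -
          obtain k where "k \<ge> l" "Y k \<omega> = Some (exit_ray \<omega> l)" using vis by blast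
          with N[of k] that show ?thesis by simp
        qed
        then show "\<exists>N. \<forall>l\<ge>N. green (exit_ray \<omega> l) < inverse (real (Suc m))" by blast
      qed
    qed
  qed
qed

text \<open>The chain started at \<open>i\<close> almost surely comes to sites where the nonnegative function
  \<open>C - h\<close>, extended by \<open>C\<close> to the cemetery, is at least \<open>C - \<epsilon>\<close>; hence
  \<open>C - h i \<ge> C - \<epsilon>\<close> by the maximal inequality.\<close>

lemma harmonic_le_0:
  assumes h: "harmonic h" and bdd: "\<And>i. \<bar>h i\<bar> \<le> C"
    and lim: "AE \<xi> in exit_law. (\<lambda>n. h (\<xi> n)) \<longlonglongrightarrow> 0"
  shows "h i \<le> 0"
proof (rule field_le_epsilon)
  fix \<epsilon> :: real assume \<epsilon>: "0 < \<epsilon>"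
  have C: "0 \<le> C" using bdd[of i] by simp
  \<comment> \<open>The mean over one jump preserves functions that are constant on sites and
    cemetery together, so the shifted function keeps the mean value property, also at the
    root.\<close>
  define g where "g y = C - ext0 h y" for y
  have g: "0 \<le> g y" for y using bdd C abs_le_D1 by (cases y) (auto simp: g_def)
  have "jump_mean (\<lambda>y. ennreal (g y)) y \<le> ennreal (g y)" for y
  proof (cases y)
    case (Some j)
    have "g (up j) / incr (level j) + (\<Sum>k\<in>succs j. g (Some k)) / incr (Suc (level j)) =
      C * exit_rate j - (ext0 h (up j) / incr (level j) + (\<Sum>k\<in>succs j. h k) / incr (Suc (level j)))"
      by (simp add: g_def sum_subtractf diff_divide_distrib exit_rate_eq algebra_simps)
    also have "\<dots> = exit_rate j * g y"
      using h Some unfolding harmonic_iff by (simp add: g_def algebra_simps)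
    finally show ?thesis using Some g by (simp add: jump_mean_ennreal)
  qed simp
  note max = maximal_inequality[of "\<lambda>y. ennreal (g y)", OF this]
  obtain n where n: "prob {\<omega> \<in> space M. Y n \<omega> = Some i} > 0" using visits_pos by blast
  let ?E = "{\<omega> \<in> space M. Y n \<omega> = Some i}"
  let ?F = "{\<omega> \<in> space M. Y n \<omega> \<in> {Some i} \<and> (\<exists>l\<ge>n. ennreal (C - \<epsilon>) \<le> ennreal (g (Y l \<omega>)))}"
  have "emeasure M ?E = emeasure M ?F"
  proof (rule emeasure_eq_AE)
    show "AE \<omega> in M. \<omega> \<in> ?E \<longleftrightarrow> \<omega> \<in> ?F"
      using AE_exit AE_exit_lawD[OF lim] AE_space
    proof eventually_elim
      case (elim \<omega>)
      have "\<exists>l\<ge>n. C - \<epsilon> \<le> g (Y l \<omega>)"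
      proof (cases "absorbed \<omega>")
        case True
        then obtain N where "Y N \<omega> = None" by (auto simp: absorbed_def)
        with Y_absorbed_le[OF elim(3), of N "max n N"] \<epsilon> show ?thesis
          by (intro exI[of _ "max n N"]) (simp add: g_def)
      next
        case False
        with elim have *: "(\<lambda>m. h (exit_ray \<omega> m)) \<longlonglongrightarrow> 0" "\<And>m. \<exists>k\<ge>m. Y k \<omega> = Some (exit_ray \<omega> m)"
          by blast+
        from LIMSEQ_D[OF *(1) \<epsilon>] obtain N where N: "\<And>m. m \<ge> N \<Longrightarrow> \<bar>h (exit_ray \<omega> m)\<bar> < \<epsilon>"
          by auto
        obtain k where "k \<ge> max n N" "Y k \<omega> = Some (exit_ray \<omega> (max n N))" using *(2) by blast
        with N[of "max n N"] show ?thesis by (intro exI[of _ k]) (simp add: g_def)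
      qed
      then show ?case using elim by (auto intro: ennreal_leI)
    qed
    have "(\<lambda>\<omega>. ennreal (g (Y l \<omega>))) \<in> borel_measurable M" for l
      by (rule borel_Y[of "\<lambda>y. ennreal (g y)"])
    then show "?F \<in> sets M" by measurable
  qed measurable
  then have "ennreal (C - \<epsilon>) * emeasure M ?E \<le>
      (\<integral>\<^sup>+\<omega>. ennreal (g (Y n \<omega>)) * indicator {\<omega> \<in> space M. Y n \<omega> \<in> {Some i}} \<omega> \<partial>M)"
    using max[of "ennreal (C - \<epsilon>)" n "{Some i}"] by simp
  also have "\<dots> = (\<integral>\<^sup>+\<omega>. ennreal (C - h i) * indicator ?E \<omega> \<partial>M)"
    by (intro nn_integral_cong) (auto simp: g_def indicator_def)
  also have "\<dots> = ennreal (C - h i) * emeasure M ?E"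
    by (simp add: nn_integral_cmult_indicator)
  finally have "emeasure M ?E * ennreal (C - \<epsilon>) \<le> emeasure M ?E * ennreal (C - h i)"
    by (simp only: mult.commute)
  then have "ennreal (C - \<epsilon>) \<le> ennreal (C - h i)"
    using n by (subst (asm) ennreal_mult_le_mult_iff) (auto simp: emeasure_eq_measure)
  moreover have "0 \<le> C - h i" using bdd[of i] by simp
  ultimately show "h i \<le> 0 + \<epsilon>" by simp
qed

section \<open>Uniqueness of bounded harmonic functions with given limits\<close>

lemma harmonic_diff: "harmonic g \<Longrightarrow> harmonic h \<Longrightarrow> harmonic (\<lambda>i. g i - h i)"
proof -
  assume gh: "harmonic g" "harmonic h"
  have "ext0 (\<lambda>i. g i - h i) y = ext0 g y - ext0 h y" for y by (cases y) auto
  then have "ext0 (\<lambda>i. g i - h i) (up i) / incr (level i) +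
      (\<Sum>j\<in>succs i. g j - h j) / incr (Suc (level i)) =
    (ext0 g (up i) / incr (level i) + (\<Sum>j\<in>succs i. g j) / incr (Suc (level i))) -
    (ext0 h (up i) / incr (level i) + (\<Sum>j\<in>succs i. h j) / incr (Suc (level i)))" for i
    by (simp add: sum_subtractf diff_divide_distrib)
  with gh show ?thesis unfolding harmonic_iff by (simp add: right_diff_distrib)
qed

lemma harmonic_unique:
  assumes g: "harmonic g" "bounded (range g)" and h: "harmonic h" "bounded (range h)"
    and lim: "AE \<xi> in exit_law. (\<lambda>n. g (\<xi> n)) \<longlonglongrightarrow> \<phi> \<xi>" "AE \<xi> in exit_law. (\<lambda>n. h (\<xi> n)) \<longlonglongrightarrow> \<phi> \<xi>"
  shows "g = h"
proof -
  have *: "f i \<le> f' i" if f: "harmonic f" "bounded (range f)" and f': "harmonic f'" "bounded (range f')"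
    and lim: "AE \<xi> in exit_law. (\<lambda>n. f (\<xi> n)) \<longlonglongrightarrow> \<phi> \<xi>" "AE \<xi> in exit_law. (\<lambda>n. f' (\<xi> n)) \<longlonglongrightarrow> \<phi> \<xi>"
    for f f' i
  proof -
    obtain B B' where B: "\<And>i. \<bar>f i\<bar> \<le> B" "\<And>i. \<bar>f' i\<bar> \<le> B'"
      using f(2) f'(2) by (auto simp: bounded_iff)
    have "\<bar>f i - f' i\<bar> \<le> B + B'" for i using B(1)[of i] B(2)[of i] by linarith
    moreover have "AE \<xi> in exit_law. (\<lambda>n. f (\<xi> n) - f' (\<xi> n)) \<longlonglongrightarrow> 0"
      using lim by eventually_elim (use tendsto_diff in fastforce)
    ultimately have "f i - f' i \<le> 0"
      by (intro harmonic_le_0 harmonic_diff f f')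
    then show ?thesis by simp
  qed
  show ?thesis
    by (rule ext) (intro order_antisym * assms)
qed

end

end

section \<open>The operator \<open>W\<close>\<close>

context minimal_chain
begin

definition mass :: "((nat \<Rightarrow> 'a) \<Rightarrow> real) \<Rightarrow> 'a \<Rightarrow> real" where
  "mass f i = (\<integral>\<xi>. indicator (cyl i) \<xi> * f \<xi> \<partial>exit_law)"

text \<open>The pairing \<open>\<integral>\<integral> f \<xi> U \<xi> \<eta> g \<eta>\<close> is the sum over \<open>k\<close> of \<open>incr k * level_pairing f g k\<close>.\<close>

definition level_pairing :: "((nat \<Rightarrow> 'a) \<Rightarrow> real) \<Rightarrow> ((nat \<Rightarrow> 'a) \<Rightarrow> real) \<Rightarrow> nat \<Rightarrow> real" where
  "level_pairing f g k = (\<Sum>i | level i = k. mass f i * mass g i)"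

definition site_potential :: "((nat \<Rightarrow> 'a) \<Rightarrow> real) \<Rightarrow> 'a \<Rightarrow> real" where
  "site_potential f i = (\<Sum>k\<le>level i. incr k * mass f (anc k i))"

context
  assumes transient: "transient"
begin

interpretation E: prob_space exit_law
  by (rule prob_space_exit_law[OF transient])

lemmas exit_law_sets [simp, measurable_cong] = sets_exit_law[OF transient]
lemmas exit_law_space [simp] = space_exit_law[OF transient]

section \<open>Masses of cylinders and site potentials\<close>

lemma finite_level [simp]: "finite {i. level i = k}"
  by (rule finite_subset[OF _ finite_ball[of k]]) auto

lemma integrable_cyl [simp]:
  fixes f :: "(nat \<Rightarrow> 'a) \<Rightarrow> real"
  shows "integrable exit_law f \<Longrightarrow> integrable exit_law (\<lambda>\<xi>. indicator (cyl i) \<xi> * f \<xi>)"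
  using integrable_mult_indicator[of "cyl i" exit_law f] by simp

lemma mass_add: "integrable exit_law f \<Longrightarrow> integrable exit_law g \<Longrightarrow>
    mass (\<lambda>\<xi>. f \<xi> + g \<xi>) i = mass f i + mass g i"
  by (simp add: mass_def distrib_left)

lemma mass_diff: "integrable exit_law f \<Longrightarrow> integrable exit_law g \<Longrightarrow>
    mass (\<lambda>\<xi>. f \<xi> - g \<xi>) i = mass f i - mass g i"
  by (simp add: mass_def right_diff_distrib)

lemma mass_cmult: "mass (\<lambda>\<xi>. c * f \<xi>) i = c * mass f i"
  by (simp add: mass_def mult.left_commute)

lemma mass_const: "mass (\<lambda>_. c) i = c * measure exit_law (cyl i)"
proof -
  have "cyl i \<inter> rays = cyl i" using cyl_subset_rays by blast
  then show ?thesis by (simp add: mass_def)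
qed

lemma mass_mono: "integrable exit_law f \<Longrightarrow> integrable exit_law g \<Longrightarrow>
    (\<And>\<xi>. \<xi> \<in> rays \<Longrightarrow> f \<xi> \<le> g \<xi>) \<Longrightarrow> mass f i \<le> mass g i"
  unfolding mass_def using cyl_subset_rays
  by (intro integral_mono integrable_cyl mult_left_mono) (auto simp: indicator_def)

lemma mass_nonneg: "(\<And>\<xi>. 0 \<le> f \<xi>) \<Longrightarrow> 0 \<le> mass f i"
  unfolding mass_def by (intro Bochner_Integration.integral_nonneg) auto

lemma abs_mass_le: "\<bar>mass f i\<bar> \<le> mass (\<lambda>\<xi>. \<bar>f \<xi>\<bar>) i"
proof -
  have "\<bar>mass f i\<bar> \<le> (\<integral>\<xi>. \<bar>indicator (cyl i) \<xi> * f \<xi>\<bar> \<partial>exit_law)"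
    unfolding mass_def by (rule integral_abs_bound)
  then show ?thesis by (simp add: mass_def abs_mult)
qed

lemma mass_split:
  assumes "integrable exit_law f"
  shows "mass f i = (\<Sum>j\<in>succs i. mass f j)"
proof -
  have "indicator (cyl i) \<xi> * f \<xi> = (\<Sum>j\<in>succs i. indicator (cyl j) \<xi> * f \<xi>)" for \<xi>
    unfolding cyl_split[of i] sum_distrib_right[symmetric]
    by (subst indicator_UN_disjoint[OF finite_succs disjoint_cyl_succs]) simp
  then have "mass f i = (\<integral>\<xi>. (\<Sum>j\<in>succs i. indicator (cyl j) \<xi> * f \<xi>) \<partial>exit_law)"
    unfolding mass_def by (simp only:)
  also have "\<dots> = (\<Sum>j\<in>succs i. mass f j)"
    unfolding mass_def by (rule Bochner_Integration.integral_sum) (rule integrable_cyl[OF assms])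
  finally show ?thesis .
qed

lemma bounded_integrable:
  fixes f :: "(nat \<Rightarrow> 'a) \<Rightarrow> real"
  assumes "f \<in> borel_measurable boundary_space" "\<And>\<xi>. \<xi> \<in> rays \<Longrightarrow> \<bar>f \<xi>\<bar> \<le> K"
  shows "integrable exit_law f"
  using assms by (intro E.integrable_const_bound[where B = K]) (auto intro!: AE_I2)

lemma has_integral_U_site:
  assumes "integrable exit_law f"
  shows "has_bochner_integral exit_law (\<lambda>\<xi>. U_site i \<xi> * f \<xi>) (site_potential f i)"
proof -
  have main: "has_bochner_integral exit_law (\<lambda>\<xi>. \<Sum>k\<le>level i. incr k * (indicator (cyl (anc k i)) \<xi> * f \<xi>))
      (site_potential f i)"
    unfolding site_potential_def mass_def using assms
    by (intro has_bochner_integral_sum has_bochner_integral_mult_right has_bochner_integral_integrable) auto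
  have "U_site i \<xi> * f \<xi> = (\<Sum>k\<le>level i. incr k * (indicator (cyl (anc k i)) \<xi> * f \<xi>))"
    if "\<xi> \<in> space exit_law" for \<xi>
  proof -
    from that have "\<xi> \<in> rays" by simp
    then show ?thesis by (simp only: U_site_eq sum_distrib_right mult.assoc)
  qed
  from has_bochner_integral_cong[OF refl this refl] main show ?thesis by (rule iffD2)
qed

lemma site_potential_step:
  assumes "i \<noteq> r"
  shows "site_potential f i = site_potential f (pred i) + incr (level i) * mass f i"
proof -
  have "site_potential f i = (\<Sum>k\<le>level (pred i). incr k * mass f (anc k i)) + incr (level i) * mass f i"
    using anc_level[of i] unfolding site_potential_def level_pred[OF assms] by simp
  also have "(\<Sum>k\<le>level (pred i). incr k * mass f (anc k i)) = site_potential f (pred i)"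
    unfolding site_potential_def
    by (intro sum.cong refl) (use level_pred[OF assms] anc_pred[of _ i] in auto)
  finally show ?thesis .
qed

text \<open>The difference of the potential across the edge above \<open>i\<close>, divided by the
  increment, is \<open>mass f i\<close>. Harmonicity is therefore conservation of this flow at each
  site, which is \<open>mass_split\<close>.\<close>

lemma harmonic_site_potential:
  assumes f: "integrable exit_law f"
  shows "harmonic (site_potential f)"
  unfolding harmonic_iff
proof
  fix i
  let ?h = "site_potential f"
  have 1: "ext0 ?h (up i) = ?h i - incr (level i) * mass f i"
  proof (cases "i = r")
    case True
    then show ?thesis by (simp add: up_def site_potential_def)
  next
    case False
    then show ?thesis using site_potential_step[OF False] by (simp add: up_def)
  qed
  have "?h j = ?h i + incr (Suc (level i)) * mass f j" if "j \<in> succs i" for j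
    using that site_potential_step[of j] level_succs[OF that] by (simp add: succs_def)
  then have 2: "(\<Sum>j\<in>succs i. ?h j) = real (card (succs i)) * ?h i + incr (Suc (level i)) * mass f i"
    by (simp add: sum.distrib mass_split[OF f, of i] sum_distrib_left)
  show "ext0 ?h (up i) / incr (level i) + (\<Sum>j\<in>succs i. ?h j) / incr (Suc (level i)) = exit_rate i * ?h i"
    unfolding 1 2 exit_rate_eq by (simp add: diff_divide_distrib add_divide_distrib distrib_right)
qed

lemma sum_measure_cyl:
  "(\<Sum>k\<le>level i. incr k * measure exit_law (cyl (anc k i))) = (w 0 - green i) / exit_prob r"
  by (simp add: measure_exit_law_cyl[OF transient] sum_exit_prob[symmetric] sum_divide_distrib)

lemma exit_prob_r_pos: "0 < exit_prob r"
  by (rule exit_prob_pos[OF transient])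

text \<open>A bound on the potential of the constant 1 that is uniform in the site: it makes the
  potentials of bounded functions bounded.\<close>

lemma sum_measure_cyl_le:
  "(\<Sum>k\<le>level i. incr k * measure exit_law (cyl (anc k i))) \<le> w 0 / exit_prob r"
  using exit_prob_r_pos unfolding sum_measure_cyl by (simp add: divide_right_mono)

lemma sum_measure_ray:
  assumes "\<eta> \<in> rays"
  shows "(\<Sum>k\<le>n. incr k * measure exit_law (cyl (\<eta> k))) = (w 0 - green (\<eta> n)) / exit_prob r"
  using sum_measure_cyl[of "\<eta> n"] assms by (simp add: anc_ray)

lemma bounded_site_potential:
  assumes "f \<in> borel_measurable boundary_space" "\<And>\<xi>. \<xi> \<in> rays \<Longrightarrow> \<bar>f \<xi>\<bar> \<le> K"
  shows "bounded (range (site_potential f))"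
proof -
  have int: "integrable exit_law f" by (rule bounded_integrable; fact)
  have K: "\<bar>mass f i\<bar> \<le> K * measure exit_law (cyl i)" for i
    using abs_mass_le[of f i] mass_mono[of "\<lambda>\<xi>. \<bar>f \<xi>\<bar>" "\<lambda>_. K" i] int assms(2)
    by (simp add: mass_const)
  obtain \<omega> where "\<omega> \<in> exits_in rays"
    using transient by (metis transient_def equals0I less_irrefl measure_empty)
  then have K0: "0 \<le> K" using assms(2) exit_ray(1) abs_ge_zero order_trans by meson
  have "\<bar>site_potential f i\<bar> \<le> K * (w 0 / exit_prob r)" for i
  proof -
    have "\<bar>site_potential f i\<bar> \<le> (\<Sum>k\<le>level i. incr k * \<bar>mass f (anc k i)\<bar>)"
      unfolding site_potential_def by (rule order_trans[OF sum_abs]) (simp add: abs_mult)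
    also have "\<dots> \<le> (\<Sum>k\<le>level i. incr k * (K * measure exit_law (cyl (anc k i))))"
      by (intro sum_mono mult_left_mono K) simp
    also have "\<dots> = K * (\<Sum>k\<le>level i. incr k * measure exit_law (cyl (anc k i)))"
      by (simp add: sum_distrib_left mult.left_commute)
    also have "\<dots> \<le> K * (w 0 / exit_prob r)"
      by (intro mult_left_mono sum_measure_cyl_le K0)
    finally show ?thesis .
  qed
  then show ?thesis unfolding bounded_iff by (intro exI[of _ "K * (w 0 / exit_prob r)"]) auto
qed

section \<open>Pairings level by level and their summability\<close>

lemma mass_ray_eq:
  assumes "\<eta> \<in> rays"
  shows "mass f (\<eta> k) = (\<Sum>i | level i = k. indicator (cyl i) \<eta> * mass f i)"
proof -
  have "(\<Sum>i | level i = k. indicator (cyl i) \<eta> * mass f i) =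
      (\<Sum>i | level i = k. if i = \<eta> k then mass f i else 0)"
    using assms by (intro sum.cong) (auto simp: cyl_iff)
  then show ?thesis using assms by (simp add: sum.delta)
qed

text \<open>As a function of \<open>\<eta>\<close>, \<open>mass f (\<eta> k)\<close> is a finite
  combination of indicators of the cylinders of level \<open>k\<close>. Integration against
  \<open>g\<close> thus gives a finite sum that is symmetric in \<open>f\<close> and
  \<open>g\<close>.\<close>

lemma
  assumes g: "integrable exit_law g"
  shows integrable_mass_ray: "integrable exit_law (\<lambda>\<eta>. g \<eta> * mass f (\<eta> k))"
    and integral_mass_ray: "(\<integral>\<eta>. g \<eta> * mass f (\<eta> k) \<partial>exit_law) = level_pairing f g k"
proof -
  have eq: "g \<eta> * mass f (\<eta> k) = (\<Sum>i | level i = k. mass f i * (indicator (cyl i) \<eta> * g \<eta>))"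
    if "\<eta> \<in> space exit_law" for \<eta>
  proof -
    from that have "\<eta> \<in> rays" by simp
    then show ?thesis by (simp only: mass_ray_eq sum_distrib_left) (simp only: mult_ac)
  qed
  show "integrable exit_law (\<lambda>\<eta>. g \<eta> * mass f (\<eta> k))"
    by (subst Bochner_Integration.integrable_cong[OF refl eq]) (use g in auto)
  have "(\<integral>\<eta>. g \<eta> * mass f (\<eta> k) \<partial>exit_law) =
      (\<integral>\<eta>. (\<Sum>i | level i = k. mass f i * (indicator (cyl i) \<eta> * g \<eta>)) \<partial>exit_law)"
    by (rule Bochner_Integration.integral_cong[OF refl eq])
  also have "\<dots> = level_pairing f g k"
    using g by (simp add: level_pairing_def mass_def)
  finally show "(\<integral>\<eta>. g \<eta> * mass f (\<eta> k) \<partial>exit_law) = level_pairing f g k" .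
qed

lemma level_pairing_commute: "level_pairing f g k = level_pairing g f k"
  by (simp add: level_pairing_def mult.commute)

lemma level_pairing_abs_nonneg: "0 \<le> level_pairing (\<lambda>\<xi>. \<bar>f \<xi>\<bar>) (\<lambda>\<xi>. \<bar>g \<xi>\<bar>) k"
  unfolding level_pairing_def by (intro sum_nonneg mult_nonneg_nonneg mass_nonneg) auto

text \<open>Replacing \<open>g\<close> by its bound \<open>K\<close> leaves
  \<open>\<bar>f\<bar>\<close> integrated against the partial sums of the potential of a constant,
  which are bounded by a multiple of \<open>w 0 / exit_prob r\<close>.\<close>

lemma summable_pairing:
  assumes f: "integrable exit_law f"
    and g: "g \<in> borel_measurable boundary_space" "\<And>\<xi>. \<xi> \<in> rays \<Longrightarrow> \<bar>g \<xi>\<bar> \<le> K"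
  shows "summable (\<lambda>k. incr k * level_pairing (\<lambda>\<xi>. \<bar>f \<xi>\<bar>) (\<lambda>\<xi>. \<bar>g \<xi>\<bar>) k)"
proof (rule summableI_nonneg_bounded)
  have g': "integrable exit_law g" by (rule bounded_integrable; fact)
  have le: "level_pairing (\<lambda>\<xi>. \<bar>f \<xi>\<bar>) (\<lambda>\<xi>. \<bar>g \<xi>\<bar>) k \<le> level_pairing (\<lambda>_. K) (\<lambda>\<xi>. \<bar>f \<xi>\<bar>) k" for k
    unfolding level_pairing_def
  proof (rule sum_mono)
    fix i
    have "mass (\<lambda>\<xi>. \<bar>g \<xi>\<bar>) i \<le> mass (\<lambda>_. K) i"
      using g g' by (intro mass_mono) auto
    then have "mass (\<lambda>\<xi>. \<bar>g \<xi>\<bar>) i * mass (\<lambda>\<xi>. \<bar>f \<xi>\<bar>) i \<le> mass (\<lambda>_. K) i * mass (\<lambda>\<xi>. \<bar>f \<xi>\<bar>) i"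
      by (rule mult_right_mono) (simp add: mass_nonneg)
    then show "mass (\<lambda>\<xi>. \<bar>f \<xi>\<bar>) i * mass (\<lambda>\<xi>. \<bar>g \<xi>\<bar>) i \<le> mass (\<lambda>_. K) i * mass (\<lambda>\<xi>. \<bar>f \<xi>\<bar>) i"
      by (simp only: mult.commute)
  qed
  fix n
  have "(\<Sum>k<n. incr k * level_pairing (\<lambda>\<xi>. \<bar>f \<xi>\<bar>) (\<lambda>\<xi>. \<bar>g \<xi>\<bar>) k) \<le>
      (\<Sum>k<n. incr k * level_pairing (\<lambda>_. K) (\<lambda>\<xi>. \<bar>f \<xi>\<bar>) k)"
    by (intro sum_mono mult_left_mono le) simp
  also have "\<dots> \<le> (\<Sum>k\<le>n. incr k * level_pairing (\<lambda>_. K) (\<lambda>\<xi>. \<bar>f \<xi>\<bar>) k)"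
    using order_trans[OF level_pairing_abs_nonneg le]
    by (intro sum_mono2) auto
  also have "\<dots> = (\<integral>\<eta>. (\<Sum>k\<le>n. incr k * (\<bar>f \<eta>\<bar> * mass (\<lambda>_. K) (\<eta> k))) \<partial>exit_law)"
    using f by (simp add: integral_mass_ray integrable_mass_ray)
  also have "\<dots> = (\<integral>\<eta>. \<bar>f \<eta>\<bar> * (K * ((w 0 - green (\<eta> n)) / exit_prob r)) \<partial>exit_law)"
    by (intro Bochner_Integration.integral_cong refl)
      (simp add: mass_const sum_measure_ray[symmetric] sum_distrib_left mult_ac)
  also have "\<dots> \<le> (\<integral>\<eta>. \<bar>f \<eta>\<bar> * (\<bar>K\<bar> * (w 0 / exit_prob r)) \<partial>exit_law)"
  proof (rule integral_mono')
    fix \<eta> :: "nat \<Rightarrow> 'a"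
    have *: "0 \<le> (w 0 - green (\<eta> n)) / exit_prob r" "(w 0 - green (\<eta> n)) / exit_prob r \<le> w 0 / exit_prob r"
      using exit_prob_r_pos green_le[of "\<eta> n"] by (simp_all add: divide_right_mono)
    have "K * ((w 0 - green (\<eta> n)) / exit_prob r) \<le> \<bar>K\<bar> * ((w 0 - green (\<eta> n)) / exit_prob r)"
      using *(1) by (intro mult_right_mono) auto
    also have "\<dots> \<le> \<bar>K\<bar> * (w 0 / exit_prob r)"
      using *(2) by (intro mult_left_mono) auto
    finally show "\<bar>f \<eta>\<bar> * (K * ((w 0 - green (\<eta> n)) / exit_prob r)) \<le> \<bar>f \<eta>\<bar> * (\<bar>K\<bar> * (w 0 / exit_prob r))"
      by (rule mult_left_mono) simp
    show "0 \<le> \<bar>f \<eta>\<bar> * (\<bar>K\<bar> * (w 0 / exit_prob r))"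
      using exit_prob_r_pos w_pos[of 0] by simp
  qed (use f in simp)
  finally show "(\<Sum>k<n. incr k * level_pairing (\<lambda>\<xi>. \<bar>f \<xi>\<bar>) (\<lambda>\<xi>. \<bar>g \<xi>\<bar>) k) \<le>
    (\<integral>\<eta>. \<bar>f \<eta>\<bar> * (\<bar>K\<bar> * (w 0 / exit_prob r)) \<partial>exit_law)" .
qed (simp add: level_pairing_abs_nonneg)

text \<open>The potential of an integrable function may be infinite on some rays. Its pairing with
  the constant 1 is finite, however, so the potential of \<open>\<bar>f\<bar>\<close> has finite
  integral and is finite almost everywhere.\<close>

lemma AE_summable_mass:
  assumes f: "integrable exit_law f"
  shows "AE \<eta> in exit_law. summable (\<lambda>k. incr k * mass (\<lambda>\<xi>. \<bar>f \<xi>\<bar>) (\<eta> k))"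
proof -
  let ?c = "\<lambda>k. incr k * level_pairing (\<lambda>\<xi>. \<bar>f \<xi>\<bar>) (\<lambda>_. 1) k"
  have int: "integrable exit_law (\<lambda>\<eta>. incr k * mass (\<lambda>\<xi>. \<bar>f \<xi>\<bar>) (\<eta> k))" for k
    using integrable_mass_ray[of "\<lambda>_. 1" "\<lambda>\<xi>. \<bar>f \<xi>\<bar>" k] by simp
  have nn: "0 \<le> incr k * mass (\<lambda>\<xi>. \<bar>f \<xi>\<bar>) i" for k i
    by (intro mult_nonneg_nonneg mass_nonneg) auto
  have [measurable]: "(\<lambda>\<eta>. ennreal (incr k * mass (\<lambda>\<xi>. \<bar>f \<xi>\<bar>) (\<eta> k))) \<in> borel_measurable exit_law" for k
    by (rule measurable_compose[OF borel_measurable_integrable[OF int] measurable_ennreal])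
  have "(\<integral>\<^sup>+\<eta>. (\<Sum>k. ennreal (incr k * mass (\<lambda>\<xi>. \<bar>f \<xi>\<bar>) (\<eta> k))) \<partial>exit_law) =
      (\<Sum>k. \<integral>\<^sup>+\<eta>. ennreal (incr k * mass (\<lambda>\<xi>. \<bar>f \<xi>\<bar>) (\<eta> k)) \<partial>exit_law)"
    by (intro nn_integral_suminf) measurable
  also have "\<dots> = (\<Sum>k. ennreal (?c k))"
    using integral_mass_ray[of "\<lambda>_. 1" "\<lambda>\<xi>. \<bar>f \<xi>\<bar>"]
    by (intro suminf_cong, subst nn_integral_eq_integral[OF int]) (auto simp: nn)
  also have "\<dots> = ennreal (suminf ?c)"
    using summable_pairing[OF f, of "\<lambda>_. 1" 1] level_pairing_abs_nonneg[of f "\<lambda>_. 1"]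
    by (intro suminf_ennreal2) auto
  finally have fin: "(\<integral>\<^sup>+\<eta>. (\<Sum>k. ennreal (incr k * mass (\<lambda>\<xi>. \<bar>f \<xi>\<bar>) (\<eta> k))) \<partial>exit_law) \<noteq> \<infinity>"
    by simp
  have "AE \<eta> in exit_law. (\<Sum>k. ennreal (incr k * mass (\<lambda>\<xi>. \<bar>f \<xi>\<bar>) (\<eta> k))) \<noteq> \<infinity>"
    by (intro nn_integral_PInf_AE fin) measurable
  then show ?thesis
    by eventually_elim (intro summable_suminf_not_top, auto intro: nn)
qed

text \<open>\<open>ennreal\<close> sends negative values to 0, so the integrand contains the
  positive part of \<open>f\<close>. Summability keeps the integral finite, and
  \<open>enn2real\<close> then returns its true value.\<close>

lemma W_nonneg_part:
  assumes "f \<in> borel_measurable boundary_space" "\<eta> \<in> rays" "integrable exit_law (\<lambda>\<xi>. max 0 (f \<xi>))"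
    and "summable (\<lambda>k. incr k * mass (\<lambda>\<xi>. max 0 (f \<xi>)) (\<eta> k))"
  shows "(\<lambda>k. incr k * mass (\<lambda>\<xi>. max 0 (f \<xi>)) (\<eta> k)) sums
    enn2real (\<integral>\<^sup>+\<xi>. U_ray \<eta> \<xi> * ennreal (f \<xi>) \<partial>exit_law)"
proof -
  have nn: "0 \<le> incr k * mass (\<lambda>\<xi>. max 0 (f \<xi>)) i" for k i
    by (intro mult_nonneg_nonneg mass_nonneg) auto
  have [measurable]: "f \<in> borel_measurable exit_law" using assms(1) by simp
  have "(\<integral>\<^sup>+\<xi>. U_ray \<eta> \<xi> * ennreal (f \<xi>) \<partial>exit_law) =
      (\<integral>\<^sup>+\<xi>. (\<Sum>k. ennreal (incr k) * (indicator (cyl (\<eta> k)) \<xi> * ennreal (f \<xi>))) \<partial>exit_law)"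
    by (intro nn_integral_cong) (simp add: U_ray_eq assms(2) mult.assoc flip: ennreal_suminf_multc)
  also have "\<dots> = (\<Sum>k. \<integral>\<^sup>+\<xi>. ennreal (incr k) * (indicator (cyl (\<eta> k)) \<xi> * ennreal (f \<xi>)) \<partial>exit_law)"
    by (intro nn_integral_suminf) measurable
  also have "\<dots> = (\<Sum>k. ennreal (incr k * mass (\<lambda>\<xi>. max 0 (f \<xi>)) (\<eta> k)))"
  proof (rule suminf_cong)
    fix k
    have "(\<integral>\<^sup>+\<xi>. ennreal (incr k) * (indicator (cyl (\<eta> k)) \<xi> * ennreal (f \<xi>)) \<partial>exit_law) =
        ennreal (incr k) * (\<integral>\<^sup>+\<xi>. ennreal (indicator (cyl (\<eta> k)) \<xi> * max 0 (f \<xi>)) \<partial>exit_law)"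
      by (subst nn_integral_cmult) (auto intro!: arg_cong2[where f = "(*)"] nn_integral_cong
          simp: indicator_def max_def ennreal_neg)
    also have "\<dots> = ennreal (incr k * mass (\<lambda>\<xi>. max 0 (f \<xi>)) (\<eta> k))"
      unfolding mass_def using assms(3)
      by (subst nn_integral_eq_integral) (auto simp: ennreal_mult)
    finally show "(\<integral>\<^sup>+\<xi>. ennreal (incr k) * (indicator (cyl (\<eta> k)) \<xi> * ennreal (f \<xi>)) \<partial>exit_law) =
      ennreal (incr k * mass (\<lambda>\<xi>. max 0 (f \<xi>)) (\<eta> k))" .
  qed
  also have "\<dots> = ennreal (\<Sum>k. incr k * mass (\<lambda>\<xi>. max 0 (f \<xi>)) (\<eta> k))"
    by (intro suminf_ennreal2 nn assms(4))
  finally show ?thesis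
    using assms(4) by (simp add: enn2real_ennreal suminf_nonneg nn summable_sums)
qed

lemma W_sums:
  assumes f: "integrable exit_law f" and \<eta>: "\<eta> \<in> rays"
    and "summable (\<lambda>k. incr k * mass (\<lambda>\<xi>. \<bar>f \<xi>\<bar>) (\<eta> k))"
  shows "(\<lambda>k. incr k * mass f (\<eta> k)) sums W exit_law f \<eta>"
proof -
  \<comment> \<open>Stated for every \<open>g\<close> with the same absolute value as
    \<open>f\<close>, so that it can be used for \<open>f\<close> and for \<open>- f\<close>, the
    two parts in the definition of \<open>W\<close>.\<close>
  have part: "(\<lambda>k. incr k * mass (\<lambda>\<xi>. max 0 (g \<xi>)) (\<eta> k)) sums
      enn2real (\<integral>\<^sup>+\<xi>. U_ray \<eta> \<xi> * ennreal (g \<xi>) \<partial>exit_law)"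
    if g: "integrable exit_law g" "\<And>\<xi>. \<bar>g \<xi>\<bar> = \<bar>f \<xi>\<bar>" for g
  proof (rule W_nonneg_part)
    show "g \<in> borel_measurable boundary_space" using borel_measurable_integrable[OF g(1)] by simp
    show int: "integrable exit_law (\<lambda>\<xi>. max 0 (g \<xi>))" using g(1) by simp
    have "\<bar>incr k * mass (\<lambda>\<xi>. max 0 (g \<xi>)) i\<bar> \<le> incr k * mass (\<lambda>\<xi>. \<bar>f \<xi>\<bar>) i" for k i
    proof -
      have "\<bar>mass (\<lambda>\<xi>. max 0 (g \<xi>)) i\<bar> = mass (\<lambda>\<xi>. max 0 (g \<xi>)) i" by (simp add: mass_nonneg)
      also have "\<dots> \<le> mass (\<lambda>\<xi>. \<bar>f \<xi>\<bar>) i"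
      proof (rule mass_mono)
        show "integrable exit_law (\<lambda>\<xi>. \<bar>f \<xi>\<bar>)" using f by simp
        show "max 0 (g \<xi>) \<le> \<bar>f \<xi>\<bar>" for \<xi> using g(2)[of \<xi>] by linarith
      qed (rule int)
      finally show ?thesis by (simp add: abs_mult mult_left_mono)
    qed
    then show "summable (\<lambda>k. incr k * mass (\<lambda>\<xi>. max 0 (g \<xi>)) (\<eta> k))"
      by (intro summable_comparison_test'[OF assms(3), of 0]) auto
  qed (rule \<eta>)
  have "mass f i = mass (\<lambda>\<xi>. max 0 (f \<xi>)) i - mass (\<lambda>\<xi>. max 0 (- f \<xi>)) i" for i
  proof -
    have "(\<lambda>\<xi>. max 0 (f \<xi>) - max 0 (- f \<xi>)) = f" by (auto simp: max_def)
    then show ?thesis using f mass_diff[of "\<lambda>\<xi>. max 0 (f \<xi>)" "\<lambda>\<xi>. max 0 (- f \<xi>)" i] by simp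
  qed
  then show ?thesis
    using sums_diff[OF part[of f] part[of "\<lambda>\<xi>. - f \<xi>"]] f
    unfolding W_def by (simp add: right_diff_distrib)
qed

lemma AE_W_sums:
  assumes "integrable exit_law f"
  shows "AE \<eta> in exit_law. (\<lambda>k. incr k * mass f (\<eta> k)) sums W exit_law f \<eta>"
  using AE_summable_mass[OF assms] AE_space by eventually_elim (simp add: W_sums assms)

text \<open>Linearity is obtained by adding series and only almost everywhere: where a defining
  integral is infinite, \<open>enn2real\<close> replaces it by 0.\<close>

lemma W_add:
  assumes f: "integrable exit_law f" and g: "integrable exit_law g"
  shows "AE \<eta> in exit_law. W exit_law (\<lambda>\<xi>. f \<xi> + g \<xi>) \<eta> = W exit_law f \<eta> + W exit_law g \<eta>"
  using AE_W_sums[OF f] AE_W_sums[OF g] AE_W_sums[OF Bochner_Integration.integrable_add[OF f g]]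
  by eventually_elim
    (rule sums_unique2, assumption, use sums_add f g in \<open>simp add: mass_add distrib_left\<close>)

lemma W_cmult:
  assumes f: "integrable exit_law f"
  shows "AE \<eta> in exit_law. W exit_law (\<lambda>\<xi>. c * f \<xi>) \<eta> = c * W exit_law f \<eta>"
proof -
  have "integrable exit_law (\<lambda>\<xi>. c * f \<xi>)" using f by simp
  from AE_W_sums[OF f] AE_W_sums[OF this] show ?thesis
    by eventually_elim
      (rule sums_unique2, assumption, use sums_mult[where c = c] in \<open>simp add: mass_cmult mult.left_commute\<close>)
qed

text \<open>Self-adjointness of \<open>W\<close> in the form of a series: \<open>W f\<close> is
  expanded along the ray and integrated term by term, which the summability of the pairing of
  absolute values permits. The resulting series is symmetric in \<open>f\<close> and
  \<open>g\<close>.\<close>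

lemma W_duality:
  assumes f: "integrable exit_law f" and g: "integrable exit_law g"
    and summ: "summable (\<lambda>k. incr k * level_pairing (\<lambda>\<xi>. \<bar>f \<xi>\<bar>) (\<lambda>\<xi>. \<bar>g \<xi>\<bar>) k)"
    and \<psi>: "\<psi> \<in> borel_measurable boundary_space" "AE \<eta> in exit_law. W exit_law f \<eta> = \<psi> \<eta>"
  shows "(\<lambda>k. incr k * level_pairing f g k) sums (\<integral>\<eta>. g \<eta> * \<psi> \<eta> \<partial>exit_law)"
proof -
  let ?t = "\<lambda>k \<eta>. incr k * (g \<eta> * mass f (\<eta> k))"
  have int: "integrable exit_law (?t k)" for k
    using integrable_mass_ray[OF g] by simp
  have "AE \<eta> in exit_law. summable (\<lambda>k. norm (?t k \<eta>)) \<and> (\<Sum>k. ?t k \<eta>) = g \<eta> * \<psi> \<eta>"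
    using AE_summable_mass[OF f] AE_W_sums[OF f] \<psi>(2)
  proof eventually_elim
    case (elim \<eta>)
    have "summable (\<lambda>k. \<bar>g \<eta>\<bar> * (incr k * mass (\<lambda>\<xi>. \<bar>f \<xi>\<bar>) (\<eta> k)))"
      using elim(1) by (rule summable_mult)
    then have "summable (\<lambda>k. norm (?t k \<eta>))"
    proof (rule summable_comparison_test'[of _ 0])
      fix k
      have "norm (norm (?t k \<eta>)) = \<bar>g \<eta>\<bar> * (incr k * \<bar>mass f (\<eta> k)\<bar>)"
        by (simp add: abs_mult mult_ac)
      also have "\<dots> \<le> \<bar>g \<eta>\<bar> * (incr k * mass (\<lambda>\<xi>. \<bar>f \<xi>\<bar>) (\<eta> k))"
        by (intro mult_left_mono abs_mass_le) auto
      finally show "norm (norm (?t k \<eta>)) \<le> \<bar>g \<eta>\<bar> * (incr k * mass (\<lambda>\<xi>. \<bar>f \<xi>\<bar>) (\<eta> k))" .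
    qed
    moreover have "(\<lambda>k. ?t k \<eta>) sums (g \<eta> * \<psi> \<eta>)"
      using sums_mult[OF elim(2), of "g \<eta>"] elim(3) by (simp add: mult_ac)
    ultimately show ?case by (simp add: sums_unique[symmetric])
  qed
  then have ae: "AE \<eta> in exit_law. summable (\<lambda>k. norm (?t k \<eta>))"
    and eq: "AE \<eta> in exit_law. (\<Sum>k. ?t k \<eta>) = g \<eta> * \<psi> \<eta>" by auto
  have norm_le: "norm (\<integral>\<eta>. norm (?t k \<eta>) \<partial>exit_law) \<le>
      incr k * level_pairing (\<lambda>\<xi>. \<bar>f \<xi>\<bar>) (\<lambda>\<xi>. \<bar>g \<xi>\<bar>) k" for k
  proof -
    have "norm (\<integral>\<eta>. norm (?t k \<eta>) \<partial>exit_law) = (\<integral>\<eta>. norm (?t k \<eta>) \<partial>exit_law)"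
      by (simp add: Bochner_Integration.integral_nonneg)
    also have "\<dots> \<le> (\<integral>\<eta>. incr k * (\<bar>g \<eta>\<bar> * mass (\<lambda>\<xi>. \<bar>f \<xi>\<bar>) (\<eta> k)) \<partial>exit_law)"
    proof (rule integral_mono)
      show "integrable exit_law (\<lambda>\<eta>. norm (?t k \<eta>))" by (rule integrable_norm[OF int])
      show "integrable exit_law (\<lambda>\<eta>. incr k * (\<bar>g \<eta>\<bar> * mass (\<lambda>\<xi>. \<bar>f \<xi>\<bar>) (\<eta> k)))"
        using integrable_mass_ray[of "\<lambda>\<eta>. \<bar>g \<eta>\<bar>"] g by simp
      show "norm (?t k \<eta>) \<le> incr k * (\<bar>g \<eta>\<bar> * mass (\<lambda>\<xi>. \<bar>f \<xi>\<bar>) (\<eta> k))" for \<eta>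
        by (auto simp: abs_mult intro!: mult_left_mono abs_mass_le)
    qed
    also have "\<dots> = incr k * level_pairing (\<lambda>\<xi>. \<bar>f \<xi>\<bar>) (\<lambda>\<xi>. \<bar>g \<xi>\<bar>) k"
      using g by (simp add: integral_mass_ray)
    finally show ?thesis .
  qed
  have summ': "summable (\<lambda>k. \<integral>\<eta>. norm (?t k \<eta>) \<partial>exit_law)"
    by (rule summable_comparison_test'[OF summ, of 0]) (rule norm_le)
  have meas: "(\<lambda>\<eta>. \<Sum>k. ?t k \<eta>) \<in> borel_measurable exit_law"
    using borel_measurable_integrable[OF int] by measurable
  have "(\<lambda>k. integral\<^sup>L exit_law (?t k)) sums (\<integral>\<eta>. (\<Sum>k. ?t k \<eta>) \<partial>exit_law)"
    by (rule sums_integral[OF int ae summ'])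
  also have "(\<integral>\<eta>. (\<Sum>k. ?t k \<eta>) \<partial>exit_law) = (\<integral>\<eta>. g \<eta> * \<psi> \<eta> \<partial>exit_law)"
    using meas eq \<psi>(1) borel_measurable_integrable[OF g] by (intro integral_cong_AE) auto
  finally show ?thesis
    using g by (simp add: integral_mass_ray)
qed

text \<open>Bounded preimages are required twice: they can be paired with any integrable function by
  \<open>summable_pairing\<close>, and their site potentials are bounded, as
  \<open>harmonic_unique\<close> demands.\<close>

definition bounded_image :: "((nat \<Rightarrow> 'a) \<Rightarrow> real) \<Rightarrow> bool" where
  "bounded_image \<psi> \<longleftrightarrow> (\<exists>f K. f \<in> borel_measurable boundary_space \<and> (\<forall>\<xi>\<in>rays. \<bar>f \<xi>\<bar> \<le> K) \<and>
    (AE \<eta> in exit_law. W exit_law f \<eta> = \<psi> \<eta>))"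

lemma bounded_image_add:
  assumes "bounded_image \<phi>" "bounded_image \<psi>"
  shows "bounded_image (\<lambda>\<xi>. \<phi> \<xi> + \<psi> \<xi>)"
proof -
  obtain f K where f: "f \<in> borel_measurable boundary_space" "\<And>\<xi>. \<xi> \<in> rays \<Longrightarrow> \<bar>f \<xi>\<bar> \<le> K"
    "AE \<eta> in exit_law. W exit_law f \<eta> = \<phi> \<eta>" using assms(1) by (auto simp: bounded_image_def)
  obtain g L where g: "g \<in> borel_measurable boundary_space" "\<And>\<xi>. \<xi> \<in> rays \<Longrightarrow> \<bar>g \<xi>\<bar> \<le> L"
    "AE \<eta> in exit_law. W exit_law g \<eta> = \<psi> \<eta>" using assms(2) by (auto simp: bounded_image_def)
  have "integrable exit_law f" "integrable exit_law g"
    by (rule bounded_integrable; fact)+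
  from f(3) g(3) W_add[OF this] have "AE \<eta> in exit_law. W exit_law (\<lambda>\<xi>. f \<xi> + g \<xi>) \<eta> = \<phi> \<eta> + \<psi> \<eta>"
    by eventually_elim simp
  moreover have "\<bar>f \<xi> + g \<xi>\<bar> \<le> K + L" if "\<xi> \<in> rays" for \<xi>
    using f(2)[OF that] g(2)[OF that] by linarith
  moreover have "(\<lambda>\<xi>. f \<xi> + g \<xi>) \<in> borel_measurable boundary_space" using f g by simp
  ultimately show ?thesis unfolding bounded_image_def by blast
qed

lemma bounded_image_cmult:
  assumes "bounded_image \<phi>"
  shows "bounded_image (\<lambda>\<xi>. c * \<phi> \<xi>)"
proof -
  obtain f K where f: "f \<in> borel_measurable boundary_space" "\<And>\<xi>. \<xi> \<in> rays \<Longrightarrow> \<bar>f \<xi>\<bar> \<le> K"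
    "AE \<eta> in exit_law. W exit_law f \<eta> = \<phi> \<eta>" using assms(1) by (auto simp: bounded_image_def)
  have "integrable exit_law f" by (rule bounded_integrable; fact)
  from f(3) W_cmult[OF this, of c] have "AE \<eta> in exit_law. W exit_law (\<lambda>\<xi>. c * f \<xi>) \<eta> = c * \<phi> \<eta>"
    by eventually_elim simp
  moreover have "\<bar>c * f \<xi>\<bar> \<le> \<bar>c\<bar> * K" if "\<xi> \<in> rays" for \<xi>
    using f(2)[OF that] by (simp add: abs_mult mult_left_mono)
  moreover have "(\<lambda>\<xi>. c * f \<xi>) \<in> borel_measurable boundary_space" using f by simp
  ultimately show ?thesis unfolding bounded_image_def by blast
qed

lemma bounded_image_cong:
  assumes "bounded_image \<phi>" "AE \<eta> in exit_law. \<phi> \<eta> = \<psi> \<eta>"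
  shows "bounded_image \<psi>"
proof -
  obtain f K where f: "f \<in> borel_measurable boundary_space" "\<forall>\<xi>\<in>rays. \<bar>f \<xi>\<bar> \<le> K"
    "AE \<eta> in exit_law. W exit_law f \<eta> = \<phi> \<eta>" using assms(1) by (auto simp: bounded_image_def)
  from f(3) assms(2) have "AE \<eta> in exit_law. W exit_law f \<eta> = \<psi> \<eta>" by eventually_elim simp
  with f show ?thesis unfolding bounded_image_def by blast
qed

lemma bounded_image_sum:
  assumes "finite A" "\<And>a. a \<in> A \<Longrightarrow> bounded_image (\<phi> a)"
  shows "bounded_image (\<lambda>\<xi>. \<Sum>a\<in>A. \<phi> a \<xi>)"
  using assms
proof (induction A rule: finite_induct)
  case empty
  have "W exit_law (\<lambda>_. 0) \<eta> = 0" for \<eta> by (simp add: W_def)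
  then show ?case unfolding bounded_image_def
    by (intro exI[of _ "\<lambda>_. 0"] exI[of _ 0]) simp
next
  case (insert a A)
  then show ?case by (simp add: bounded_image_add)
qed

section \<open>Images of indicators of cylinders under \<open>W\<close>\<close>

lemma cyl_inter_cyl:
  assumes "\<eta> \<in> rays"
  shows "cyl (\<eta> k) \<inter> cyl j =
    (if k < level j then if \<eta> \<in> cyl (anc k j) then cyl j else {}
     else if \<eta> \<in> cyl j then cyl (\<eta> k) else {})"
proof (cases "k < level j")
  case True
  then have "\<xi> k = anc k j" if "\<xi> \<in> cyl j" for \<xi>
    using that anc_ray[of \<xi> k "level j"] by (auto simp: cyl_iff)
  with True assms show ?thesis by (auto simp: cyl_anc_iff ray_in_cyl cyl_iff[of _ j])
next
  case False
  then have "\<xi> (level j) = \<eta> (level j)" if "\<xi> \<in> cyl (\<eta> k)" for \<xi>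
    using that assms ray_eq_mono[of \<xi> \<eta> "level j" k] by (auto simp: ray_in_cyl)
  then have "\<xi> \<in> cyl j \<longleftrightarrow> \<eta> \<in> cyl j" if "\<xi> \<in> cyl (\<eta> k)" for \<xi>
    using that assms cyl_subset_rays by (auto simp only: cyl_iff[of _ j])
  with False show ?thesis by (cases "\<eta> \<in> cyl j") (simp_all only: if_True if_False, blast+)
qed

lemma mass_indicator:
  assumes "\<eta> \<in> rays"
  shows "mass (indicator (cyl j)) (\<eta> k) =
    (if k < level j then measure exit_law (cyl j) * indicator (cyl (anc k j)) \<eta>
     else indicator (cyl j) \<eta> * measure exit_law (cyl (\<eta> k)))"
proof -
  have "mass (indicator (cyl j)) (\<eta> k) = measure exit_law (cyl (\<eta> k) \<inter> cyl j)"
  proof -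
    have "cyl (\<eta> k) \<inter> cyl j \<inter> rays = cyl (\<eta> k) \<inter> cyl j" using cyl_subset_rays by blast
    then show ?thesis unfolding mass_def indicator_inter_arith[symmetric] by simp
  qed
  then show ?thesis by (simp add: cyl_inter_cyl[OF assms])
qed

text \<open>The sum stops just before the level of \<open>j\<close> and so yields the Green function
  at the parent. For \<open>j = r\<close> it is empty, in agreement with
  \<open>green_up r = w 0\<close>.\<close>

lemma sum_measure_below:
  "(\<Sum>k<level j. incr k * measure exit_law (cyl (anc k j))) = (w 0 - green_up j) / exit_prob r"
proof (cases "j = r")
  case True
  then show ?thesis by (simp add: green_up_def)
next
  case False
  have "(\<Sum>k<level j. incr k * measure exit_law (cyl (anc k j))) =
    (\<Sum>k\<le>level (pred j). incr k * measure exit_law (cyl (anc k (pred j))))"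
    unfolding level_pred[OF False] lessThan_Suc_atMost
    by (intro sum.cong refl) (use level_pred[OF False] anc_pred[of _ j] in auto)
  then show ?thesis using False by (simp add: sum_measure_cyl green_up_def)
qed

lemma W_indicator_cyl:
  "AE \<eta> in exit_law. W exit_law (indicator (cyl j)) \<eta> =
    green_up j / exit_prob r * indicator (cyl j) \<eta> +
    measure exit_law (cyl j) * (\<Sum>k<level j. incr k * indicator (cyl (anc k j)) \<eta>)"
proof -
  have int: "integrable exit_law (indicator (cyl j) :: _ \<Rightarrow> real)"
    by (rule bounded_integrable[where K = 1]) (auto simp: indicator_def)
  show ?thesis
    using AE_W_sums[OF int] AE_green_ray[OF transient] AE_space
  proof eventually_elim
    case (elim \<eta>)
    then have \<eta>: "\<eta> \<in> rays" by simp
    let ?m = "\<lambda>i. measure exit_law (cyl i)"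
    \<comment> \<open>As \<open>green\<close> tends to 0 along the ray, the total is the same for
      almost every ray. This is why \<open>W\<close> takes indicators to simple functions.\<close>
    have "(\<lambda>n. \<Sum>k\<le>n. incr k * ?m (\<eta> k)) \<longlonglongrightarrow> (w 0 - 0) / exit_prob r"
      unfolding sum_measure_ray[OF \<eta>] using exit_prob_r_pos elim(2) by (intro tendsto_intros) auto
    then have tot: "(\<lambda>k. incr k * ?m (\<eta> k)) sums (w 0 / exit_prob r)"
      by (simp add: sums_def_le)
    have 1: "(\<lambda>k. if k < level j then incr k * (?m j * indicator (cyl (anc k j)) \<eta>) else 0) sums
        (\<Sum>k<level j. incr k * (?m j * indicator (cyl (anc k j)) \<eta>))"
      using sums_If_finite[of "\<lambda>k. k < level j"] by (simp add: lessThan_def)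
    have 2: "(\<lambda>k. if k < level j then incr k * ?m (anc k j) else 0) sums ((w 0 - green_up j) / exit_prob r)"
      using sums_If_finite[of "\<lambda>k. k < level j" "\<lambda>k. incr k * ?m (anc k j)"] sum_measure_below[of j]
      by (simp add: lessThan_def)
    \<comment> \<open>On the cylinder of \<open>j\<close> the terms from level
      \<open>level j\<close> on are the total minus the terms below, where the vertices of the ray
      are ancestors of \<open>j\<close>. Below that level every ray in the cylinder of the ancestor
      contributes the mass of the cylinder of \<open>j\<close>.\<close>
    have "(\<lambda>k. (if k < level j then incr k * (?m j * indicator (cyl (anc k j)) \<eta>) else 0) +
        indicator (cyl j) \<eta> * (incr k * ?m (\<eta> k) - (if k < level j then incr k * ?m (anc k j) else 0)))
      sums ((\<Sum>k<level j. incr k * (?m j * indicator (cyl (anc k j)) \<eta>)) +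
        indicator (cyl j) \<eta> * (w 0 / exit_prob r - (w 0 - green_up j) / exit_prob r))"
      by (intro sums_add sums_mult sums_diff tot 1 2)
    moreover have "(if k < level j then incr k * (?m j * indicator (cyl (anc k j)) \<eta>) else 0) +
        indicator (cyl j) \<eta> * (incr k * ?m (\<eta> k) - (if k < level j then incr k * ?m (anc k j) else 0)) =
      incr k * mass (indicator (cyl j)) (\<eta> k)" for k
    proof (cases "k < level j")
      case True
      then have "\<eta> \<in> cyl j \<Longrightarrow> \<eta> k = anc k j"
        using anc_ray[of \<eta> k "level j"] by (auto simp: cyl_iff)
      with True show ?thesis by (auto simp: mass_indicator[OF \<eta>] indicator_def)
    qed (simp add: mass_indicator[OF \<eta>])
    ultimately have "(\<lambda>k. incr k * mass (indicator (cyl j)) (\<eta> k)) sums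
      ((\<Sum>k<level j. incr k * (?m j * indicator (cyl (anc k j)) \<eta>)) +
        indicator (cyl j) \<eta> * (w 0 / exit_prob r - (w 0 - green_up j) / exit_prob r))" by simp
    from sums_unique2[OF elim(1) this]
    have "W exit_law (indicator (cyl j)) \<eta> = (\<Sum>k<level j. incr k * (?m j * indicator (cyl (anc k j)) \<eta>)) +
        indicator (cyl j) \<eta> * (green_up j / exit_prob r)" by (simp add: diff_divide_distrib)
    also have "(\<Sum>k<level j. incr k * (?m j * indicator (cyl (anc k j)) \<eta>)) =
        ?m j * (\<Sum>k<level j. incr k * indicator (cyl (anc k j)) \<eta>)"
      by (simp only: sum_distrib_left mult.left_commute)
    finally show ?case by (simp only: add.commute mult.commute)
  qed
qed

lemma green_up_pos: "0 < green_up j"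
  using green_pos w_pos[of 0] by (simp add: green_up_def)

text \<open>\<open>W_indicator_cyl\<close> is a triangular system with respect to the level, with
  nonzero diagonal because \<open>green_up\<close> is positive. It is solved for the indicator of
  \<open>cyl j\<close>.\<close>

lemma bounded_image_indicator: "bounded_image (indicator (cyl j))"
proof (induction "level j" arbitrary: j rule: less_induct)
  case less
  let ?c = "green_up j / exit_prob r" and ?m = "measure exit_law (cyl j)"
  have c: "?c \<noteq> 0" using green_up_pos[of j] exit_prob_r_pos by simp
  have "bounded_image (\<lambda>\<eta>. W exit_law (indicator (cyl j)) \<eta>)"
    unfolding bounded_image_def
    by (intro exI[of _ "indicator (cyl j)"] exI[of _ 1]) (auto simp: indicator_def)
  moreover have "bounded_image (\<lambda>\<eta>. \<Sum>k<level j. incr k * indicator (cyl (anc k j)) \<eta>)"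
    by (intro bounded_image_sum bounded_image_cmult less) (auto simp: level_anc)
  ultimately have "bounded_image (\<lambda>\<eta>. (1 / ?c) * (W exit_law (indicator (cyl j)) \<eta> +
      (- ?m) * (\<Sum>k<level j. incr k * indicator (cyl (anc k j)) \<eta>)))"
    by (intro bounded_image_cmult bounded_image_add)
  then show ?case
    by (rule bounded_image_cong) (use W_indicator_cyl[of j] in \<open>eventually_elim, use c in simp\<close>)
qed

text \<open>If \<open>e\<close> is a bounded preimage of the indicator of \<open>cyl j\<close>,
  self-adjointness turns the integral of \<open>e\<close> times \<open>W f\<close> into
  \<open>mass f j\<close>. The masses are therefore determined by the image alone.\<close>

lemma mass_eq_if_W_eq:
  assumes f: "integrable exit_law f" and g: "integrable exit_law g"
    and \<psi>: "\<psi> \<in> borel_measurable boundary_space"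
      "AE \<eta> in exit_law. W exit_law f \<eta> = \<psi> \<eta>" "AE \<eta> in exit_law. W exit_law g \<eta> = \<psi> \<eta>"
  shows "mass f = mass g"
proof
  fix j
  obtain e K where e: "e \<in> borel_measurable boundary_space" "\<And>\<xi>. \<xi> \<in> rays \<Longrightarrow> \<bar>e \<xi>\<bar> \<le> K"
    "AE \<eta> in exit_law. W exit_law e \<eta> = indicator (cyl j) \<eta>"
    using bounded_image_indicator[of j] by (auto simp: bounded_image_def)
  have e_int: "integrable exit_law e" by (rule bounded_integrable; fact)
  have "mass u j = (\<integral>\<eta>. e \<eta> * \<psi> \<eta> \<partial>exit_law)"
    if u: "integrable exit_law u" "AE \<eta> in exit_law. W exit_law u \<eta> = \<psi> \<eta>" for u
  proof -
    have s: "summable (\<lambda>k. incr k * level_pairing (\<lambda>\<xi>. \<bar>u \<xi>\<bar>) (\<lambda>\<xi>. \<bar>e \<xi>\<bar>) k)"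
      by (rule summable_pairing; fact)
    have 1: "(\<lambda>k. incr k * level_pairing u e k) sums (\<integral>\<eta>. e \<eta> * \<psi> \<eta> \<partial>exit_law)"
      by (rule W_duality[OF u(1) e_int s \<psi>(1) u(2)])
    have "(\<lambda>k. incr k * level_pairing e u k) sums (\<integral>\<eta>. u \<eta> * indicator (cyl j) \<eta> \<partial>exit_law)"
      using s by (intro W_duality[OF e_int u(1) _ _ e(3)])
        (simp_all add: level_pairing_commute[of "\<lambda>\<xi>. \<bar>u \<xi>\<bar>"])
    then have "(\<lambda>k. incr k * level_pairing u e k) sums mass u j"
      by (simp add: level_pairing_commute[of u] mass_def mult.commute)
    with 1 show ?thesis by (rule sums_unique2[symmetric])
  qed
  with f g \<psi> show "mass f j = mass g j" by simp
qed

lemma simple_fns_cyl: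
  assumes "\<phi> \<in> simple_fns exit_law"
  shows "\<exists>n c. \<forall>\<xi>\<in>rays. \<phi> \<xi> = (\<Sum>j | level j = n. c j * indicator (cyl j) \<xi>)"
proof -
  obtain n where \<phi>: "\<phi> \<in> borel_measurable (restr_to_subalg exit_law (level_field n))"
    using assms by (auto simp: simple_fns_def L2_def)
  have sub: "cyl ` {i. level i = n} \<subseteq> Pow rays" using range_cyl_Pow by blast
  have sets: "sets (level_field n) = sigma_sets rays (cyl ` {i. level i = n})"
    unfolding level_field_def using sub by (rule sets_measure_of)
  have "sets (level_field n) \<subseteq> sets boundary_space"
    unfolding sets boundary_space_def sets_measure_of[OF range_cyl_Pow]
    by (rule sigma_sets_mono') auto
  then have "subalgebra exit_law (level_field n)"
    by (simp add: subalgebra_def level_field_def space_measure_of[OF sub])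
  then have "sets (restr_to_subalg exit_law (level_field n)) = sigma_sets rays (cyl ` {i. level i = n})"
    by (simp add: sets_restr_to_subalg sets)
  moreover have "space (restr_to_subalg exit_law (level_field n)) = rays"
    by (simp add: space_restr_to_subalg)
  ultimately have vim: "\<phi> -` {x} \<inter> rays \<in> sigma_sets rays (cyl ` {i. level i = n})" for x
    using measurable_sets[OF \<phi>, of "{x}"] by simp
  have const: "\<phi> \<xi> = \<phi> \<eta>" if "\<xi> \<in> rays" "\<eta> \<in> rays" "\<xi> n = \<eta> n" for \<xi> \<eta>
  proof -
    \<comment> \<open>The sets that do not separate the two rays form a sigma-field, and it contains
      every cylinder of level \<open>n\<close>.\<close>
    have "\<xi> \<in> A \<longleftrightarrow> \<eta> \<in> A" if "A \<in> sigma_sets rays (cyl ` {i. level i = n})" for A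
      using that by induction (use \<open>\<xi> \<in> rays\<close> \<open>\<eta> \<in> rays\<close> \<open>\<xi> n = \<eta> n\<close> in \<open>auto simp: cyl_iff\<close>)
    from this[OF vim[of "\<phi> \<eta>"]] that show ?thesis by simp
  qed
  define c where "c j = \<phi> (SOME \<xi>. \<xi> \<in> cyl j)" for j
  have "\<phi> \<xi> = (\<Sum>j | level j = n. c j * indicator (cyl j) \<xi>)" if \<xi>: "\<xi> \<in> rays" for \<xi>
  proof -
    have "(SOME \<zeta>. \<zeta> \<in> cyl (\<xi> n)) \<in> cyl (\<xi> n)"
      using \<xi> by (intro someI_ex[of "\<lambda>\<zeta>. \<zeta> \<in> cyl (\<xi> n)"]) (auto simp: ray_in_cyl)
    then have "c (\<xi> n) = \<phi> \<xi>"
      unfolding c_def using \<xi> by (intro const) (auto simp: ray_in_cyl)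
    moreover have "(\<Sum>j | level j = n. c j * indicator (cyl j) \<xi>) =
        (\<Sum>j | level j = n. if j = \<xi> n then c j else 0)"
      using \<xi> by (intro sum.cong) (auto simp: cyl_iff)
    ultimately show ?thesis using \<xi> by (simp add: sum.delta)
  qed
  then show ?thesis by blast
qed

theorem harmonic_representation:
  assumes h: "harmonic h" "bounded (range h)"
    and lim: "AE \<xi> in exit_law. (\<lambda>n. h (\<xi> n)) \<longlonglongrightarrow> \<phi> \<xi>"
    and \<phi>: "\<phi> \<in> simple_fns exit_law"
  shows "\<phi> \<in> dom_W_inv exit_law"
    and "has_bochner_integral exit_law (\<lambda>\<xi>. U_site i \<xi> * W_inv exit_law \<phi> \<xi>) (h i)"
proof -
  obtain n c where c: "\<And>\<xi>. \<xi> \<in> rays \<Longrightarrow> \<phi> \<xi> = (\<Sum>j | level j = n. c j * indicator (cyl j) \<xi>)"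
    using simple_fns_cyl[OF \<phi>] by blast
  have \<phi>_meas: "\<phi> \<in> borel_measurable boundary_space"
  proof (rule measurable_cong[THEN iffD2])
    show "(\<lambda>\<xi>. \<Sum>j | level j = n. c j * indicator (cyl j) \<xi>) \<in> borel_measurable boundary_space"
      by (intro borel_measurable_sum borel_measurable_times borel_measurable_const
        borel_measurable_indicator cyl_sets)
  qed (use c in simp)
  have "\<bar>\<phi> \<xi>\<bar> \<le> (\<Sum>j | level j = n. \<bar>c j\<bar>)" if "\<xi> \<in> rays" for \<xi>
    unfolding c[OF that] by (rule order_trans[OF sum_abs], intro sum_mono) (auto simp: indicator_def)
  note \<phi>_bdd = this
  have L2I: "f \<in> L2 exit_law"
    if "f \<in> borel_measurable boundary_space" "\<And>\<xi>. \<xi> \<in> rays \<Longrightarrow> \<bar>f \<xi>\<bar> \<le> K" for f K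
  proof -
    have "(f \<xi>)\<^sup>2 \<le> K\<^sup>2" if "\<xi> \<in> rays" for \<xi>
      using power_mono[OF \<open>\<And>\<xi>. \<xi> \<in> rays \<Longrightarrow> \<bar>f \<xi>\<bar> \<le> K\<close>[OF that], of 2] by simp
    then have "integrable exit_law (\<lambda>\<xi>. (f \<xi>)\<^sup>2)"
      using that(1) by (intro bounded_integrable[where K = "K\<^sup>2"]) auto
    then show ?thesis using that(1) by (simp add: L2_def)
  qed
  have "bounded_image \<phi>"
  proof (rule bounded_image_cong)
    show "bounded_image (\<lambda>\<xi>. \<Sum>j | level j = n. c j * indicator (cyl j) \<xi>)"
      by (intro bounded_image_sum bounded_image_cmult bounded_image_indicator finite_level)
    show "AE \<eta> in exit_law. (\<Sum>j | level j = n. c j * indicator (cyl j) \<eta>) = \<phi> \<eta>"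
      by (rule AE_I2) (simp only: c exit_law_space)
  qed
  then obtain f K where f: "f \<in> borel_measurable boundary_space" "\<And>\<xi>. \<xi> \<in> rays \<Longrightarrow> \<bar>f \<xi>\<bar> \<le> K"
    "AE \<eta> in exit_law. W exit_law f \<eta> = \<phi> \<eta>" by (auto simp: bounded_image_def)
  have f_int: "integrable exit_law f" by (rule bounded_integrable; fact)
  have ex: "\<exists>f\<in>L2 exit_law. AE \<eta> in exit_law. W exit_law f \<eta> = \<phi> \<eta>"
    using L2I[OF f(1,2)] f(3) by blast
  then show "\<phi> \<in> dom_W_inv exit_law"
    using L2I[OF \<phi>_meas \<phi>_bdd] by (simp add: dom_W_inv_def)
  \<comment> \<open>\<open>W_inv\<close> is given by a choice operator, so square integrability and
    the equation almost everywhere are all that is known of the chosen function; it need not be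
    \<open>f\<close>.\<close>
  have inv: "W_inv exit_law \<phi> \<in> L2 exit_law" "AE \<eta> in exit_law. W exit_law (W_inv exit_law \<phi>) \<eta> = \<phi> \<eta>"
proof -
    from ex have "\<exists>f. f \<in> L2 exit_law \<and> (AE \<eta> in exit_law. W exit_law f \<eta> = \<phi> \<eta>)"
      by (simp only: Bex_def)
    from someI_ex[OF this, folded W_inv_def]
    show "W_inv exit_law \<phi> \<in> L2 exit_law" "AE \<eta> in exit_law. W exit_law (W_inv exit_law \<phi>) \<eta> = \<phi> \<eta>"
      by (rule conjunct1, rule conjunct2)
  qed
  have inv_int: "integrable exit_law (W_inv exit_law \<phi>)"
    using inv(1) unfolding L2_def mem_Collect_eq
    by (elim conjE) (rule E.square_integrable_imp_integrable)
  \<comment> \<open>The chosen preimage may be unbounded, but the site potential depends on masses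
    only. Bounds and limits are therefore proved for \<open>f\<close> and carried over.\<close>
  have mass: "mass (W_inv exit_law \<phi>) = mass f"
    by (rule mass_eq_if_W_eq[OF inv_int f_int \<phi>_meas inv(2) f(3)])
  \<comment> \<open>At the vertices of a ray the site potential of \<open>f\<close> is a partial sum
    of the series for \<open>W f\<close>.\<close>
  have "AE \<eta> in exit_law. (\<lambda>n. site_potential f (\<eta> n)) \<longlonglongrightarrow> \<phi> \<eta>"
    using AE_W_sums[OF f_int] f(3) AE_space
  proof eventually_elim
    case (elim \<eta>)
    then have "(\<lambda>n. \<Sum>k\<le>n. incr k * mass f (\<eta> k)) \<longlonglongrightarrow> \<phi> \<eta>"
      by (simp add: sums_def_le)
    moreover have "site_potential f (\<eta> n) = (\<Sum>k\<le>n. incr k * mass f (\<eta> k))" for n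
      using elim(3) by (simp add: site_potential_def anc_ray)
    ultimately show ?case by simp
  qed
  moreover have bdd: "bounded (range (site_potential f))"
    by (rule bounded_site_potential; fact)
  ultimately have "site_potential f = h"
    using harmonic_unique[OF transient harmonic_site_potential[OF f_int] bdd h _ lim] by blast
  moreover have "site_potential (W_inv exit_law \<phi>) = site_potential f"
    by (rule ext) (simp add: site_potential_def mass)
  ultimately show "has_bochner_integral exit_law (\<lambda>\<xi>. U_site i \<xi> * W_inv exit_law \<phi> \<xi>) (h i)"
    using has_integral_U_site[OF inv_int, of i] by simp
qed

end

end

theorem corollary3p1:
  fixes adj :: "'a \<Rightarrow> 'a \<Rightarrow> bool" and r :: 'a and w :: "nat \<Rightarrow> real"
    and M :: "'b measure" and Y :: "nat \<Rightarrow> 'b \<Rightarrow> 'a option" and T :: "nat \<Rightarrow> 'b \<Rightarrow> real"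
    and \<mu> :: "(nat \<Rightarrow> 'a) measure" and h :: "'a \<Rightarrow> real" and \<phi> :: "(nat \<Rightarrow> 'a) \<Rightarrow> real"
  assumes "minimal_chain adj r w M Y T"
    and "minimal_chain.transient adj r M Y T"
    and "\<mu> = minimal_chain.exit_law adj r M Y T"
    and "tree_matrix.harmonic adj r w h"
    and "AE \<xi> in \<mu>. (\<lambda>n. h (\<xi> n)) \<longlonglongrightarrow> \<phi> \<xi>"
    and "bounded (range h)"
    and "\<phi> \<in> tree_matrix.simple_fns adj r \<mu>"
  shows "\<phi> \<in> tree_matrix.dom_W_inv w \<mu> \<and>
    (\<forall>i. has_bochner_integral \<mu>
           (\<lambda>\<xi>. tree_matrix.U_site adj r w i \<xi> * tree_matrix.W_inv w \<mu> \<phi> \<xi>) (h i))"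
proof -
  interpret minimal_chain adj r w M Y T by (rule assms(1))
  show ?thesis
    using harmonic_representation[OF assms(2,4,6) assms(5)[unfolded assms(3)] assms(7)[unfolded assms(3)]]
    unfolding assms(3) by blast
qed

end
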